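(* Let $\{u_n\}_{n\in\mathbb N}\subset X_\varphi$ satisfy $\sup_{n\in\mathbb N}\mathcal F(u_n)\le C$ for some $C<\infty$. Then there exist a subsequence, not relabelled, and $u\in L^2(\Omega)\cap W^{1,1}(\Omega)$ such that $u_n\to u$ strongly in $L^1(\Omega)$, $u_n\rightharpoonup u$ weakly in $L^2(\Omega)$, and $\nabla u_n\rightharpoonup\nabla u$ weakly in $L^1(\Omega;\mathbb R^N)$.
   Context: $\Omega\subset\mathbb R^N$ is a bounded Lipschitz domain with Lebesgue measure, and $f\in L^2(\Omega)$. Standing assumptions on $\varphi:\Omega\times[0,\infty)\to[0,\infty)$: $x\mapsto\varphi(x,t)$ is measurable for every $t\ge0$; for a.e. $x\in\Omega$ the map $t\mapsto\varphi(x,t)$ is convex, increasing (in the non-strict sense), continuous, and $\varphi(x,0)=0$; $\varphi(\cdot,t)\in L^1(\Omega)$ for every $t\ge0$; there is a constant $C_\Delta$ with $\varphi(x,2t)\le C_\Delta\varphi(x,t)$ for a.e. $x\in\Omega$ and all $t\ge0$; and $\lim_{t\to\infty}\operatorname{ess\,inf}_{x\in\Omega}\varphi(x,t)/t=\infty$. For measurable $v:\Omega\to\mathbb R^N$ set $\rho_\varphi(v):=\int_\Omega\varphi(x,|v(x)|)\,dx$. Define $X_\varphi:=\{u\in L^2(\Omega)\cap W^{1,1}(\Omega): \rho_\varphi(\nabla u)<\infty\}$, where $\nabla u$ is the weak gradient, and $\mathcal F:X_\varphi\to\mathbb R$, $\mathcal F(u):=\frac12\|u-f\|_{L^2(\Omega)}^2+\rho_\varphi(\nabla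 u)$. *)

theory Defs
  imports "HOL-Analysis.Analysis"
begin

section \<open>Bounded Lipschitz domains\<close>

text \<open>
  Near each boundary point the domain is, after a rigid motion, the strict epigraph of a Lipschitz
  function. The unit vector \<open>e\<close> is the local vertical direction, and \<open>g\<close> is a Lipschitz function on
  the hyperplane orthogonal to \<open>e\<close>.
\<close>

definition lipschitz_boundary :: "'a::euclidean_space set \<Rightarrow> bool" where
  "lipschitz_boundary \<Omega> \<longleftrightarrow>
     (\<forall>p\<in>frontier \<Omega>. \<exists>r>0. \<exists>e g L. norm e = 1 \<and> L-lipschitz_on {y. y \<bullet> e = 0} (g :: 'a \<Rightarrow> real) \<and>
        \<Omega> \<inter> ball p r = {x \<in> ball p r. g (x - (x \<bullet> e) *\<^sub>R e) < x \<bullet> e})"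

definition bounded_lipschitz_domain :: "'a::euclidean_space set \<Rightarrow> bool" where
  "bounded_lipschitz_domain \<Omega> \<longleftrightarrow>
     open \<Omega> \<and> connected \<Omega> \<and> \<Omega> \<noteq> {} \<and> bounded \<Omega> \<and> lipschitz_boundary \<Omega>"


section \<open>Lebesgue spaces and weak convergence\<close>

text \<open>
  Elements of \<open>L\<^sup>p\<close> are represented by functions rather than by classes modulo null sets, so \<open>Lp_norm\<close>
  is a seminorm. Only finite exponents \<open>p \<ge> 1\<close> are intended.
\<close>

definition Lp_space :: "real \<Rightarrow> 'a measure \<Rightarrow> ('a \<Rightarrow> 'b::euclidean_space) set" where
  "Lp_space p M = {f \<in> borel_measurable M. integrable M (\<lambda>x. norm (f x) powr p)}"

definition Lp_norm :: "real \<Rightarrow> 'a measure \<Rightarrow> ('a \<Rightarrow> 'b::euclidean_space) \<Rightarrow> real" where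
  "Lp_norm p M f = (LINT x|M. norm (f x) powr p) powr (1 / p)"

text \<open>
  The (topological) dual. Boundedness forces the values of a functional to depend only on the
  equivalence class of its argument; values outside \<open>Lp_space p M\<close> are irrelevant.
\<close>

definition Lp_dual :: "real \<Rightarrow> 'a measure \<Rightarrow> (('a \<Rightarrow> 'b::euclidean_space) \<Rightarrow> real) set" where
  "Lp_dual p M = {\<Lambda>.
     (\<forall>f\<in>Lp_space p M. \<forall>g\<in>Lp_space p M. \<Lambda> (\<lambda>x. f x + g x) = \<Lambda> f + \<Lambda> g) \<and>
     (\<forall>c. \<forall>f\<in>Lp_space p M. \<Lambda> (\<lambda>x. c *\<^sub>R f x) = c * \<Lambda> f) \<and>
     (\<exists>K. \<forall>f\<in>Lp_space p M. \<bar>\<Lambda> f\<bar> \<le> K * Lp_norm p M f)}"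

definition Lp_strongly_tendsto ::
  "real \<Rightarrow> 'a measure \<Rightarrow> (nat \<Rightarrow> 'a \<Rightarrow> 'b::euclidean_space) \<Rightarrow> ('a \<Rightarrow> 'b) \<Rightarrow> bool" where
  "Lp_strongly_tendsto p M v w \<longleftrightarrow>
     (\<forall>n. v n \<in> Lp_space p M) \<and> w \<in> Lp_space p M \<and>
     (\<lambda>n. Lp_norm p M (\<lambda>x. v n x - w x)) \<longlonglongrightarrow> 0"

definition Lp_weakly_tendsto ::
  "real \<Rightarrow> 'a measure \<Rightarrow> (nat \<Rightarrow> 'a \<Rightarrow> 'b::euclidean_space) \<Rightarrow> ('a \<Rightarrow> 'b) \<Rightarrow> bool" where
  "Lp_weakly_tendsto p M v w \<longleftrightarrow>
     (\<forall>n. v n \<in> Lp_space p M) \<and> w \<in> Lp_space p M \<and>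
     (\<forall>\<Lambda>\<in>Lp_dual p M. (\<lambda>n. \<Lambda> (v n)) \<longlonglongrightarrow> \<Lambda> w)"


section \<open>Weak gradients and the Sobolev space\<close>

fun C_k :: "nat \<Rightarrow> ('a::euclidean_space \<Rightarrow> real) \<Rightarrow> bool" where
  "C_k 0 \<psi> \<longleftrightarrow> continuous_on UNIV \<psi>"
| "C_k (Suc k) \<psi> \<longleftrightarrow>
     (\<forall>x. \<psi> differentiable (at x)) \<and>
     (\<forall>b\<in>Basis. C_k k (\<lambda>x. frechet_derivative \<psi> (at x) b))"

text \<open>The space of smooth functions compactly supported in \<open>\<Omega>\<close>, extended by zero to the whole space.\<close>

definition test_functions :: "'a::euclidean_space set \<Rightarrow> ('a \<Rightarrow> real) set" where
  "test_functions \<Omega> =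
     {\<psi>. (\<forall>k. C_k k \<psi>) \<and> compact (closure {x. \<psi> x \<noteq> 0}) \<and> closure {x. \<psi> x \<noteq> 0} \<subseteq> \<Omega>}"

definition locally_integrable :: "'a::euclidean_space set \<Rightarrow> ('a \<Rightarrow> 'b::euclidean_space) \<Rightarrow> bool" where
  "locally_integrable \<Omega> u \<longleftrightarrow> (\<forall>K. compact K \<and> K \<subseteq> \<Omega> \<longrightarrow> set_integrable lebesgue K u)"

definition has_weak_gradient :: "'a::euclidean_space set \<Rightarrow> ('a \<Rightarrow> real) \<Rightarrow> ('a \<Rightarrow> 'a) \<Rightarrow> bool" where
  "has_weak_gradient \<Omega> u g \<longleftrightarrow>
     locally_integrable \<Omega> u \<and> locally_integrable \<Omega> g \<and>
     (\<forall>\<psi>\<in>test_functions \<Omega>. \<forall>b\<in>Basis.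
        (LINT x|lebesgue_on \<Omega>. u x * frechet_derivative \<psi> (at x) b) =
        - (LINT x|lebesgue_on \<Omega>. (g x \<bullet> b) * \<psi> x))"

text \<open>A weak gradient is unique up to null sets; this chooses a representative when one exists.\<close>

definition weak_gradient :: "'a::euclidean_space set \<Rightarrow> ('a \<Rightarrow> real) \<Rightarrow> 'a \<Rightarrow> 'a" where
  "weak_gradient \<Omega> u = (SOME g. has_weak_gradient \<Omega> u g)"

definition W11 :: "'a::euclidean_space set \<Rightarrow> ('a \<Rightarrow> real) set" where
  "W11 \<Omega> = {u \<in> Lp_space 1 (lebesgue_on \<Omega>).
     \<exists>g \<in> Lp_space 1 (lebesgue_on \<Omega>). has_weak_gradient \<Omega> u g}"


section \<open>The integrand and the functional\<close>

definition ess_inf :: "'a measure \<Rightarrow> ('a \<Rightarrow> real) \<Rightarrow> ereal" where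
  "ess_inf M h = Sup {c. AE x in M. c \<le> ereal (h x)}"

text \<open>Only the values \<open>\<phi> x t\<close> with \<open>x \<in> \<Omega>\<close> and \<open>t \<ge> 0\<close> are relevant.\<close>

definition admissible_integrand :: "'a::euclidean_space set \<Rightarrow> ('a \<Rightarrow> real \<Rightarrow> real) \<Rightarrow> bool" where
  "admissible_integrand \<Omega> \<phi> \<longleftrightarrow>
     (\<forall>x\<in>\<Omega>. \<forall>t\<ge>0. \<phi> x t \<ge> 0) \<and>
     (\<forall>t\<ge>0. (\<lambda>x. \<phi> x t) \<in> borel_measurable (lebesgue_on \<Omega>)) \<and>
     (AE x in lebesgue_on \<Omega>.
        convex_on {0..} (\<phi> x) \<and> mono_on {0..} (\<phi> x) \<and> continuous_on {0..} (\<phi> x) \<and> \<phi> x 0 = 0) \<and>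
     (\<forall>t\<ge>0. integrable (lebesgue_on \<Omega>) (\<lambda>x. \<phi> x t)) \<and>
     (\<exists>C. AE x in lebesgue_on \<Omega>. \<forall>t\<ge>0. \<phi> x (2 * t) \<le> C * \<phi> x t) \<and>
     ((\<lambda>t. ess_inf (lebesgue_on \<Omega>) (\<lambda>x. \<phi> x t / t)) \<longlongrightarrow> \<infinity>) at_top"

definition rho :: "'a::euclidean_space set \<Rightarrow> ('a \<Rightarrow> real \<Rightarrow> real) \<Rightarrow> ('a \<Rightarrow> 'a) \<Rightarrow> ennreal" where
  "rho \<Omega> \<phi> v = (\<integral>\<^sup>+x. ennreal (\<phi> x (norm (v x))) \<partial>lebesgue_on \<Omega>)"

definition X_space :: "'a::euclidean_space set \<Rightarrow> ('a \<Rightarrow> real \<Rightarrow> real) \<Rightarrow> ('a \<Rightarrow> real) set" where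
  "X_space \<Omega> \<phi> =
     {u \<in> Lp_space 2 (lebesgue_on \<Omega>) \<inter> W11 \<Omega>. rho \<Omega> \<phi> (weak_gradient \<Omega> u) < \<infinity>}"

text \<open>Intended for \<open>u \<in> X_space \<Omega> \<phi>\<close>, where \<open>rho\<close> is finite and \<open>enn2real\<close> loses nothing.\<close>

definition energy ::
  "'a::euclidean_space set \<Rightarrow> ('a \<Rightarrow> real \<Rightarrow> real) \<Rightarrow> ('a \<Rightarrow> real) \<Rightarrow> ('a \<Rightarrow> real) \<Rightarrow> real" where
  "energy \<Omega> \<phi> f u =
     1 / 2 * (Lp_norm 2 (lebesgue_on \<Omega>) (\<lambda>x. u x - f x))\<^sup>2 +
     enn2real (rho \<Omega> \<phi> (weak_gradient \<Omega> u))"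

end

theory Submission
  imports Defs "HOL-Complex_Analysis.Great_Picard" "HOL-Computational_Algebra.Polynomial"
begin

text \<open>
  The energy bounds \<open>u n\<close> in \<open>L\<^sup>2\<close>, and superlinearity of \<open>\<phi>\<close> makes the gradients uniformly
  integrable. Bounded sequences in \<open>L\<^sup>2\<close> have weakly convergent subsequences (Riesz representation on
  the closed subspace of directions in which the inner products converge); uniformly integrable
  sequences inherit this in \<open>L\<^sup>1\<close> by truncation. The functionals are treated abstractly: if
  \<open>z n\<close> is bounded and tends to \<open>0\<close> against its own span, then greedily chosen sums of \<open>m\<close> terms have
  norm \<open>O(\<surd>m)\<close>, so a bounded functional cannot stay above \<open>\<epsilon> > 0\<close> on infinitely many \<open>z n\<close>.
  For strong convergence, the weak gradient bounds \<open>\<integral> \<bar>z (x + h) - z x\<bar> dx\<close> by \<open>norm h\<close> times its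
  \<open>L\<^sup>1\<close> norm on compact subsets of \<open>\<Omega>\<close>, so \<open>z n\<close> is close to its averages over small balls, which
  converge pointwise by weak convergence. The rest of \<open>\<Omega>\<close> has small measure and is controlled by the
  \<open>L\<^sup>2\<close> bound.
\<close>

section \<open>The spaces \<open>L\<^sup>1\<close> and \<open>L\<^sup>2\<close>\<close>

text \<open>No representation theorem for \<open>Lp_dual\<close> enters. In \<open>L\<^sup>2\<close>
  only the countable table of inner products \<open>L2_inner M (v n) (v m)\<close> has to converge
  along a subsequence, so a diagonal argument suffices without a dense set; directions outside the
  closed span of the sequence are dealt with by boundedness of the functional alone. Functionals on
  \<open>L\<^sup>1\<close> restrict to \<open>L\<^sup>2\<close> on a finite measure space and are
  reduced to this case.

  Uniqueness of weak gradients and the translation bound share one device: an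
  \<open>L\<^sup>1\<close> norm is a supremum of integrals against test functions with values in
  [-1, 1]. Uniqueness is forced by \<open>weak_gradient\<close> being an arbitrary choice that
  carries only local integrability: integrability and the identification of the limit must be
  transferred from another representative.

  Translations and Fubini are carried out on \<open>lborel\<close>, for Borel functions that agree
  almost everywhere with the extension by zero. The radius of the balls is fixed before
  \<open>n\<close>: the translation error is small uniformly in \<open>n\<close>, and only then does
  weak convergence make the averages small.\<close>

lemma Lp_space_1_iff: "f \<in> Lp_space 1 M \<longleftrightarrow> integrable M f"
proof -
  have "integrable M f \<longleftrightarrow> f \<in> borel_measurable M \<and> integrable M (\<lambda>x. norm (f x))"
    using integrable_norm_iff by auto
  then show ?thesis by (simp add: Lp_space_def)
qed

lemma Lp_norm_1: "Lp_norm 1 M f = (LINT x|M. norm (f x))"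
  by (simp add: Lp_norm_def)

definition L2_inner :: "'a measure \<Rightarrow> ('a \<Rightarrow> 'b::euclidean_space) \<Rightarrow> ('a \<Rightarrow> 'b) \<Rightarrow> real" where
  "L2_inner M f g = (LINT x|M. f x \<bullet> g x)"

lemma Lp_space_2_iff:
  "f \<in> Lp_space 2 M \<longleftrightarrow> f \<in> borel_measurable M \<and> integrable M (\<lambda>x. f x \<bullet> f x)"
  by (simp add: Lp_space_def dot_square_norm)

lemma Lp_norm_2: "Lp_norm 2 M f = sqrt (L2_inner M f f)"
  by (simp add: Lp_norm_def L2_inner_def dot_square_norm powr_half_sqrt)

lemma L2_inner_integrable:
  assumes "f \<in> Lp_space 2 M" "g \<in> Lp_space 2 M"
  shows "integrable M (\<lambda>x. f x \<bullet> g x)"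
proof (rule Bochner_Integration.integrable_bound)
  show "integrable M (\<lambda>x. f x \<bullet> f x + g x \<bullet> g x)"
    using assms by (auto simp: Lp_space_2_iff)
  show "(\<lambda>x. f x \<bullet> g x) \<in> borel_measurable M"
    using assms by (auto simp: Lp_space_2_iff)
  have "\<bar>a \<bullet> b\<bar> \<le> a \<bullet> a + b \<bullet> b" for a b :: 'b
  proof -
    have "0 \<le> (a + b) \<bullet> (a + b)" "0 \<le> (a - b) \<bullet> (a - b)" "0 \<le> a \<bullet> a" "0 \<le> b \<bullet> b" by simp_all
    then have "\<bar>2 * (a \<bullet> b)\<bar> \<le> a \<bullet> a + b \<bullet> b"
      by (simp add: inner_simps inner_commute)
    then show ?thesis by linarith
  qed
  then show "AE x in M. norm (f x \<bullet> g x) \<le> norm (f x \<bullet> f x + g x \<bullet> g x)"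
    by (intro AE_I2) (metis abs_of_nonneg add_nonneg_nonneg inner_ge_zero real_norm_def)
qed

lemma Lp_space_2_add:
  assumes "f \<in> Lp_space 2 M" "g \<in> Lp_space 2 M"
  shows "(\<lambda>x. f x + g x) \<in> Lp_space 2 M"
  using assms L2_inner_integrable[OF assms] unfolding Lp_space_2_iff
  by (auto simp: inner_simps inner_commute)

lemma Lp_space_2_scaleR:
  assumes "f \<in> Lp_space 2 M"
  shows "(\<lambda>x. c *\<^sub>R f x) \<in> Lp_space 2 M"
  using assms unfolding Lp_space_2_iff by auto

lemma Lp_space_2_diff:
  assumes "f \<in> Lp_space 2 M" "g \<in> Lp_space 2 M"
  shows "(\<lambda>x. f x - g x) \<in> Lp_space 2 M"
  using Lp_space_2_add[OF assms(1) Lp_space_2_scaleR[OF assms(2), of "-1"]] by simp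

lemma L2_inner_commute: "L2_inner M f g = L2_inner M g f"
  by (simp add: L2_inner_def inner_commute)

lemma L2_inner_nonneg: "0 \<le> L2_inner M f f"
  by (simp add: L2_inner_def)

lemma L2_inner_add_left:
  assumes "f \<in> Lp_space 2 M" "g \<in> Lp_space 2 M" "h \<in> Lp_space 2 M"
  shows "L2_inner M (\<lambda>x. f x + g x) h = L2_inner M f h + L2_inner M g h"
  using assms by (simp add: L2_inner_def inner_simps L2_inner_integrable)

lemma L2_inner_diff_left:
  assumes "f \<in> Lp_space 2 M" "g \<in> Lp_space 2 M" "h \<in> Lp_space 2 M"
  shows "L2_inner M (\<lambda>x. f x - g x) h = L2_inner M f h - L2_inner M g h"
  using assms by (simp add: L2_inner_def inner_simps L2_inner_integrable)

lemma L2_inner_scaleR_left: "L2_inner M (\<lambda>x. c *\<^sub>R f x) h = c * L2_inner M f h"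
  by (simp add: L2_inner_def)

lemma L2_inner_add_right:
  assumes "f \<in> Lp_space 2 M" "g \<in> Lp_space 2 M" "h \<in> Lp_space 2 M"
  shows "L2_inner M h (\<lambda>x. f x + g x) = L2_inner M h f + L2_inner M h g"
  using L2_inner_add_left[OF assms] by (simp add: L2_inner_commute)

lemma L2_inner_diff_right:
  assumes "f \<in> Lp_space 2 M" "g \<in> Lp_space 2 M" "h \<in> Lp_space 2 M"
  shows "L2_inner M h (\<lambda>x. f x - g x) = L2_inner M h f - L2_inner M h g"
  using L2_inner_diff_left[OF assms] by (simp add: L2_inner_commute)

lemma L2_inner_scaleR_right: "L2_inner M h (\<lambda>x. c *\<^sub>R f x) = c * L2_inner M h f"
  by (simp add: L2_inner_def)

lemmas L2_inner_simps = L2_inner_add_left L2_inner_diff_left L2_inner_scaleR_left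
  L2_inner_add_right L2_inner_diff_right L2_inner_scaleR_right
  Lp_space_2_add Lp_space_2_diff Lp_space_2_scaleR

text \<open>A seminorm may vanish on a nonzero function, so \<open>c = 0\<close> is included.
  Besides Cauchy-Schwarz this yields the Euler equation of a minimizer: with \<open>a = 0\<close>
  the linear coefficient must vanish.\<close>

lemma quadratic_nonneg_imp_discriminant:
  fixes a b c :: real
  assumes "\<And>t. 0 \<le> a + 2 * t * b + t\<^sup>2 * c" "c \<ge> 0"
  shows "b\<^sup>2 \<le> a * c"
proof (cases "c = 0")
  case True
  have "b = 0"
  proof (rule ccontr)
    assume "b \<noteq> 0"
    \<comment> \<open>At this \<open>t\<close> the affine function \<open>a + 2 * t * b\<close>
      equals \<open>-1\<close>.\<close>
    then have "2 * (- (a + 1) / (2 * b)) * b = - (a + 1)" by simp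
    then show False using assms(1)[of "- (a + 1) / (2 * b)"] True by simp
  qed
  then show ?thesis using True by simp
next
  case False
  then have "0 < c" using assms(2) by simp
  \<comment> \<open>The value \<open>t = - b / c\<close> minimizes the quadratic.\<close>
  have "0 \<le> c * (a + 2 * (- b / c) * b + (- b / c)\<^sup>2 * c)"
    using assms(1)[of "- b / c"] \<open>0 < c\<close> by (intro mult_nonneg_nonneg) auto
  also have "\<dots> = a * c - b\<^sup>2" using \<open>0 < c\<close> by (simp add: field_simps power2_eq_square)
  finally show ?thesis by simp
qed

lemma L2_Cauchy_Schwarz:
  assumes f: "f \<in> Lp_space 2 M" and g: "g \<in> Lp_space 2 M"
  shows "\<bar>L2_inner M f g\<bar> \<le> sqrt (L2_inner M f f) * sqrt (L2_inner M g g)"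
proof -
  have "0 \<le> L2_inner M f f + 2 * t * L2_inner M f g + t\<^sup>2 * L2_inner M g g" for t
    using L2_inner_nonneg[of M "\<lambda>x. f x + t *\<^sub>R g x"] f g
    by (simp add: L2_inner_simps L2_inner_commute[of M g f] power2_eq_square algebra_simps)
  then have "(L2_inner M f g)\<^sup>2 \<le> L2_inner M f f * L2_inner M g g"
    by (rule quadratic_nonneg_imp_discriminant) (rule L2_inner_nonneg)
  then have "sqrt ((L2_inner M f g)\<^sup>2) \<le> sqrt (L2_inner M f f * L2_inner M g g)"
    by (rule real_sqrt_le_mono)
  then show ?thesis by (simp add: real_sqrt_mult)
qed

lemma Lp_space_2_const: "finite_measure M \<Longrightarrow> (\<lambda>x. c) \<in> Lp_space 2 M"
  by (simp add: Lp_space_2_iff finite_measure.integrable_const)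

lemma Lp_space_2_norm: "f \<in> Lp_space 2 M \<Longrightarrow> (\<lambda>x. norm (f x)) \<in> Lp_space 2 M"
  by (auto simp: Lp_space_2_iff dot_square_norm power2_eq_square)

lemma Lp_space_2_bounded:
  assumes "finite_measure M" "f \<in> borel_measurable M" "\<And>x. x \<in> space M \<Longrightarrow> norm (f x) \<le> B"
  shows "f \<in> Lp_space 2 M"
  unfolding Lp_space_2_iff
proof
  show "integrable M (\<lambda>x. f x \<bullet> f x)"
  proof (rule finite_measure.integrable_const_bound[OF assms(1)])
    show "AE x in M. norm (f x \<bullet> f x) \<le> B\<^sup>2"
      using assms(3) by (intro AE_I2) (auto simp: dot_square_norm power_mono)
  qed (use assms in auto)
qed (fact assms)

lemma Lp_space_2_imp_integrable:
  assumes "finite_measure M" "f \<in> Lp_space 2 M"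
  shows "integrable M f"
  using L2_inner_integrable[OF Lp_space_2_norm[OF assms(2)] Lp_space_2_const[OF assms(1), of 1]] assms(2)
  by (simp add: Lp_space_2_iff integrable_norm_iff)

lemma L1_norm_le_L2_norm:
  assumes "finite_measure M" "f \<in> Lp_space 2 M"
  shows "(LINT x|M. norm (f x)) \<le> sqrt (measure M (space M)) * sqrt (L2_inner M f f)"
  using L2_Cauchy_Schwarz[OF Lp_space_2_norm[OF assms(2)] Lp_space_2_const[OF assms(1), of 1]]
  by (simp add: L2_inner_def dot_square_norm power2_eq_square mult.commute)

section \<open>Bounded functionals on \<open>L\<^sup>1\<close> and \<open>L\<^sup>2\<close>\<close>

lemma L2_inner_mem_Lp_dual:
  assumes "h \<in> Lp_space 2 M"
  shows "(\<lambda>v. L2_inner M v h) \<in> Lp_dual 2 M"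
  unfolding Lp_dual_def mem_Collect_eq
proof (intro conjI ballI allI exI)
  fix f :: "'a \<Rightarrow> 'b" assume f: "f \<in> Lp_space 2 M"
  show "\<bar>L2_inner M f h\<bar> \<le> sqrt (L2_inner M h h) * Lp_norm 2 M f"
    using L2_Cauchy_Schwarz[OF f assms] by (simp add: Lp_norm_2 mult.commute)
qed (use assms in \<open>auto simp: L2_inner_simps\<close>)

text \<open>On a finite measure space the \<open>L\<^sup>1\<close> norm is controlled by the
  \<open>L\<^sup>2\<close> norm. Weak \<open>L\<^sup>2\<close> limits of truncations can therefore
  be tested with functionals given on \<open>L\<^sup>1\<close>.\<close>

lemma Lp_dual_1_subset_2:
  assumes "finite_measure M" "\<Lambda> \<in> Lp_dual 1 M"
  shows "\<Lambda> \<in> Lp_dual 2 M"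
proof -
  have sub: "f \<in> Lp_space 1 M" if "f \<in> Lp_space 2 M" for f :: "'a \<Rightarrow> 'b"
    using Lp_space_2_imp_integrable[OF assms(1) that] by (simp add: Lp_space_1_iff)
  obtain K where K: "\<And>f. f \<in> Lp_space 1 M \<Longrightarrow> \<bar>\<Lambda> f\<bar> \<le> K * Lp_norm 1 M f"
    using assms(2) unfolding Lp_dual_def mem_Collect_eq by blast
  have "\<bar>\<Lambda> f\<bar> \<le> (\<bar>K\<bar> * sqrt (measure M (space M))) * Lp_norm 2 M f" if "f \<in> Lp_space 2 M" for f
  proof -
    have "\<bar>\<Lambda> f\<bar> \<le> K * Lp_norm 1 M f" using K sub that by auto
    also have "\<dots> \<le> \<bar>K\<bar> * Lp_norm 1 M f"
      by (intro mult_right_mono) (auto simp: Lp_norm_1)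
    also have "\<dots> \<le> \<bar>K\<bar> * (sqrt (measure M (space M)) * Lp_norm 2 M f)"
      using L1_norm_le_L2_norm[OF assms(1) that]
      by (intro mult_left_mono) (auto simp: Lp_norm_1 Lp_norm_2)
    finally show ?thesis by (simp add: mult.assoc)
  qed
  then show ?thesis using assms(2) sub by (auto simp: Lp_dual_def)
qed

lemma L1_dual_diff:
  assumes "\<Lambda> \<in> Lp_dual 1 M" "f \<in> Lp_space 1 M" "g \<in> Lp_space 1 M"
  shows "\<Lambda> (\<lambda>x. f x - g x) = \<Lambda> f - \<Lambda> g"
proof -
  have "(\<lambda>x. (-1) *\<^sub>R g x) \<in> Lp_space 1 M" using assms(3) by (simp add: Lp_space_1_iff)
  then have "\<Lambda> (\<lambda>x. f x + (-1) *\<^sub>R g x) = \<Lambda> f + (-1) * \<Lambda> g"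
    using assms by (simp add: Lp_dual_def del: scaleR_minus1_left scaleR_minus_left)
  then show ?thesis by simp
qed

lemma L2_dual_diff:
  assumes "\<Lambda> \<in> Lp_dual 2 M" "f \<in> Lp_space 2 M" "g \<in> Lp_space 2 M"
  shows "\<Lambda> (\<lambda>x. f x - g x) = \<Lambda> f - \<Lambda> g"
proof -
  have "\<Lambda> (\<lambda>x. f x + (-1) *\<^sub>R g x) = \<Lambda> f + (-1) * \<Lambda> g"
    using assms Lp_space_2_scaleR[OF assms(3), of "-1"] by (simp add: Lp_dual_def del: scaleR_minus1_left scaleR_minus_left)
  then show ?thesis by simp
qed

text \<open>The completeness argument of Riesz and Fischer: summable \<open>L\<^sup>1\<close>
  increments converge absolutely almost everywhere, and Fatou carries the distance bounds over to
  the pointwise limit. The exponent \<open>p\<close> of the tail bounds is kept free to serve both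
  \<open>L\<^sup>2\<close> and \<open>L\<^sup>1\<close>.\<close>

lemma Lp_fast_Cauchy_limit:
  fixes F :: "nat \<Rightarrow> 'a \<Rightarrow> 'b::euclidean_space"
  assumes [measurable]: "\<And>i. F i \<in> borel_measurable M"
    and fast: "\<And>i. (\<integral>\<^sup>+x. ennreal (norm (F (Suc i) x - F i x)) \<partial>M) \<le> ennreal (c * (1/2)^i)"
    and c: "c \<ge> 0"
    and tail: "\<And>i j. i \<le> j \<Longrightarrow> (\<integral>\<^sup>+x. ennreal (norm (F i x - F j x) ^ p) \<partial>M) \<le> e i"
  shows "\<exists>G\<in>borel_measurable M. \<forall>i. (\<integral>\<^sup>+x. ennreal (norm (F i x - G x) ^ p) \<partial>M) \<le> e i"
proof -
  have "(\<integral>\<^sup>+x. (\<Sum>i. ennreal (norm (F (Suc i) x - F i x))) \<partial>M)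
      = (\<Sum>i. \<integral>\<^sup>+x. ennreal (norm (F (Suc i) x - F i x)) \<partial>M)"
    by (rule nn_integral_suminf) auto
  also have "\<dots> \<le> (\<Sum>i. ennreal (c * (1/2)^i))"
    by (intro suminf_le fast) auto
  also have "\<dots> = ennreal (\<Sum>i. c * (1/2)^i)"
    using c by (intro suminf_ennreal2) (auto intro!: summable_mult summable_geometric)
  finally have fin: "(\<integral>\<^sup>+x. (\<Sum>i. ennreal (norm (F (Suc i) x - F i x))) \<partial>M) \<noteq> \<infinity>"
    by (auto simp: top_unique)
  have "AE x in M. (\<Sum>i. ennreal (norm (F (Suc i) x - F i x))) \<noteq> \<infinity>"
    by (rule nn_integral_PInf_AE) (use fin in auto)
  then have conv: "AE x in M. convergent (\<lambda>i. F i x)"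
  proof eventually_elim
    case (elim x)
    then have "summable (\<lambda>i. norm (F (Suc i) x - F i x))"
      by (intro summable_suminf_not_top) auto
    then have "summable (\<lambda>i. F (Suc i) x - F i x)" by (rule summable_norm_cancel)
    then have "convergent (\<lambda>n. \<Sum>i<n. F (Suc i) x - F i x)" by (simp add: summable_iff_convergent)
    then have "convergent (\<lambda>n. (\<Sum>i<n. F (Suc i) x - F i x) + F 0 x)"
      by (intro convergent_add convergent_const)
    then show ?case by (simp add: sum_lessThan_telescope[of "\<lambda>i. F i x"])
  qed
  \<comment> \<open>Where the sequence diverges, \<open>lim\<close> is an unspecified value; this
    concerns a null set only.\<close>
  define G where "G x = lim (\<lambda>i. F i x)" for x
  have [measurable]: "G \<in> borel_measurable M" unfolding G_def by measurable
  have "(\<integral>\<^sup>+x. ennreal (norm (F i x - G x) ^ p) \<partial>M) \<le> e i" for i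
  proof -
    have "AE x in M. ennreal (norm (F i x - G x) ^ p) = liminf (\<lambda>j. ennreal (norm (F i x - F j x) ^ p))"
      using conv
    proof eventually_elim
      case (elim x)
      then have "(\<lambda>j. F j x) \<longlonglongrightarrow> G x" unfolding G_def by (simp add: convergent_LIMSEQ_iff)
      then have "(\<lambda>j. ennreal (norm (F i x - F j x) ^ p)) \<longlonglongrightarrow> ennreal (norm (F i x - G x) ^ p)"
        by (intro tendsto_intros)
      then show ?case by (intro lim_imp_Liminf[symmetric]) auto
    qed
    then have "(\<integral>\<^sup>+x. ennreal (norm (F i x - G x) ^ p) \<partial>M)
        = (\<integral>\<^sup>+x. liminf (\<lambda>j. ennreal (norm (F i x - F j x) ^ p)) \<partial>M)"
      by (rule nn_integral_cong_AE)
    also have "\<dots> \<le> liminf (\<lambda>j. \<integral>\<^sup>+x. ennreal (norm (F i x - F j x) ^ p) \<partial>M)"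
      by (rule nn_integral_liminf) auto
    also have "\<dots> \<le> liminf (\<lambda>j. e i)"
      by (intro Liminf_mono eventually_sequentiallyI[of i] tail)
    also have "\<dots> = e i" by (intro Liminf_const) simp
    finally show ?thesis .
  qed
  then show ?thesis by (intro bexI[of _ G]) simp_all
qed

section \<open>Weak compactness in \<open>L\<^sup>2\<close> and \<open>L\<^sup>1\<close>\<close>

lemma nn_integral_norm_squared:
  assumes "f \<in> Lp_space 2 M"
  shows "(\<integral>\<^sup>+x. ennreal (norm (f x) ^ 2) \<partial>M) = ennreal (L2_inner M f f)"
  using assms unfolding L2_inner_def Lp_space_2_iff
  by (simp add: nn_integral_eq_integral dot_square_norm)

text \<open>Finiteness of \<open>M\<close> turns the \<open>L\<^sup>2\<close> bounds into the
  summable \<open>L\<^sup>1\<close> bounds behind almost everywhere convergence; the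
  \<open>L\<^sup>2\<close> bounds themselves survive in the limit.\<close>

lemma L2_fast_Cauchy_limit:
  fixes F :: "nat \<Rightarrow> 'a \<Rightarrow> 'b::euclidean_space"
  assumes M: "finite_measure M" and F: "\<And>i. F i \<in> Lp_space 2 M"
    and tail: "\<And>i j. i \<le> j \<Longrightarrow> L2_inner M (\<lambda>x. F i x - F j x) (\<lambda>x. F i x - F j x) \<le> ((1/2)^i)\<^sup>2"
  shows "\<exists>G\<in>Lp_space 2 M. (\<lambda>i. L2_inner M (\<lambda>x. F i x - G x) (\<lambda>x. F i x - G x)) \<longlonglongrightarrow> 0"
proof -
  have meas: "F i \<in> borel_measurable M" for i using F by (simp add: Lp_space_2_iff)
  have "\<exists>G\<in>borel_measurable M. \<forall>i. (\<integral>\<^sup>+x. ennreal (norm (F i x - G x) ^ 2) \<partial>M) \<le> ennreal (((1/2)^i)\<^sup>2)"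
  proof (rule Lp_fast_Cauchy_limit[OF meas])
    fix i
    have d: "(\<lambda>x. F (Suc i) x - F i x) \<in> Lp_space 2 M" using F by (intro Lp_space_2_diff)
    have "(\<integral>\<^sup>+x. ennreal (norm (F (Suc i) x - F i x)) \<partial>M) = ennreal (LINT x|M. norm (F (Suc i) x - F i x))"
      using Lp_space_2_imp_integrable[OF M d] by (intro nn_integral_eq_integral) auto
    also have "(LINT x|M. norm (F (Suc i) x - F i x))
       \<le> sqrt (measure M (space M)) * sqrt (L2_inner M (\<lambda>x. F (Suc i) x - F i x) (\<lambda>x. F (Suc i) x - F i x))"
      by (rule L1_norm_le_L2_norm[OF M d])
    also have "L2_inner M (\<lambda>x. F (Suc i) x - F i x) (\<lambda>x. F (Suc i) x - F i x)
       = L2_inner M (\<lambda>x. F i x - F (Suc i) x) (\<lambda>x. F i x - F (Suc i) x)"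
      by (simp add: L2_inner_def inner_simps inner_commute algebra_simps)
    also have "sqrt \<dots> \<le> sqrt (((1/2)^i)\<^sup>2)"
      by (intro real_sqrt_le_mono tail) auto
    finally show "(\<integral>\<^sup>+x. ennreal (norm (F (Suc i) x - F i x)) \<partial>M)
        \<le> ennreal (sqrt (measure M (space M)) * (1/2)^i)"
      by (simp add: ennreal_leI mult_left_mono)
  next
    fix i j :: nat assume "i \<le> j"
    then show "(\<integral>\<^sup>+x. ennreal (norm (F i x - F j x) ^ 2) \<partial>M) \<le> ennreal (((1/2)^i)\<^sup>2)"
      using tail by (subst nn_integral_norm_squared) (auto intro!: Lp_space_2_diff F ennreal_leI)
  qed simp
  then obtain G where G[measurable]: "G \<in> borel_measurable M"
    and le: "\<And>i. (\<integral>\<^sup>+x. ennreal (norm (F i x - G x) ^ 2) \<partial>M) \<le> ennreal (((1/2)^i)\<^sup>2)" by blast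
  note [measurable] = meas
  have D: "(\<lambda>x. F i x - G x) \<in> Lp_space 2 M" for i
    unfolding Lp_space_2_iff integrable_iff_bounded
    using le[of i] by (auto simp: dot_square_norm intro: le_less_trans)
  have "(\<lambda>x. F 0 x - (F 0 x - G x)) \<in> Lp_space 2 M"
    by (intro Lp_space_2_diff F D)
  then have "G \<in> Lp_space 2 M" by simp
  moreover have "(\<lambda>i. L2_inner M (\<lambda>x. F i x - G x) (\<lambda>x. F i x - G x)) \<longlonglongrightarrow> 0"
  proof (rule tendsto_sandwich[of "\<lambda>i. 0" _ _ "\<lambda>i. ((1/2)^i)\<^sup>2"])
    show "\<forall>\<^sub>F i in sequentially. L2_inner M (\<lambda>x. F i x - G x) (\<lambda>x. F i x - G x) \<le> ((1/2)^i)\<^sup>2"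
      using le D by (auto simp: nn_integral_norm_squared L2_inner_nonneg)
    show "(\<lambda>i::nat. ((1/2::real)^i)\<^sup>2) \<longlonglongrightarrow> 0"
      using tendsto_power[OF LIMSEQ_power_zero[of "1/2::real"], of 2] by simp
  qed (auto simp: L2_inner_nonneg)
  ultimately show ?thesis by blast
qed

text \<open>\<open>S\<close> is the closed subspace on which \<open>l\<close>, the limit of the inner products with \<open>v n\<close>, exists. The
  weak limit represents \<open>l\<close> on \<open>S\<close>: it is the minimizer of \<open>J\<close>.\<close>

lemma weak_L2_limit_exists:
  fixes v :: "nat \<Rightarrow> 'a \<Rightarrow> 'b::euclidean_space"
  assumes M: "finite_measure M" and v: "\<And>n. v n \<in> Lp_space 2 M"
    and B: "\<And>n. L2_inner M (v n) (v n) \<le> B"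
    and conv: "\<And>m. convergent (\<lambda>n. L2_inner M (v n) (v m))"
  shows "\<exists>w\<in>Lp_space 2 M. (\<forall>m. (\<lambda>n. L2_inner M (v n) (v m)) \<longlonglongrightarrow> L2_inner M w (v m)) \<and>
           (\<lambda>n. L2_inner M (v n) w) \<longlonglongrightarrow> L2_inner M w w"
proof -
  define S where "S = {w \<in> Lp_space 2 M. convergent (\<lambda>n. L2_inner M (v n) w)}"
  define l where "l w = lim (\<lambda>n. L2_inner M (v n) w)" for w
  define J where "J w = L2_inner M w w - 2 * l w" for w
  have S2: "w \<in> Lp_space 2 M" if "w \<in> S" for w using that by (simp add: S_def)
  have l: "(\<lambda>n. L2_inner M (v n) w) \<longlonglongrightarrow> l w" if "w \<in> S" for w
    using that by (simp add: S_def l_def convergent_LIMSEQ_iff)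
  have S_I: "w \<in> S" "l w = a" if "w \<in> Lp_space 2 M" "(\<lambda>n. L2_inner M (v n) w) \<longlonglongrightarrow> a" for w a
    using that by (auto simp: S_def l_def convergent_def limI)
  have S_lin: "(\<lambda>x. a x + t *\<^sub>R b x) \<in> S \<and> l (\<lambda>x. a x + t *\<^sub>R b x) = l a + t * l b"
    if "a \<in> S" "b \<in> S" for a b t
  proof -
    have "(\<lambda>n. L2_inner M (v n) a + t * L2_inner M (v n) b) \<longlonglongrightarrow> l a + t * l b"
      using l that by (intro tendsto_intros)
    then show ?thesis
      using S_I[of "\<lambda>x. a x + t *\<^sub>R b x" "l a + t * l b"] that v S2
      by (auto simp: L2_inner_simps)
  qed
  have expand: "L2_inner M (\<lambda>x. a x + t *\<^sub>R b x) (\<lambda>x. a x + t *\<^sub>R b x)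
      = L2_inner M a a + 2 * t * L2_inner M a b + t\<^sup>2 * L2_inner M b b"
    if "a \<in> Lp_space 2 M" "b \<in> Lp_space 2 M" for a b t
    using that by (simp add: L2_inner_simps L2_inner_commute[of M b a] power2_eq_square algebra_simps)
  \<comment> \<open>Expanding the square of \<open>w - v n\<close> bounds
    \<open>2 * L2_inner M (v n) w\<close> by \<open>L2_inner M w w + B\<close>; the limit in
    \<open>n\<close> bounds \<open>J\<close> from below.\<close>
  have lower: "- B \<le> J w" if "w \<in> S" for w
  proof -
    have "2 * L2_inner M (v n) w \<le> L2_inner M w w + B" for n
      using expand[of w "v n" "-1"] L2_inner_nonneg[of M "\<lambda>x. w x + (-1) *\<^sub>R v n x"] B[of n] S2[OF that] v
      by (simp add: L2_inner_commute[of M w "v n"])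
    then have "2 * l w \<le> L2_inner M w w + B"
      using l[OF that] by (intro LIMSEQ_le_const2[of "\<lambda>n. 2 * L2_inner M (v n) w"] tendsto_intros) auto
    then show ?thesis by (simp add: J_def)
  qed
  have "v 0 \<in> S" using v conv by (simp add: S_def)
  define I where "I = Inf (J ` S)"
  have bdd: "bdd_below (J ` S)" using lower by (auto intro!: bdd_belowI2)
  have I_le: "I \<le> J w" if "w \<in> S" for w
    unfolding I_def using bdd that by (intro cInf_lower) auto
  \<comment> \<open>The tolerance carries the factor \<open>1 / 4\<close> so that the parallelogram
    estimate below yields distances of at most \<open>(1/2)^i\<close>, the rate needed for
    completeness.\<close>
  have "\<exists>w\<in>S. J w < I + ((1/2)^k)\<^sup>2 / 4" for k
    using cInf_lessD[of "J ` S" "I + ((1/2)^k)\<^sup>2 / 4"] \<open>v 0 \<in> S\<close> unfolding I_def by auto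
  then obtain w where w: "\<And>k. w k \<in> S" and Jw: "\<And>k. J (w k) < I + ((1/2)^k)\<^sup>2 / 4" by metis
  have tail: "L2_inner M (\<lambda>x. w i x - w j x) (\<lambda>x. w i x - w j x) \<le> ((1/2)^i)\<^sup>2" if "i \<le> j" for i j
  proof -
    have d: "(\<lambda>x. w i x + (-1) *\<^sub>R w j x) \<in> S" "l (\<lambda>x. w i x + (-1) *\<^sub>R w j x) = l (w i) + (-1) * l (w j)"
      using S_lin[OF w w] by blast+
    define d where "d = (\<lambda>x. w i x + (-1) *\<^sub>R w j x)"
    \<comment> \<open>The competitor is the midpoint of \<open>w i\<close> and \<open>w j\<close>.
      By the parallelogram identity its \<open>J\<close> lies below the mean of
      \<open>J (w i)\<close> and \<open>J (w j)\<close> by a quarter of the squared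
      distance.\<close>
    have m: "I \<le> J (\<lambda>x. w j x + (1/2) *\<^sub>R d x)"
      using S_lin[OF w d(1)] d_def by (intro I_le) auto
    have d2: "d \<in> Lp_space 2 M" using d S2 d_def by auto
    have "J (\<lambda>x. w j x + (1/2) *\<^sub>R d x) = (J (w i) + J (w j)) / 2 - L2_inner M d d / 4"
    proof -
      have "L2_inner M d d = L2_inner M (w i) (w i) - 2 * L2_inner M (w i) (w j) + L2_inner M (w j) (w j)"
        using expand[OF S2[OF w] S2[OF w], of i "-1" j] by (simp add: d_def)
      moreover have "L2_inner M (w j) d = L2_inner M (w j) (w i) - L2_inner M (w j) (w j)"
        unfolding d_def using S2[OF w] by (subst L2_inner_add_right) (auto simp: L2_inner_simps simp del: scaleR_minus1_left scaleR_minus_left)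
      moreover have "J (\<lambda>x. w j x + (1/2) *\<^sub>R d x) =
          L2_inner M (w j) (w j) + L2_inner M (w j) d + (1/4) * L2_inner M d d - 2 * (l (w j) + (1/2) * l d)"
        unfolding J_def using expand[OF S2[OF w] d2, of j "1/2"] S_lin[OF w d(1), of j "1/2"]
        by (simp add: power2_eq_square d_def)
      moreover have "l d = l (w i) - l (w j)" using d(2) by (simp add: d_def)
      ultimately show ?thesis by (simp add: J_def L2_inner_commute[of M "w j" "w i"] field_simps)
    qed
    with m have "L2_inner M d d \<le> 2 * (J (w i) - I) + 2 * (J (w j) - I)" by (simp add: field_simps)
    also have "\<dots> \<le> 2 * (((1/2)^i)\<^sup>2 / 4) + 2 * (((1/2)^j)\<^sup>2 / 4)"
      using Jw[of i] Jw[of j] by simp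
    also have "((1/2::real)^j)\<^sup>2 \<le> ((1/2)^i)\<^sup>2"
      using that by (intro power_mono power_decreasing) auto
    finally show ?thesis by (simp add: d_def)
  qed
  obtain h where h: "h \<in> Lp_space 2 M"
    and hlim: "(\<lambda>i. L2_inner M (\<lambda>x. w i x - h x) (\<lambda>x. w i x - h x)) \<longlonglongrightarrow> 0"
    using L2_fast_Cauchy_limit[OF M S2[OF w] tail] by blast
  have "0 \<le> B" using B[of 0] L2_inner_nonneg[of M "v 0"] by linarith
  \<comment> \<open>Uniformity in \<open>n\<close> is the point: it makes the inner products with
    \<open>h\<close> a Cauchy sequence, so that \<open>h\<close> lies in \<open>S\<close>, and it
    gives convergence of \<open>l (w k)\<close> to \<open>l h\<close>.\<close>
  have unif: "\<bar>L2_inner M (v n) (w k) - L2_inner M (v n) h\<bar> \<le> sqrt B * sqrt (L2_inner M (\<lambda>x. w k x - h x) (\<lambda>x. w k x - h x))" for n k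
  proof -
    have "\<bar>L2_inner M (v n) (\<lambda>x. w k x - h x)\<bar>
        \<le> sqrt (L2_inner M (v n) (v n)) * sqrt (L2_inner M (\<lambda>x. w k x - h x) (\<lambda>x. w k x - h x))"
      using v S2[OF w] h by (intro L2_Cauchy_Schwarz Lp_space_2_diff)
    also have "\<dots> \<le> sqrt B * sqrt (L2_inner M (\<lambda>x. w k x - h x) (\<lambda>x. w k x - h x))"
      using B by (intro mult_right_mono real_sqrt_le_mono) (auto simp: L2_inner_nonneg)
    finally show ?thesis using v S2[OF w] h by (simp add: L2_inner_simps)
  qed
  have unif0: "(\<lambda>k. sqrt B * sqrt (L2_inner M (\<lambda>x. w k x - h x) (\<lambda>x. w k x - h x))) \<longlonglongrightarrow> 0"
    using tendsto_mult_left[OF tendsto_real_sqrt[OF hlim], of "sqrt B"] by simp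
  have "Cauchy (\<lambda>n. L2_inner M (v n) h)"
  proof (rule metric_CauchyI)
    fix e :: real assume "0 < e"
    then obtain k where k: "sqrt B * sqrt (L2_inner M (\<lambda>x. w k x - h x) (\<lambda>x. w k x - h x)) < e / 3"
      using order_tendstoD(2)[OF unif0, of "e/3"] by (auto simp: eventually_sequentially)
    have "Cauchy (\<lambda>n. L2_inner M (v n) (w k))" using l[OF w] by (rule LIMSEQ_imp_Cauchy)
    then obtain N where N: "\<And>m n. m \<ge> N \<Longrightarrow> n \<ge> N \<Longrightarrow> dist (L2_inner M (v m) (w k)) (L2_inner M (v n) (w k)) < e / 3"
      using \<open>0 < e\<close> unfolding Cauchy_def by (metis divide_pos_pos zero_less_numeral)
    have "dist (L2_inner M (v m) h) (L2_inner M (v n) h) < e" if "m \<ge> N" "n \<ge> N" for m n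
      using N[OF that] unif[of m k] unif[of n k] k unfolding dist_real_def by linarith
    then show "\<exists>N. \<forall>m\<ge>N. \<forall>n\<ge>N. dist (L2_inner M (v m) h) (L2_inner M (v n) h) < e" by blast
  qed
  then have hS: "h \<in> S" using h by (simp add: S_def real_Cauchy_convergent)
  have "(\<lambda>k. l (w k)) \<longlonglongrightarrow> l h"
  proof -
    have "\<bar>l (w k) - l h\<bar> \<le> sqrt B * sqrt (L2_inner M (\<lambda>x. w k x - h x) (\<lambda>x. w k x - h x))" for k
      using unif l[OF w, of k] l[OF hS]
      by (intro LIMSEQ_le_const2[of "\<lambda>n. \<bar>L2_inner M (v n) (w k) - L2_inner M (v n) h\<bar>"] tendsto_intros) auto
    then have "(\<lambda>k. l (w k) - l h) \<longlonglongrightarrow> 0"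
      by (intro Lim_null_comparison[OF _ unif0]) auto
    then show ?thesis by (simp add: LIM_zero_iff)
  qed
  moreover have "(\<lambda>k. L2_inner M (w k) (w k)) \<longlonglongrightarrow> L2_inner M h h"
  proof -
    have "(\<lambda>k. L2_inner M (\<lambda>x. w k x - h x) h) \<longlonglongrightarrow> 0"
    proof (rule Lim_null_comparison)
      show "\<forall>\<^sub>F k in sequentially. norm (L2_inner M (\<lambda>x. w k x - h x) h)
        \<le> sqrt (L2_inner M (\<lambda>x. w k x - h x) (\<lambda>x. w k x - h x)) * sqrt (L2_inner M h h)"
        unfolding real_norm_def by (intro always_eventually allI L2_Cauchy_Schwarz Lp_space_2_diff S2[OF w] h)
      show "(\<lambda>k. sqrt (L2_inner M (\<lambda>x. w k x - h x) (\<lambda>x. w k x - h x)) * sqrt (L2_inner M h h)) \<longlonglongrightarrow> 0"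
        using tendsto_mult_right[OF tendsto_real_sqrt[OF hlim], of "sqrt (L2_inner M h h)"] by simp
    qed
    then have "(\<lambda>k. L2_inner M (\<lambda>x. w k x - h x) (\<lambda>x. w k x - h x) + 2 * L2_inner M (\<lambda>x. w k x - h x) h + L2_inner M h h)
       \<longlonglongrightarrow> 0 + 2 * 0 + L2_inner M h h"
      using hlim by (intro tendsto_intros)
    moreover have "L2_inner M (\<lambda>x. w k x - h x) (\<lambda>x. w k x - h x) + 2 * L2_inner M (\<lambda>x. w k x - h x) h + L2_inner M h h
       = L2_inner M (w k) (w k)" for k
      using S2[OF w] h by (simp add: L2_inner_simps L2_inner_commute[of M h "w k"])
    ultimately show ?thesis by simp
  qed
  ultimately have "(\<lambda>k. J (w k)) \<longlonglongrightarrow> J h" unfolding J_def by (intro tendsto_intros)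
  moreover have "(\<lambda>k. I + ((1/2)^k)\<^sup>2 / 4) \<longlonglongrightarrow> I + 0\<^sup>2 / 4"
    by (intro tendsto_add tendsto_divide tendsto_power tendsto_const LIMSEQ_power_zero) auto
  ultimately have "J h \<le> I"
    using Jw by (intro LIMSEQ_le[of "\<lambda>k. J (w k)" "J h" "\<lambda>k. I + ((1/2)^k)\<^sup>2 / 4"]) (auto intro: less_imp_le)
  have l_eq: "l a = L2_inner M h a" if "a \<in> S" for a
  proof -
    \<comment> \<open>First variation of the minimizer \<open>h\<close> in direction
      \<open>a\<close>; the constant term is written as \<open>0\<close> to fit the discriminant
      lemma.\<close>
    have "0 \<le> 0 + 2 * t * (L2_inner M h a - l a) + t\<^sup>2 * L2_inner M a a" for t
    proof -
      have "J h \<le> J (\<lambda>x. h x + t *\<^sub>R a x)" using \<open>J h \<le> I\<close> I_le S_lin[OF hS that, of t] by force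
      also have "\<dots> = J h + 2 * t * (L2_inner M h a - l a) + t\<^sup>2 * L2_inner M a a"
        unfolding J_def using expand[OF h S2[OF that], of t] S_lin[OF hS that, of t] by (simp add: algebra_simps)
      finally show ?thesis by simp
    qed
    then have "(L2_inner M h a - l a)\<^sup>2 \<le> 0 * L2_inner M a a"
      by (rule quadratic_nonneg_imp_discriminant) (rule L2_inner_nonneg)
    then show ?thesis by simp
  qed
  have "v m \<in> S" for m using v conv by (simp add: S_def)
  then show ?thesis using l l_eq h hS by metis
qed

text \<open>Almost orthogonality of the terms takes the place of a vector representing
  \<open>\<Lambda>\<close>. An upper bound is enough, since applying it to
  \<open>- \<Lambda>\<close> supplies the lower one.\<close>

lemma weak_L2_dual_upper:
  assumes \<Lambda>: "\<Lambda> \<in> Lp_dual 2 M" and z: "\<And>n. z n \<in> Lp_space 2 M"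
    and B: "\<And>n. L2_inner M (z n) (z n) \<le> B"
    and lim: "\<And>m. (\<lambda>n. L2_inner M (z m) (z n)) \<longlonglongrightarrow> 0"
    and "\<epsilon> > 0"
  shows "\<forall>\<^sub>F n in sequentially. \<Lambda> (z n) < \<epsilon>"
proof (rule ccontr)
  assume "\<not> ?thesis"
  then have freq: "\<exists>\<^sub>F n in sequentially. \<epsilon> \<le> \<Lambda> (z n)" by (simp add: not_eventually not_less)
  obtain K where K: "\<And>f. f \<in> Lp_space 2 M \<Longrightarrow> \<bar>\<Lambda> f\<bar> \<le> K * Lp_norm 2 M f"
    using \<Lambda> unfolding Lp_dual_def mem_Collect_eq by blast
  have add: "\<Lambda> (\<lambda>x. f x + g x) = \<Lambda> f + \<Lambda> g" if "f \<in> Lp_space 2 M" "g \<in> Lp_space 2 M" for f g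
    using \<Lambda> that by (simp add: Lp_dual_def)
  have "0 \<le> B" using B[of 0] L2_inner_nonneg[of M "z 0"] by linarith
  \<comment> \<open>Each addition costs at most \<open>B\<close> for the square of the new term and
    \<open>2\<close> for twice a cross product below \<open>1\<close>. The case \<open>m = 0\<close>
    is already one term, whence the extra \<open>B\<close>. Keeping the inner products of
    \<open>s\<close> with \<open>z n\<close> convergent to \<open>0\<close> makes the next choice
    possible.\<close>
  have sums: "\<exists>s\<in>Lp_space 2 M. (\<lambda>n. L2_inner M s (z n)) \<longlonglongrightarrow> 0 \<and>
      L2_inner M s s \<le> real m * (B + 2) + B \<and> real m * \<epsilon> \<le> \<Lambda> s" for m
  proof (induction m)
    case 0
    obtain n where "\<epsilon> \<le> \<Lambda> (z n)" using freq frequently_ex by blast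
    then show ?case using z lim B \<open>\<epsilon> > 0\<close> by (intro bexI[of _ "z n"]) auto
  next
    case (Suc m)
    then obtain s where s: "s \<in> Lp_space 2 M" "(\<lambda>n. L2_inner M s (z n)) \<longlonglongrightarrow> 0"
      "L2_inner M s s \<le> real m * (B + 2) + B" "real m * \<epsilon> \<le> \<Lambda> s" by blast
    have "\<forall>\<^sub>F n in sequentially. L2_inner M s (z n) < 1"
      using s(2) by (rule order_tendstoD) simp
    then obtain n where n: "L2_inner M s (z n) < 1" "\<epsilon> \<le> \<Lambda> (z n)"
      using frequently_ex[OF frequently_eventually_frequently[OF freq]] by blast
    have "(\<lambda>k. L2_inner M s (z k) + L2_inner M (z n) (z k)) \<longlonglongrightarrow> 0 + 0"
      by (intro tendsto_intros s lim)
    moreover have "L2_inner M (\<lambda>x. s x + z n x) (\<lambda>x. s x + z n x) \<le> real (Suc m) * (B + 2) + B"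
      using s z n B[of n] by (simp add: L2_inner_simps L2_inner_commute[of M "z n" s] algebra_simps)
    ultimately show ?case
      using s z n by (intro bexI[of _ "\<lambda>x. s x + z n x"]) (auto simp: L2_inner_simps add algebra_simps)
  qed
  \<comment> \<open>Comparing \<open>real m * \<epsilon>\<close> with \<open>K\<close> times the
    norm of \<open>s\<close> would force
    \<open>real m \<le> K\<^sup>2 * (2 * B + 2) / \<epsilon>\<^sup>2\<close>. The added
    \<open>1\<close> ensures \<open>1 \<le> real m\<close>, so that \<open>B\<close> is absorbed
    into \<open>real m * B\<close> and \<open>m\<close> can be cancelled.\<close>
  obtain m :: nat where m: "real m > K\<^sup>2 * (2 * B + 2) / \<epsilon>\<^sup>2 + 1" using reals_Archimedean2 by blast
  obtain s where s: "s \<in> Lp_space 2 M" "L2_inner M s s \<le> real m * (B + 2) + B" "real m * \<epsilon> \<le> \<Lambda> s"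
    using sums[of m] by blast
  have "1 \<le> real m" using m \<open>0 \<le> B\<close> by (smt (verit) divide_nonneg_nonneg mult_nonneg_nonneg zero_le_power2)
  have "(real m * \<epsilon>)\<^sup>2 \<le> \<bar>\<Lambda> s\<bar>\<^sup>2" using s \<open>\<epsilon> > 0\<close> by (intro power_mono) auto
  also have "\<dots> \<le> (K * Lp_norm 2 M s)\<^sup>2" using K[OF s(1)] by (intro power_mono) auto
  also have "\<dots> = K\<^sup>2 * L2_inner M s s" by (simp add: Lp_norm_2 power_mult_distrib L2_inner_nonneg)
  also have "\<dots> \<le> K\<^sup>2 * (real m * (2 * B + 2))"
  proof (intro mult_left_mono)
    have "B \<le> real m * B" using \<open>1 \<le> real m\<close> \<open>0 \<le> B\<close> by (simp add: mult_le_cancel_right1)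
    then show "L2_inner M s s \<le> real m * (2 * B + 2)" using s(2) by (simp add: algebra_simps)
  qed auto
  finally have "real m * (real m * \<epsilon>\<^sup>2) \<le> real m * (K\<^sup>2 * (2 * B + 2))"
    by (simp add: power2_eq_square mult_ac)
  then have "real m * \<epsilon>\<^sup>2 \<le> K\<^sup>2 * (2 * B + 2)" using \<open>1 \<le> real m\<close> by (subst (asm) mult_le_cancel_left_pos) auto
  then have "real m \<le> K\<^sup>2 * (2 * B + 2) / \<epsilon>\<^sup>2" using \<open>\<epsilon> > 0\<close> by (simp add: field_simps)
  then show False using m by simp
qed

text \<open>Inner products among the differences \<open>v n - w\<close> involve only pairings with
  the \<open>v m\<close> and with \<open>w\<close>, so the two limit hypotheses already make each
  difference asymptotically orthogonal to the later ones.\<close>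

lemma weak_L2_dual_tendsto:
  assumes \<Lambda>: "\<Lambda> \<in> Lp_dual 2 M" and v: "\<And>n. v n \<in> Lp_space 2 M" and w: "w \<in> Lp_space 2 M"
    and B: "\<And>n. L2_inner M (v n) (v n) \<le> B"
    and lim: "\<And>m. (\<lambda>n. L2_inner M (v n) (v m)) \<longlonglongrightarrow> L2_inner M w (v m)"
    and limw: "(\<lambda>n. L2_inner M (v n) w) \<longlonglongrightarrow> L2_inner M w w"
  shows "(\<lambda>n. \<Lambda> (v n)) \<longlonglongrightarrow> \<Lambda> w"
proof -
  define z where "z n = (\<lambda>x. v n x - w x)" for n
  have z: "z n \<in> Lp_space 2 M" for n unfolding z_def by (intro Lp_space_2_diff v w)
  have zlim: "(\<lambda>n. L2_inner M (z m) (z n)) \<longlonglongrightarrow> 0" for m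
  proof -
    have "(\<lambda>n. (L2_inner M (v n) (v m) - L2_inner M w (v m)) - (L2_inner M (v n) w - L2_inner M w w))
       \<longlonglongrightarrow> (L2_inner M w (v m) - L2_inner M w (v m)) - (L2_inner M w w - L2_inner M w w)"
      by (intro tendsto_intros lim limw)
    moreover have "L2_inner M (z m) (z n)
       = (L2_inner M (v n) (v m) - L2_inner M w (v m)) - (L2_inner M (v n) w - L2_inner M w w)" for n
      using v w by (simp add: z_def L2_inner_simps L2_inner_commute[of M "v m" "v n"]
          L2_inner_commute[of M "v m" w] L2_inner_commute[of M w "v n"])
    ultimately show ?thesis by simp
  qed
  \<comment> \<open>Nonnegativity of the square of \<open>v n + w\<close> bounds the cross term that
    appears for \<open>v n - w\<close>.\<close>
  have zB: "L2_inner M (z n) (z n) \<le> 2 * B + 2 * L2_inner M w w" for n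
    using L2_inner_nonneg[of M "\<lambda>x. v n x + w x"] B[of n] v w
    by (simp add: z_def L2_inner_simps L2_inner_commute[of M w "v n"])
  have \<Lambda>': "(\<lambda>f. - \<Lambda> f) \<in> Lp_dual 2 M" using \<Lambda> unfolding Lp_dual_def by auto
  have "(\<lambda>n. \<Lambda> (z n)) \<longlonglongrightarrow> 0"
  proof (rule order_tendstoI)
    fix a :: real assume "0 < a"
    then show "\<forall>\<^sub>F n in sequentially. \<Lambda> (z n) < a" by (rule weak_L2_dual_upper[OF \<Lambda> z zB zlim])
  next
    fix a :: real assume "a < 0"
    then show "\<forall>\<^sub>F n in sequentially. a < \<Lambda> (z n)"
      using weak_L2_dual_upper[OF \<Lambda>' z zB zlim, of "-a"] by simp
  qed
  then show ?thesis unfolding z_def using v w by (simp add: L2_dual_diff[OF \<Lambda>] LIM_zero_iff)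
qed

text \<open>The index \<open>i\<close> lets one subsequence serve countably many sequences at once,
  as is needed for all truncation levels together.\<close>

lemma weak_L2_compactness:
  fixes v :: "nat \<Rightarrow> 'i::countable \<Rightarrow> 'a \<Rightarrow> 'b::euclidean_space"
  assumes M: "finite_measure M" and v: "\<And>n i. v n i \<in> Lp_space 2 M"
    and B: "\<And>n i. L2_inner M (v n i) (v n i) \<le> B i"
  shows "\<exists>r w. strict_mono (r :: nat \<Rightarrow> nat) \<and> (\<forall>i. w i \<in> Lp_space 2 M \<and>
           (\<forall>\<Lambda>\<in>Lp_dual 2 M. (\<lambda>n. \<Lambda> (v (r n) i)) \<longlonglongrightarrow> \<Lambda> (w i)))"
proof -
  have B0: "0 \<le> B i" for i using B[of 0 i] L2_inner_nonneg[of M "v 0 i"] by linarith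
  \<comment> \<open>Division by \<open>B i + 1\<close> gives the common bound required by the
    diagonal argument; the summand \<open>1\<close> avoids division by zero.\<close>
  define f where "f = (\<lambda>n (i, m). L2_inner M (v n i) (v m i) / (B i + 1))"
  have bound: "norm (f n x) \<le> 1" for n x
  proof (cases x)
    case (Pair i m)
    have "\<bar>L2_inner M (v n i) (v m i)\<bar> \<le> sqrt (B i) * sqrt (B i)"
      using B0 B by (intro order_trans[OF L2_Cauchy_Schwarz] mult_mono real_sqrt_le_mono v) (auto simp: L2_inner_nonneg)
    then show ?thesis using B0[of i] Pair by (simp add: f_def)
  qed
  obtain r where r: "strict_mono (r :: nat \<Rightarrow> nat)" "\<And>x. \<exists>l. (\<lambda>n. f (r n) x) \<longlonglongrightarrow> l"
    using function_convergent_subsequence[of UNIV f 1] bound by auto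
  have conv: "convergent (\<lambda>n. L2_inner M (v (r n) i) (v (r m) i))" for i m
  proof -
    obtain l where "(\<lambda>n. f (r n) (i, r m)) \<longlonglongrightarrow> l" using r by blast
    then have "(\<lambda>n. f (r n) (i, r m) * (B i + 1)) \<longlonglongrightarrow> l * (B i + 1)" by (intro tendsto_intros)
    then show ?thesis using B0[of i] by (auto simp: f_def convergent_def)
  qed
  have "\<exists>w\<in>Lp_space 2 M. \<forall>\<Lambda>\<in>Lp_dual 2 M. (\<lambda>n. \<Lambda> (v (r n) i)) \<longlonglongrightarrow> \<Lambda> w" for i
  proof -
    obtain w where w: "w \<in> Lp_space 2 M"
      "\<And>m. (\<lambda>n. L2_inner M (v (r n) i) (v (r m) i)) \<longlonglongrightarrow> L2_inner M w (v (r m) i)"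
      "(\<lambda>n. L2_inner M (v (r n) i) w) \<longlonglongrightarrow> L2_inner M w w"
      using weak_L2_limit_exists[OF M, of "\<lambda>n. v (r n) i" "B i"] v B conv by blast
    show ?thesis
      using weak_L2_dual_tendsto[of _ M "\<lambda>n. v (r n) i" w "B i"] w v B by blast
  qed
  then show ?thesis using r by metis
qed

text \<open>
  The truncations of \<open>G n\<close> are bounded in \<open>L\<^sup>2\<close> and differ little from \<open>G n\<close> in \<open>L\<^sup>1\<close>, uniformly in \<open>n\<close>.
  So are their weak \<open>L\<^sup>2\<close> limits, which therefore form a Cauchy sequence in \<open>L\<^sup>1\<close>.
\<close>

lemma weak_L1_compactness:
  fixes G :: "nat \<Rightarrow> 'a \<Rightarrow> 'b::euclidean_space"
  assumes M: "finite_measure M" and G: "\<And>n. integrable M (G n)"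
    and ui: "\<And>\<epsilon>. 0 < \<epsilon> \<Longrightarrow> \<exists>k::real. \<forall>n. (LINT x|M. (if norm (G n x) \<le> k then 0 else norm (G n x))) \<le> \<epsilon>"
  shows "\<exists>r g. strict_mono (r :: nat \<Rightarrow> nat) \<and> integrable M g \<and>
           (\<forall>\<Lambda>\<in>Lp_dual 1 M. (\<lambda>n. \<Lambda> (G (r n))) \<longlonglongrightarrow> \<Lambda> g)"
proof -
  interpret finite_measure M by (rule M)
  have [measurable]: "G n \<in> borel_measurable M" for n using G by auto
  have "\<exists>k::real. \<forall>n. (LINT x|M. (if norm (G n x) \<le> k then 0 else norm (G n x))) \<le> (1/2)^j" for j
    by (rule ui) simp
  \<comment> \<open>Cutting off at level \<open>\<kappa> j\<close> changes every \<open>G n\<close>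
    by at most \<open>(1/2)^j\<close> in \<open>L\<^sup>1\<close>.\<close>
  then obtain \<kappa> :: "nat \<Rightarrow> real"
    where \<kappa>: "\<And>j n. (LINT x|M. (if norm (G n x) \<le> \<kappa> j then 0 else norm (G n x))) \<le> (1/2)^j" by metis
  define T where "T n j = (\<lambda>x. if norm (G n x) \<le> \<kappa> j then G n x else 0)" for n j
  have [measurable]: "T n j \<in> borel_measurable M" for n j unfolding T_def by measurable
  have T_bound: "norm (T n j x) \<le> \<bar>\<kappa> j\<bar>" for n j x by (auto simp: T_def)
  have T: "T n j \<in> Lp_space 2 M" for n j
    by (rule Lp_space_2_bounded[OF M _ T_bound]) measurable
  have T_le: "L2_inner M (T n j) (T n j) \<le> \<bar>\<kappa> j\<bar>\<^sup>2 * measure M (space M)" for n j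
  proof -
    have "L2_inner M (T n j) (T n j) \<le> (LINT x|M. \<bar>\<kappa> j\<bar>\<^sup>2)"
      unfolding L2_inner_def
    proof (rule integral_mono[OF L2_inner_integrable[OF T T]])
      show "T n j x \<bullet> T n j x \<le> \<bar>\<kappa> j\<bar>\<^sup>2" for x
        unfolding dot_square_norm by (rule power_mono[OF T_bound norm_ge_zero])
    qed simp
    then show ?thesis by (simp add: mult.commute)
  qed
  have T1: "integrable M (T n j)" for n j by (rule Lp_space_2_imp_integrable[OF M T])
  have GT: "(LINT x|M. norm (G n x - T n j x)) \<le> (1/2)^j" for n j
  proof -
    have "(LINT x|M. norm (G n x - T n j x)) = (LINT x|M. (if norm (G n x) \<le> \<kappa> j then 0 else norm (G n x)))"
      by (intro Bochner_Integration.integral_cong) (auto simp: T_def)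
    then show ?thesis using \<kappa> by simp
  qed
  obtain r w where r: "strict_mono (r :: nat \<Rightarrow> nat)" and w: "\<And>j. w j \<in> Lp_space 2 M"
    and lim: "\<And>j \<Lambda>. \<Lambda> \<in> Lp_dual 2 M \<Longrightarrow> (\<lambda>n. \<Lambda> (T (r n) j)) \<longlonglongrightarrow> \<Lambda> (w j)"
    using weak_L2_compactness[OF M, of T, OF T T_le] by blast
  have [measurable]: "w j \<in> borel_measurable M" for j using w by (simp add: Lp_space_2_iff)
  have tail: "(LINT x|M. norm (w i x - w j x)) \<le> 2 * (1/2)^i" if "i \<le> j" for i j
  proof -
    \<comment> \<open>Pairing with the sign of \<open>w i - w j\<close> turns the
      \<open>L\<^sup>1\<close> distance into a linear expression, so the bound for the truncations
      passes to their weak limits.\<close>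
    define h where "h = (\<lambda>x. sgn (w i x - w j x))"
    have h_meas[measurable]: "h \<in> borel_measurable M" unfolding h_def sgn_div_norm by measurable
    have h1: "norm (h x) \<le> 1" for x by (simp add: h_def norm_sgn)
    have h: "h \<in> Lp_space 2 M" by (rule Lp_space_2_bounded[OF M h_meas h1])
    have "(\<lambda>n. L2_inner M (T (r n) i) h - L2_inner M (T (r n) j) h) \<longlonglongrightarrow> L2_inner M (w i) h - L2_inner M (w j) h"
      by (intro tendsto_diff lim[OF L2_inner_mem_Lp_dual[OF h]])
    moreover have "L2_inner M (T n i) h - L2_inner M (T n j) h \<le> 2 * (1/2)^i" for n
    proof -
      have "L2_inner M (T n i) h - L2_inner M (T n j) h = L2_inner M (\<lambda>x. T n i x - T n j x) h"
        by (simp add: L2_inner_diff_left T h)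
      also have "\<dots> \<le> (LINT x|M. norm (G n x - T n i x) + norm (G n x - T n j x))"
        unfolding L2_inner_def
      proof (rule integral_mono)
        fix x
        have "(T n i x - T n j x) \<bullet> h x \<le> norm (T n i x - T n j x) * norm (h x)" by (rule norm_cauchy_schwarz)
        also have "\<dots> \<le> norm (T n i x - T n j x)" using h1 by (simp add: mult_left_le)
        also have "\<dots> \<le> norm (G n x - T n i x) + norm (G n x - T n j x)"
          using norm_triangle_ineq4[of "G n x - T n j x" "G n x - T n i x"] by simp
        finally show "(T n i x - T n j x) \<bullet> h x \<le> norm (G n x - T n i x) + norm (G n x - T n j x)" .
      qed (use G T1 in \<open>auto intro!: L2_inner_integrable Lp_space_2_diff T h\<close>)
      also have "\<dots> = (LINT x|M. norm (G n x - T n i x)) + (LINT x|M. norm (G n x - T n j x))"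
        using G T1 by (intro Bochner_Integration.integral_add) auto
      also have "\<dots> \<le> (1/2)^i + (1/2)^j" using GT by (intro add_mono)
      also have "\<dots> \<le> 2 * (1/2)^i" using power_decreasing[OF that, of "1/2::real"] by simp
      finally show ?thesis .
    qed
    ultimately have "L2_inner M (w i) h - L2_inner M (w j) h \<le> 2 * (1/2)^i"
      by (intro LIMSEQ_le_const2) auto
    moreover have "L2_inner M (w i) h - L2_inner M (w j) h = (LINT x|M. norm (w i x - w j x))"
    proof -
      have "L2_inner M (w i) h - L2_inner M (w j) h = L2_inner M (\<lambda>x. w i x - w j x) h"
        by (simp add: L2_inner_diff_left w h)
      also have "\<dots> = (LINT x|M. norm (w i x - w j x))"
      proof -
        have "a \<bullet> sgn a = norm a" for a :: 'b
          by (cases "a = 0") (auto simp: sgn_div_norm dot_square_norm power2_eq_square)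
        then show ?thesis by (simp add: L2_inner_def h_def)
      qed
      finally show ?thesis .
    qed
    ultimately show ?thesis by simp
  qed
  have w1: "integrable M (w j)" for j by (rule Lp_space_2_imp_integrable[OF M w])
  have tail': "(\<integral>\<^sup>+x. ennreal (norm (w i x - w j x)) \<partial>M) \<le> ennreal (2 * (1/2)^i)" if "i \<le> j" for i j
    using tail[OF that] w1 by (subst nn_integral_eq_integral) (auto intro!: ennreal_leI)
  have "\<exists>g\<in>borel_measurable M. \<forall>i. (\<integral>\<^sup>+x. ennreal (norm (w i x - g x) ^ 1) \<partial>M) \<le> ennreal (2 * (1/2)^i)"
  proof (rule Lp_fast_Cauchy_limit)
    show "(\<integral>\<^sup>+x. ennreal (norm (w (Suc i) x - w i x)) \<partial>M) \<le> ennreal (2 * (1/2)^i)" for i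
      using tail'[of i "Suc i"] by (simp add: norm_minus_commute)
  qed (use tail' in auto)
  then obtain g where [measurable]: "g \<in> borel_measurable M"
    and g: "\<And>i. (\<integral>\<^sup>+x. ennreal (norm (w i x - g x)) \<partial>M) \<le> ennreal (2 * (1/2)^i)" by auto
  have wg: "integrable M (\<lambda>x. w i x - g x)" for i
    unfolding integrable_iff_bounded using le_less_trans[OF g] by auto
  have "integrable M (\<lambda>x. w 0 x - (w 0 x - g x))" by (intro Bochner_Integration.integrable_diff w1 wg)
  then have g1: "integrable M g" by simp
  have wg_le: "(LINT x|M. norm (w i x - g x)) \<le> 2 * (1/2)^i" for i
    using g[of i] wg by (subst (asm) nn_integral_eq_integral) auto
  have "(\<lambda>n. \<Lambda> (G (r n))) \<longlonglongrightarrow> \<Lambda> g" if \<Lambda>: "\<Lambda> \<in> Lp_dual 1 M" for \<Lambda>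
  proof (rule metric_LIMSEQ_I)
    fix e :: real assume "0 < e"
    obtain K0 where K0: "\<And>f. f \<in> Lp_space 1 M \<Longrightarrow> \<bar>\<Lambda> f\<bar> \<le> K0 * Lp_norm 1 M f"
      using \<Lambda> unfolding Lp_dual_def mem_Collect_eq by blast
    define K where "K = \<bar>K0\<bar>"
    have K: "\<bar>\<Lambda> a - \<Lambda> b\<bar> \<le> K * c" if "integrable M a" "integrable M b" "(LINT x|M. norm (a x - b x)) \<le> c" for a b c
    proof -
      have "\<bar>\<Lambda> a - \<Lambda> b\<bar> = \<bar>\<Lambda> (\<lambda>x. a x - b x)\<bar>"
        using L1_dual_diff[OF \<Lambda>, of a b] that by (simp add: Lp_space_1_iff)
      also have "\<dots> \<le> K0 * (LINT x|M. norm (a x - b x))"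
        using K0[of "\<lambda>x. a x - b x"] that by (simp add: Lp_space_1_iff Lp_norm_1)
      also have "\<dots> \<le> K * (LINT x|M. norm (a x - b x))"
        unfolding K_def by (intro mult_right_mono) auto
      also have "\<dots> \<le> K * c" using that unfolding K_def by (intro mult_left_mono) auto
      finally show ?thesis .
    qed
    \<comment> \<open>The factor \<open>3\<close> adds the truncation error \<open>(1/2)^j\<close>
      of \<open>G\<close> and the distance \<open>2 * (1/2)^j\<close> from \<open>w j\<close> to
      \<open>g\<close>. The level \<open>j\<close> is fixed before \<open>N\<close>, since weak
      convergence is known level by level.\<close>
    have "(\<lambda>j. K * (3 * (1/2)^j)) \<longlonglongrightarrow> K * (3 * 0)"
      by (intro tendsto_mult tendsto_const LIMSEQ_power_zero) auto
    then have "\<forall>\<^sub>F j in sequentially. K * (3 * (1/2)^j) < e / 2"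
      using \<open>0 < e\<close> by (intro order_tendstoD) auto
    then obtain j where j: "K * (3 * (1/2)^j) < e / 2" by (auto simp: eventually_sequentially)
    have "(\<lambda>n. \<Lambda> (T (r n) j)) \<longlonglongrightarrow> \<Lambda> (w j)" by (rule lim[OF Lp_dual_1_subset_2[OF M \<Lambda>]])
    then obtain N where N: "\<And>n. n \<ge> N \<Longrightarrow> dist (\<Lambda> (T (r n) j)) (\<Lambda> (w j)) < e / 2"
      using \<open>0 < e\<close> by (meson half_gt_zero metric_LIMSEQ_D)
    have "dist (\<Lambda> (G (r n))) (\<Lambda> g) < e" if "n \<ge> N" for n
    proof -
      have "\<bar>\<Lambda> (G (r n)) - \<Lambda> (T (r n) j)\<bar> \<le> K * (1/2)^j" by (intro K G T1 GT)
      moreover have "\<bar>\<Lambda> (w j) - \<Lambda> g\<bar> \<le> K * (2 * (1/2)^j)" by (intro K w1 g1 wg_le)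
      moreover have "K * (3 * (1/2)^j) = K * (1/2)^j + K * (2 * (1/2)^j)" by (simp add: algebra_simps)
      ultimately show ?thesis using N[OF that] j unfolding dist_real_def by linarith
    qed
    then show "\<exists>N. \<forall>n\<ge>N. dist (\<Lambda> (G (r n))) (\<Lambda> g) < e" by blast
  qed
  then show ?thesis using r g1 by blast
qed

section \<open>Test functions\<close>

lemma C_k_SucI:
  assumes "\<And>x. (f has_derivative f' x) (at x)" "\<And>b. b \<in> Basis \<Longrightarrow> C_k k (\<lambda>x. f' x b)"
  shows "C_k (Suc k) f"
proof -
  have "frechet_derivative f (at x) = f' x" for x
    using frechet_derivative_at[OF assms(1)] by simp
  then show ?thesis using assms by (auto simp: differentiable_def)
qed

lemma C_k_SucD:
  assumes "C_k (Suc k) f"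
  shows "(f has_derivative frechet_derivative f (at x)) (at x)"
    "b \<in> Basis \<Longrightarrow> C_k k (\<lambda>x. frechet_derivative f (at x) b)"
  using assms frechet_derivative_works by auto

lemma C_k_Suc_imp: "C_k (Suc k) f \<Longrightarrow> C_k k f"
proof (induction k arbitrary: f)
  case 0
  then show ?case
    by (auto intro!: differentiable_imp_continuous_on simp: differentiable_on_def differentiable_at_withinI)
next
  case (Suc k)
  show ?case
    using Suc.IH C_k_SucD[OF Suc.prems] by (intro C_k_SucI) auto
qed

lemma C_k_const: "C_k k (\<lambda>x. c)"
proof (induction k arbitrary: c)
  case (Suc k)
  show ?case using Suc by (intro C_k_SucI[where f' = "\<lambda>x h. 0"]) auto
qed simp

lemma C_k_add: "C_k k f \<Longrightarrow> C_k k g \<Longrightarrow> C_k k (\<lambda>x. f x + g x)"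
proof (induction k arbitrary: f g)
  case 0
  then show ?case by (auto intro: continuous_intros)
next
  case (Suc k)
  show ?case
    by (rule C_k_SucI[OF has_derivative_add[OF C_k_SucD(1)[OF Suc.prems(1)] C_k_SucD(1)[OF Suc.prems(2)]]])
      (intro Suc.IH C_k_SucD(2)[OF Suc.prems(1)] C_k_SucD(2)[OF Suc.prems(2)])
qed

lemma C_k_mult: "C_k k f \<Longrightarrow> C_k k g \<Longrightarrow> C_k k (\<lambda>x. f x * g x)"
proof (induction k arbitrary: f g)
  case 0
  then show ?case by (auto intro: continuous_intros)
next
  case (Suc k)
  \<comment> \<open>The product rule also contains the undifferentiated factors, which the induction
    hypothesis needs at order \<open>k\<close>.\<close>
  have k: "C_k k f" "C_k k g" using Suc.prems by (auto intro: C_k_Suc_imp simp del: C_k.simps)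
  show ?case
    by (rule C_k_SucI[OF has_derivative_mult[OF C_k_SucD(1)[OF Suc.prems(1)] C_k_SucD(1)[OF Suc.prems(2)]]])
      (intro C_k_add Suc.IH C_k_SucD(2)[OF Suc.prems(1)] C_k_SucD(2)[OF Suc.prems(2)] k)
qed

lemma C_k_diff: "C_k k f \<Longrightarrow> C_k k g \<Longrightarrow> C_k k (\<lambda>x. f x - g x)"
  using C_k_add[of k f "\<lambda>x. (-1) * g x"] C_k_mult[OF C_k_const[of k "-1"], of g] by simp

lemma C_k_power: "C_k k f \<Longrightarrow> C_k k (\<lambda>x. f x ^ n)"
  by (induction n) (auto intro: C_k_const C_k_mult)

lemma C_k_sum: "(\<And>i. i \<in> I \<Longrightarrow> C_k k (f i)) \<Longrightarrow> C_k k (\<lambda>x. \<Sum>i\<in>I. f i x)"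
  by (induction I rule: infinite_finite_induct) (auto intro: C_k_const C_k_add)

lemma C_k_linear: "C_k k (\<lambda>x. (x - c) \<bullet> b)"
proof (cases k)
  case (Suc n)
  have "C_k (Suc n) (\<lambda>x. (x - c) \<bullet> b)"
    by (rule C_k_SucI[where f' = "\<lambda>x h. h \<bullet> b"]) (auto intro!: derivative_eq_intros C_k_const)
  then show ?thesis using Suc by simp
qed (auto intro!: continuous_intros)

lemma C_k_inner_self: "C_k k (\<lambda>x. (x - c) \<bullet> (x - c))"
proof (cases k)
  case (Suc n)
  have "C_k (Suc n) (\<lambda>x. (x - c) \<bullet> (x - c))"
  proof (rule C_k_SucI[where f' = "\<lambda>x h. (x - c) \<bullet> h + (x - c) \<bullet> h"])
    show "((\<lambda>x. (x - c) \<bullet> (x - c)) has_derivative (\<lambda>h. (x - c) \<bullet> h + (x - c) \<bullet> h)) (at x)" for x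
      by (auto intro!: derivative_eq_intros simp: inner_commute)
  qed (intro C_k_add C_k_linear)
  then show ?thesis using Suc by simp
qed (auto intro!: continuous_intros)

lemma C_k_translate: "C_k k f \<Longrightarrow> C_k k (\<lambda>x. f (x - a))"
proof (induction k arbitrary: f)
  case 0
  then show ?case by (auto intro!: continuous_on_compose2[of UNIV f] continuous_intros)
next
  case (Suc k)
  have "((\<lambda>x. f (x - a)) has_derivative frechet_derivative f (at (x - a))) (at x)" for x
  proof -
    have "((\<lambda>x. x - a) has_derivative (\<lambda>x. x)) (at x)" by (auto intro!: derivative_eq_intros)
    from has_derivative_compose[OF this C_k_SucD(1)[OF Suc.prems]] show ?thesis by simp
  qed
  then show ?case using Suc.IH[OF C_k_SucD(2)[OF Suc.prems]] by (rule C_k_SucI)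
qed

text \<open>With \<open>p = 1\<close> this is the standard smooth function that is flat at the
  origin. Polynomial factors in \<open>1 / t\<close> make the family closed under differentiation,
  so that smoothness follows by induction on the order with \<open>p\<close> arbitrary.\<close>

definition exp_flat :: "real poly \<Rightarrow> real \<Rightarrow> real" where
  "exp_flat p t = (if t > 0 then poly p (1 / t) * exp (- (1 / t)) else 0)"

lemma poly_exp_tendsto_0: "((\<lambda>s. poly p s * exp (- s)) \<longlongrightarrow> (0::real)) at_top"
proof -
  have "((\<lambda>s. \<Sum>i\<le>degree p. coeff p i * (s ^ i / exp s)) \<longlongrightarrow> (\<Sum>i\<le>degree p. coeff p i * 0)) at_top"
    by (intro tendsto_intros tendsto_power_div_exp_0)
  then show ?thesis by (simp add: poly_altdef sum_distrib_right exp_minus divide_inverse mult.assoc)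
qed

text \<open>With \<open>s = 1 / t\<close> the chain rule contributes \<open>- s\<^sup>2\<close>, and
  differentiating \<open>poly p s * exp (- s)\<close> in \<open>s\<close> replaces \<open>p\<close>
  by \<open>pderiv p - p\<close>; this is the origin of the new polynomial. At \<open>t = 0\<close>
  the exponential beats every power of \<open>s\<close>.\<close>

lemma exp_flat_has_derivative:
  "(exp_flat p has_real_derivative exp_flat (monom 1 2 * (p - pderiv p)) t) (at t)"
proof -
  consider "t > 0" | "t < 0" | "t = 0" by linarith
  then show ?thesis
  proof cases
    case 1
    have "((\<lambda>t. poly p (1 / t) * exp (- (1 / t))) has_real_derivative
        (exp_flat (monom 1 2 * (p - pderiv p)) t)) (at t)"
      using 1 unfolding exp_flat_def
      by (auto intro!: derivative_eq_intros DERIV_chain2[OF poly_DERIV]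
          simp: poly_monom field_simps power2_eq_square)
    then show ?thesis
      by (rule has_field_derivative_transform_within_open[where S = "{0<..}"]) (use 1 in \<open>auto simp: exp_flat_def\<close>)
  next
    case 2
    have "((\<lambda>t. 0) has_real_derivative (exp_flat (monom 1 2 * (p - pderiv p)) t)) (at t)"
      using 2 unfolding exp_flat_def by auto
    then show ?thesis
      by (rule has_field_derivative_transform_within_open[where S = "{..<0}"]) (use 2 in \<open>auto simp: exp_flat_def\<close>)
  next
    case 3
    have "((\<lambda>y. exp_flat p y / y) \<longlongrightarrow> 0) (at_left 0)"
      by (rule tendsto_eventually) (auto simp: exp_flat_def eventually_at_filter)
    moreover have "((\<lambda>y. exp_flat p y / y) \<longlongrightarrow> 0) (at_right 0)"
    proof -
      \<comment> \<open>\<open>pCons 0 p\<close> absorbs the factor \<open>inverse y\<close> of the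
        difference quotient.\<close>
      have "((\<lambda>y. poly (pCons 0 p) (inverse y) * exp (- inverse y)) \<longlongrightarrow> 0) (at_right 0)"
        using poly_exp_tendsto_0 filterlim_inverse_at_top_right by (rule filterlim_compose)
      then show ?thesis
        by (rule Lim_transform_eventually) (auto simp: exp_flat_def eventually_at_filter field_simps)
    qed
    ultimately have "((\<lambda>y. exp_flat p y / y) \<longlongrightarrow> 0) (at 0)" by (simp add: filterlim_at_split)
    then show ?thesis using 3 by (simp add: has_field_derivative_iff exp_flat_def)
  qed
qed

lemma C_k_exp_flat: "(\<And>k. C_k k q) \<Longrightarrow> C_k k (\<lambda>x. exp_flat p (q x))"
proof (induction k arbitrary: p)
  case 0
  have "continuous_on UNIV (exp_flat p)"
    using exp_flat_has_derivative by (meson DERIV_isCont continuous_at_imp_continuous_on)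
  then show ?case using 0[of 0] by (auto intro!: continuous_on_compose2[of UNIV "exp_flat p"])
next
  case (Suc k)
  have "((\<lambda>x. exp_flat p (q x)) has_derivative
      (\<lambda>h. exp_flat (monom 1 2 * (p - pderiv p)) (q x) * frechet_derivative q (at x) h)) (at x)" for x
    using has_derivative_compose[OF C_k_SucD(1)[OF Suc.prems[of "Suc 0"], of x]
        exp_flat_has_derivative[unfolded has_field_derivative_def]] by simp
  then show ?case
    by (rule C_k_SucI) (intro C_k_mult Suc.IH Suc.prems C_k_SucD(2))
qed

section \<open>Test functions and their supports\<close>

lemma test_functionsI:
  assumes "\<And>k. C_k k \<psi>" "compact K" "K \<subseteq> \<Omega>" "\<And>x. x \<notin> K \<Longrightarrow> \<psi> x = 0"
  shows "\<psi> \<in> test_functions \<Omega>"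
proof -
  have "closure {x. \<psi> x \<noteq> 0} \<subseteq> K"
    using assms by (intro closure_minimal compact_imp_closed) auto
  then show ?thesis
    using assms compact_Int_closed[of K "closure {x. \<psi> x \<noteq> 0}"]
    by (auto simp: test_functions_def Int_absorb1)
qed

lemma test_functionsE:
  assumes "\<psi> \<in> test_functions \<Omega>"
  obtains K where "compact K" "K \<subseteq> \<Omega>" "\<And>x. x \<notin> K \<Longrightarrow> \<psi> x = 0"
    "\<And>x. x \<notin> K \<Longrightarrow> frechet_derivative \<psi> (at x) = (\<lambda>h. 0)"
proof
  let ?K = "closure {x. \<psi> x \<noteq> 0}"
  show "compact ?K" "?K \<subseteq> \<Omega>" using assms by (auto simp: test_functions_def)
  show *: "\<psi> x = 0" if "x \<notin> ?K" for x using that closure_subset[of "{x. \<psi> x \<noteq> 0}"] by blast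
  show "frechet_derivative \<psi> (at x) = (\<lambda>h. 0)" if "x \<notin> ?K" for x
  proof -
    have "((\<lambda>x. 0) has_derivative (\<lambda>h. 0)) (at x)" by simp
    then have "(\<psi> has_derivative (\<lambda>h. 0)) (at x)"
    proof (rule has_derivative_transform_within_open)
      show "open (- ?K)" by (simp add: open_Compl)
      show "x \<in> - ?K" using that by simp
      show "0 = \<psi> y" if "y \<in> - ?K" for y using that *[of y] by simp
    qed
    then show ?thesis by (rule frechet_derivative_at[symmetric])
  qed
qed

lemma test_functions_mono: "U \<subseteq> V \<Longrightarrow> test_functions U \<subseteq> test_functions V"
  by (auto simp: test_functions_def)

lemma test_function_C_k: "\<psi> \<in> test_functions \<Omega> \<Longrightarrow> C_k k \<psi>"
  by (simp add: test_functions_def)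

lemma compact_support_bounded:
  fixes f :: "'a::euclidean_space \<Rightarrow> real"
  assumes "continuous_on UNIV f" "compact K" "\<And>x. x \<notin> K \<Longrightarrow> f x = 0"
  shows "\<exists>B\<ge>0. \<forall>x. \<bar>f x\<bar> \<le> B"
proof -
  have "bounded (f ` K)"
    using assms by (intro compact_imp_bounded compact_continuous_image) (auto intro: continuous_on_subset)
  then obtain B where "\<And>x. x \<in> K \<Longrightarrow> \<bar>f x\<bar> \<le> B" by (auto simp: bounded_iff)
  then have "\<bar>f x\<bar> \<le> max B 0" for x using assms(3)[of x] by (cases "x \<in> K") (auto simp: le_max_iff_disj)
  then show ?thesis by (intro exI[of _ "max B 0"]) auto
qed

text \<open>A finite sum of radial bumps over balls covering \<open>K\<close>. Positivity on
  \<open>K\<close> suffices in place of the value \<open>1\<close>, because powers of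
  \<open>1 - P\<close> sharpen it later.\<close>

lemma exists_bump:
  fixes K :: "'a::euclidean_space set"
  assumes "compact K" "open V" "K \<subseteq> V"
  shows "\<exists>P\<in>test_functions V. (\<forall>x. 0 \<le> P x \<and> P x \<le> 1) \<and> (\<forall>x\<in>K. 0 < P x)"
proof -
  have e01: "0 \<le> exp_flat 1 t" "exp_flat 1 t \<le> 1" "0 < exp_flat 1 t \<longleftrightarrow> 0 < t" for t
    by (auto simp: exp_flat_def)
  have "\<exists>r>0. cball x r \<subseteq> V" if "x \<in> K" for x
    using assms that by (metis open_contains_cball subsetD)
  then obtain r where r: "\<And>x. x \<in> K \<Longrightarrow> r x > 0 \<and> cball x (r x) \<subseteq> V" by metis
  obtain C where C: "C \<subseteq> K" "finite C" "K \<subseteq> (\<Union>c\<in>C. ball c (r c))"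
  proof (rule compactE_image[OF assms(1), of K "\<lambda>c. ball c (r c)"])
    show "K \<subseteq> (\<Union>c\<in>K. ball c (r c))" using r by force
  qed auto
  define b where "b c x = exp_flat 1 ((r c)\<^sup>2 - (x - c) \<bullet> (x - c))" for c x
  have b0: "b c x = 0" if "x \<notin> ball c (r c)" "c \<in> C" for c x
  proof -
    have "r c \<le> norm (x - c)" "0 < r c" using that r[of c] C by (auto simp: dist_norm norm_minus_commute)
    then have "(r c)\<^sup>2 \<le> (x - c) \<bullet> (x - c)" unfolding dot_square_norm by (intro power_mono) auto
    then show ?thesis by (simp add: b_def exp_flat_def)
  qed
  have b1: "b c x > 0" if "x \<in> ball c (r c)" for c x
  proof -
    have "norm (x - c) < r c" using that by (auto simp: dist_norm norm_minus_commute)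
    then have "(x - c) \<bullet> (x - c) < (r c)\<^sup>2" unfolding dot_square_norm by (intro power_strict_mono) auto
    then show ?thesis by (simp add: b_def e01)
  qed
  \<comment> \<open>Each bump is at most \<open>1\<close>, so this divisor gives
    \<open>P x \<le> 1\<close>; it is positive even if the cover is empty.\<close>
  define P where "P x = (\<Sum>c\<in>C. b c x) * (1 / (1 + real (card C)))" for x
  show ?thesis
  proof (intro bexI[of _ P] conjI allI ballI)
    show "P \<in> test_functions V"
    proof (rule test_functionsI[where K = "\<Union>c\<in>C. cball c (r c)"])
      show "C_k k P" for k unfolding P_def b_def
        by (intro C_k_mult C_k_sum C_k_const C_k_exp_flat C_k_diff C_k_inner_self)
      show "P x = 0" if "x \<notin> (\<Union>c\<in>C. cball c (r c))" for x
        unfolding P_def using that by (auto intro!: sum.neutral b0)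
    qed (use C r in auto)
    show "0 \<le> P x" for x unfolding P_def b_def by (auto intro!: sum_nonneg divide_nonneg_nonneg e01)
    have s: "(\<Sum>c\<in>C. b c x) \<le> real (card C)" for x
      using sum_bounded_above[of C "\<lambda>c. b c x" 1] by (auto simp: b_def e01)
    show "P x \<le> 1" for x
      using s[of x] unfolding P_def by (simp add: divide_le_eq)
    show "0 < P x" if x: "x \<in> K" for x
    proof -
      obtain c where "c \<in> C" "x \<in> ball c (r c)" using C x by blast
      then have "0 < (\<Sum>c\<in>C. b c x)"
        using C by (intro sum_pos2[of C c] b1) (auto simp: b_def e01)
      then show ?thesis unfolding P_def by (intro mult_pos_pos) auto
    qed
  qed
qed

text \<open>
  The sign of \<open>F\<close> is approximated by differences of \<open>1 - (1 - P) ^ j\<close>, where \<open>P\<close> is a bump function: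
  as \<open>j\<close> grows, this tends to the indicator function of the set where \<open>P\<close> is positive.
\<close>

lemma L1_norm_le_test_functions:
  fixes F :: "'a::euclidean_space \<Rightarrow> real"
  assumes "open U" and F: "integrable (lebesgue_on U) F"
    and A: "\<And>\<psi>. \<psi> \<in> test_functions U \<Longrightarrow> (\<And>x. \<bar>\<psi> x\<bar> \<le> 1) \<Longrightarrow> (LINT x|lebesgue_on U. F x * \<psi> x) \<le> A"
  shows "(LINT x|lebesgue_on U. \<bar>F x\<bar>) \<le> A"
proof -
  have Us: "U \<in> sets lebesgue" using assms(1) by auto
  have [measurable]: "F \<in> borel_measurable (lebesgue_on U)" using F by auto
  have cont_meas: "\<psi> \<in> borel_measurable (lebesgue_on U)" if "continuous_on UNIV \<psi>" for \<psi> :: "'a \<Rightarrow> real"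
    using that Us by (intro continuous_imp_measurable_on_sets_lebesgue) (auto intro: continuous_on_subset)
  \<comment> \<open>Up to a null set a Lebesgue measurable set is a countable union of closed sets,
    hence of compact sets; partial unions make the sequence increasing.\<close>
  have approx: "\<exists>F'::nat \<Rightarrow> 'a set. (\<forall>n. compact (F' n) \<and> F' n \<subseteq> E) \<and> incseq F' \<and> (AE x in lebesgue_on U. x \<in> E \<longrightarrow> x \<in> (\<Union>n. F' n))"
    if E: "E \<in> sets lebesgue" for E
  proof -
    obtain C T where CT: "fsigma C" "T \<in> null_sets lebesgue" "C \<union> T = E"
      by (rule lebesgue_set_almost_fsigma[OF E])
    obtain G :: "nat \<Rightarrow> 'a set" where G: "range G \<subseteq> Collect compact" "C = \<Union>(range G)"
      using CT(1) unfolding fsigma_Union_compact by blast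
    have "AE x in lebesgue. x \<notin> T" using CT(2) by (rule AE_not_in)
    then have "AE x in lebesgue_on U. x \<notin> T" using Us by (auto simp: AE_restrict_space_iff elim: eventually_mono)
    then have "AE x in lebesgue_on U. x \<in> E \<longrightarrow> x \<in> (\<Union>n. \<Union>i\<le>n. G i)"
      by eventually_elim (use CT G in auto)
    moreover have "incseq (\<lambda>n. \<Union>i\<le>n. G i)" by (intro incseq_SucI) (auto simp: atMost_Suc)
    moreover have "compact (\<Union>i\<le>n. G i)" for n
      using G(1) by (intro compact_UN) auto
    moreover have "(\<Union>i\<le>n. G i) \<subseteq> E" for n
    proof -
      have "C \<subseteq> E" using CT(3) by blast
      then show ?thesis unfolding G(2) by blast
    qed
    ultimately show ?thesis by (intro exI[of _ "\<lambda>n. \<Union>i\<le>n. G i"] conjI allI)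
  qed
  have EP: "{x \<in> U. F x > 0} \<in> sets lebesgue" and EN: "{x \<in> U. F x < 0} \<in> sets lebesgue"
  proof -
    have "{x \<in> space (lebesgue_on U). F x > 0} \<in> sets (lebesgue_on U)"
      "{x \<in> space (lebesgue_on U). F x < 0} \<in> sets (lebesgue_on U)" by measurable
    then show "{x \<in> U. F x > 0} \<in> sets lebesgue" "{x \<in> U. F x < 0} \<in> sets lebesgue"
      using Us by (auto simp: sets_restrict_space_iff)
  qed
  obtain KP where KP: "\<And>n. compact (KP n)" "\<And>n. KP n \<subseteq> {x \<in> U. F x > 0}" "incseq (KP :: nat \<Rightarrow> _)"
    "AE x in lebesgue_on U. x \<in> {x \<in> U. F x > 0} \<longrightarrow> x \<in> (\<Union>n. KP n)"
    using approx[OF EP] by blast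
  obtain KN where KN: "\<And>n. compact (KN n)" "\<And>n. KN n \<subseteq> {x \<in> U. F x < 0}" "incseq (KN :: nat \<Rightarrow> _)"
    "AE x in lebesgue_on U. x \<in> {x \<in> U. F x < 0} \<longrightarrow> x \<in> (\<Union>n. KN n)"
    using approx[OF EN] by blast
  define K where "K n = KP n \<union> KN n" for n
  have [measurable]: "K n \<in> sets borel" for n
    unfolding K_def using KP(1) KN(1) by (intro sets.Un borel_compact)
  have ind_meas[measurable]: "(\<lambda>x. indicator (K n) x :: real) \<in> borel_measurable (lebesgue_on U)" for n
    by (intro measurable_restrict_space1 measurable_completion) simp
  \<comment> \<open>On \<open>K n\<close> the approximate sign produces exactly
    \<open>\<bar>F x\<bar>\<close>; elsewhere only the lower bound \<open>- \<bar>F x\<bar>\<close>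
    is known. The factor \<open>2 * indicator (K n) x - 1\<close> records both cases, and it tends
    to \<open>1\<close> almost everywhere on the set where \<open>F\<close> is nonzero.\<close>
  have bound: "(LINT x|lebesgue_on U. \<bar>F x\<bar> * (2 * indicator (K n) x - 1)) \<le> A" for n
  proof -
    have "KP n \<inter> KN n = {}" using KP(2)[of n] KN(2)[of n] by fastforce
    \<comment> \<open>Disjoint neighbourhoods keep the two bumps from overlapping, so
      \<open>\<sigma>\<close> has the correct sign on both compact sets.\<close>
    then obtain V W where VW: "open V" "open W" "KP n \<subseteq> V" "KN n \<subseteq> W" "V \<inter> W = {}"
      using separation_normal_compact[OF KP(1) compact_imp_closed[OF KN(1)]] by metis
    have "KP n \<subseteq> V \<inter> U" using KP(2)[of n] VW by blast
    then obtain P where P: "P \<in> test_functions (V \<inter> U)" "\<And>x. 0 \<le> P x" "\<And>x. P x \<le> 1" "\<And>x. x \<in> KP n \<Longrightarrow> 0 < P x"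
      using exists_bump[OF KP(1) open_Int[OF VW(1) assms(1)]] by blast
    have "KN n \<subseteq> W \<inter> U" using KN(2)[of n] VW by blast
    then obtain Q where Q: "Q \<in> test_functions (W \<inter> U)" "\<And>x. 0 \<le> Q x" "\<And>x. Q x \<le> 1" "\<And>x. x \<in> KN n \<Longrightarrow> 0 < Q x"
      using exists_bump[OF KN(1) open_Int[OF VW(2) assms(1)]] by blast
    obtain SP where SP: "compact SP" "SP \<subseteq> V \<inter> U" "\<And>x. x \<notin> SP \<Longrightarrow> P x = 0" using test_functionsE[OF P(1)] by metis
    obtain SQ where SQ: "compact SQ" "SQ \<subseteq> W \<inter> U" "\<And>x. x \<notin> SQ \<Longrightarrow> Q x = 0" using test_functionsE[OF Q(1)] by metis
    have disj: "P x = 0 \<or> Q x = 0" for x using SP SQ VW by blast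
    \<comment> \<open>This is \<open>(1 - (1 - P x) ^ j) - (1 - (1 - Q x) ^ j)\<close>, a polynomial
      in the bumps and hence smooth.\<close>
    define \<psi> where "\<psi> j = (\<lambda>x. (1 - Q x) ^ j - (1 - P x) ^ j)" for j :: nat
    have \<psi>: "\<psi> j \<in> test_functions U" for j
    proof (rule test_functionsI[where K = "SP \<union> SQ"])
      show "C_k k (\<psi> j)" for k unfolding \<psi>_def
        by (intro C_k_diff C_k_power C_k_const test_function_C_k[OF P(1)] test_function_C_k[OF Q(1)])
    qed (use SP SQ in \<open>auto simp: \<psi>_def\<close>)
    have \<psi>1: "\<bar>\<psi> j x\<bar> \<le> 1" for j x
    proof -
      have "0 \<le> (1 - P x) ^ j" "(1 - P x) ^ j \<le> 1" "0 \<le> (1 - Q x) ^ j" "(1 - Q x) ^ j \<le> 1"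
        using P(2,3)[of x] Q(2,3)[of x] by (auto intro!: power_le_one)
      then show ?thesis unfolding \<psi>_def by linarith
    qed
    define \<sigma> where "\<sigma> x = (if P x > 0 then 1 else if Q x > 0 then -1 else 0 :: real)" for x
    have lim: "(\<lambda>j. \<psi> j x) \<longlonglongrightarrow> \<sigma> x" for x
    proof -
      have pw: "(\<lambda>j. (1 - a) ^ j) \<longlonglongrightarrow> (if a > 0 then 0 else 1)" if "0 \<le> a" "a \<le> 1" for a :: real
        using that by (auto intro!: LIMSEQ_power_zero)
      have "(\<lambda>j. \<psi> j x) \<longlonglongrightarrow> (if Q x > 0 then 0 else 1) - (if P x > 0 then 0 else 1)"
        unfolding \<psi>_def using P Q by (intro tendsto_diff pw)
      moreover have "(if Q x > 0 then 0 else 1) - (if P x > 0 then 0 else 1) = \<sigma> x"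
        using disj[of x] by (auto simp: \<sigma>_def)
      ultimately show ?thesis by simp
    qed
    have \<psi>m: "\<psi> j \<in> borel_measurable (lebesgue_on U)" for j
      using test_function_C_k[OF \<psi>, of 0] by (intro cont_meas) auto
    have \<sigma>m: "\<sigma> \<in> borel_measurable (lebesgue_on U)"
      by (rule borel_measurable_LIMSEQ_real[OF lim \<psi>m])
    note [measurable] = \<psi>m \<sigma>m
    have "(\<lambda>j. LINT x|lebesgue_on U. F x * \<psi> j x) \<longlonglongrightarrow> (LINT x|lebesgue_on U. F x * \<sigma> x)"
    proof (rule integral_dominated_convergence[where w = "\<lambda>x. \<bar>F x\<bar>"])
      show "integrable (lebesgue_on U) (\<lambda>x. \<bar>F x\<bar>)" using F by simp
      show "AE x in lebesgue_on U. (\<lambda>j. F x * \<psi> j x) \<longlonglongrightarrow> F x * \<sigma> x"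
        by (intro AE_I2 tendsto_intros lim)
      show "AE x in lebesgue_on U. norm (F x * \<psi> j x) \<le> \<bar>F x\<bar>" for j
        using \<psi>1 by (intro AE_I2) (auto simp: abs_mult mult_left_le)
    qed measurable
    then have le: "(LINT x|lebesgue_on U. F x * \<sigma> x) \<le> A"
      using A[OF \<psi> \<psi>1] by (intro LIMSEQ_le_const2) auto
    have \<sigma>1: "\<bar>\<sigma> x\<bar> \<le> 1" for x by (simp add: \<sigma>_def)
    have "(LINT x|lebesgue_on U. \<bar>F x\<bar> * (2 * indicator (K n) x - 1)) \<le> (LINT x|lebesgue_on U. F x * \<sigma> x)"
    proof (rule integral_mono)
      show "integrable (lebesgue_on U) (\<lambda>x. \<bar>F x\<bar> * (2 * indicator (K n) x - 1))"
        by (rule Bochner_Integration.integrable_bound[OF F], measurable) (auto simp: abs_mult indicator_def)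
      show "integrable (lebesgue_on U) (\<lambda>x. F x * \<sigma> x)"
        by (rule Bochner_Integration.integrable_bound[OF F], measurable) (auto simp: abs_mult mult_left_le \<sigma>1)
      fix x
      consider "x \<in> KP n" | "x \<in> KN n" | "x \<notin> K n" unfolding K_def by blast
      then show "\<bar>F x\<bar> * (2 * indicator (K n) x - 1) \<le> F x * \<sigma> x"
      proof cases
        case 1
        then have "F x > 0" "\<sigma> x = 1" "x \<in> K n" using KP(2)[of n] P(4) by (auto simp: \<sigma>_def K_def)
        then show ?thesis by simp
      next
        case 2
        then have "F x < 0" "\<sigma> x = -1" "x \<in> K n" using KN(2)[of n] Q(4)[of x] disj[of x] by (auto simp: \<sigma>_def K_def)
        then show ?thesis by simp
      next
        case 3
        have "\<bar>F x * \<sigma> x\<bar> \<le> \<bar>F x\<bar>" using \<sigma>1[of x] by (simp add: abs_mult mult_left_le)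
        then show ?thesis using 3 by simp
      qed
    qed
    with le show ?thesis by linarith
  qed
  have "(\<lambda>n. LINT x|lebesgue_on U. \<bar>F x\<bar> * (2 * indicator (K n) x - 1)) \<longlonglongrightarrow> (LINT x|lebesgue_on U. \<bar>F x\<bar>)"
  proof (rule integral_dominated_convergence[where w = "\<lambda>x. \<bar>F x\<bar>"])
    show "integrable (lebesgue_on U) (\<lambda>x. \<bar>F x\<bar>)" using F by simp
    have "AE x in lebesgue_on U. x \<in> U" using AE_space[of "lebesgue_on U"] by simp
    then show "AE x in lebesgue_on U. (\<lambda>n. \<bar>F x\<bar> * (2 * indicator (K n) x - 1)) \<longlonglongrightarrow> \<bar>F x\<bar>"
      using KP(4) KN(4)
    proof eventually_elim
      case (elim x)
      show ?case
      proof (cases "F x = 0")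
        case False
        then obtain N where "x \<in> K N" using elim unfolding K_def by (cases "F x > 0") auto
        then have "x \<in> K n" if "N \<le> n" for n
          using that KP(3) KN(3) unfolding K_def incseq_def by blast
        then show ?thesis by (intro tendsto_eventually eventually_sequentiallyI[of N]) simp
      qed simp
    qed
    show "AE x in lebesgue_on U. norm (\<bar>F x\<bar> * (2 * indicator (K n) x - 1)) \<le> \<bar>F x\<bar>" for n
      by (intro AE_I2) (auto simp: abs_mult indicator_def)
  qed measurable
  then show ?thesis using bound by (intro LIMSEQ_le_const2) auto
qed

section \<open>Uniqueness of weak gradients\<close>

lemma lebesgue_on_integrable_iff:
  fixes f :: "'a::euclidean_space \<Rightarrow> 'b::euclidean_space"
  assumes "open \<Omega>"
  shows "integrable (lebesgue_on \<Omega>) f \<longleftrightarrow> integrable lebesgue (\<lambda>x. indicator \<Omega> x *\<^sub>R f x)"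
  using assms by (intro integrable_restrict_space) auto

lemma lebesgue_on_integral_eq:
  fixes f :: "'a::euclidean_space \<Rightarrow> 'b::euclidean_space"
  assumes "open \<Omega>"
  shows "(LINT x|lebesgue_on \<Omega>. f x) = (LINT x|lebesgue. indicator \<Omega> x *\<^sub>R f x)"
  using assms by (intro integral_restrict_space) auto

lemma lebesgue_on_integral_subset:
  fixes f :: "'a::euclidean_space \<Rightarrow> real"
  assumes "open U" "open \<Omega>" "U \<subseteq> \<Omega>" "\<And>x. x \<notin> U \<Longrightarrow> f x = 0"
  shows "(LINT x|lebesgue_on \<Omega>. f x) = (LINT x|lebesgue_on U. f x)"
  unfolding lebesgue_on_integral_eq[OF assms(1)] lebesgue_on_integral_eq[OF assms(2)]
  using assms(3,4) by (intro Bochner_Integration.integral_cong) (auto simp: indicator_def)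

lemma continuous_lebesgue_measurable:
  fixes \<psi> :: "'a::euclidean_space \<Rightarrow> real"
  assumes "continuous_on UNIV \<psi>"
  shows "\<psi> \<in> borel_measurable lebesgue" "\<psi> \<in> borel_measurable (lebesgue_on \<Omega>)"
proof -
  have "\<psi> \<in> borel_measurable borel" using assms by (rule borel_measurable_continuous_onI)
  then show "\<psi> \<in> borel_measurable lebesgue" by (intro measurable_completion) simp
  then show "\<psi> \<in> borel_measurable (lebesgue_on \<Omega>)" by (rule measurable_restrict_space1)
qed

lemma integrable_scaleR_bounded:
  fixes g :: "'a \<Rightarrow> 'b::euclidean_space" and \<psi> :: "'a \<Rightarrow> real"
  assumes "integrable M g" "\<psi> \<in> borel_measurable M" "\<And>x. \<bar>\<psi> x\<bar> \<le> B"
  shows "integrable M (\<lambda>x. \<psi> x *\<^sub>R g x)"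
proof (rule Bochner_Integration.integrable_bound)
  show "integrable M (\<lambda>x. B *\<^sub>R g x)" using assms by simp
  show "AE x in M. norm (\<psi> x *\<^sub>R g x) \<le> norm (B *\<^sub>R g x)"
    using assms(3) by (intro AE_I2) (auto intro!: mult_right_mono intro: order_trans[OF _ abs_ge_self])
qed (use assms in auto)

lemma locally_integrable_test:
  fixes g :: "'a::euclidean_space \<Rightarrow> 'b::euclidean_space"
  assumes "open \<Omega>" "locally_integrable \<Omega> g" "continuous_on UNIV \<psi>"
    "compact K" "K \<subseteq> \<Omega>" "\<And>x. x \<notin> K \<Longrightarrow> \<psi> x = (0::real)"
  shows "integrable (lebesgue_on \<Omega>) (\<lambda>x. \<psi> x *\<^sub>R g x)"
proof -
  have "integrable lebesgue (\<lambda>x. indicator K x *\<^sub>R g x)"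
    using assms unfolding locally_integrable_def set_integrable_def by auto
  moreover obtain B where "\<And>x. \<bar>\<psi> x\<bar> \<le> B" using compact_support_bounded[OF assms(3,4,6)] by blast
  ultimately have "integrable lebesgue (\<lambda>x. \<psi> x *\<^sub>R (indicator K x *\<^sub>R g x))"
    by (rule integrable_scaleR_bounded[OF _ continuous_lebesgue_measurable(1)[OF assms(3)]])
  moreover have "(\<lambda>x. \<psi> x *\<^sub>R (indicator K x *\<^sub>R g x)) = (\<lambda>x. indicator \<Omega> x *\<^sub>R (\<psi> x *\<^sub>R g x))"
    using assms(5,6) by (auto simp: indicator_def fun_eq_iff)
  ultimately show ?thesis by (simp add: lebesgue_on_integrable_iff[OF assms(1)])
qed

text \<open>Shifts by vectors of length at most \<open>\<delta>\<close> keep these points inside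
  \<open>\<Omega>\<close>; the strict inequality makes the set open.\<close>

definition inner_set :: "'a::euclidean_space set \<Rightarrow> real \<Rightarrow> 'a set" where
  "inner_set \<Omega> \<delta> = {x. \<delta> < infdist x (- \<Omega>)}"

lemma open_inner_set: "open (inner_set \<Omega> \<delta>)"
  unfolding inner_set_def by (intro open_Collect_less continuous_intros)

lemma inner_set_translate:
  assumes "x \<in> inner_set \<Omega> \<delta>" "norm h \<le> \<delta>"
  shows "x + h \<in> \<Omega>"
proof (rule ccontr)
  assume "x + h \<notin> \<Omega>"
  then have "infdist x (- \<Omega>) \<le> dist x (x + h)" by (intro infdist_le) simp
  then show False using assms by (simp add: inner_set_def dist_norm)
qed

lemma inner_set_subset: "0 \<le> \<delta> \<Longrightarrow> inner_set \<Omega> \<delta> \<subseteq> \<Omega>"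
  using inner_set_translate[of _ \<Omega> \<delta> 0] by auto

lemma inner_set_subset_compact:
  assumes "bounded \<Omega>" "0 < \<delta>"
  obtains K where "compact K" "inner_set \<Omega> \<delta> \<subseteq> K" "K \<subseteq> \<Omega>"
proof
  let ?K = "{x. \<delta> \<le> infdist x (- \<Omega>)}"
  show sub: "?K \<subseteq> \<Omega>" using assms(2) by (auto intro: ccontr)
  have "closed ?K" by (intro closed_Collect_le continuous_intros)
  then show "compact ?K" using bounded_subset[OF assms(1) sub] by (simp add: compact_eq_bounded_closed)
  show "inner_set \<Omega> \<delta> \<subseteq> ?K" by (auto simp: inner_set_def)
qed

lemma eventually_mem_inner_set:
  assumes "open \<Omega>" "bounded (\<Omega> :: 'a::euclidean_space set)" "x \<in> \<Omega>"
  shows "\<forall>\<^sub>F j in sequentially. x \<in> inner_set \<Omega> (1 / real (Suc j))"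
proof -
  \<comment> \<open>Boundedness enters here: \<open>infdist\<close> to the empty set is
    \<open>0\<close> by convention, which would make these inner sets empty.\<close>
  have "- \<Omega> \<noteq> {}" using assms(2) not_bounded_UNIV by (metis Compl_empty_eq double_complement)
  then have "0 < infdist x (- \<Omega>)" using assms by (intro infdist_pos_not_in_closed) (auto simp: closed_Compl)
  then have "\<forall>\<^sub>F j in sequentially. 1 / real (Suc j) < infdist x (- \<Omega>)"
    by (intro order_tendstoD(2)[OF LIMSEQ_inverse_real_of_nat[unfolded inverse_eq_divide]])
  then show ?thesis by (simp add: inner_set_def)
qed

text \<open>The fundamental lemma of the calculus of variations. Weak gradients are only locally
  integrable, so the duality bound is applied with \<open>A = 0\<close> on inner sets, which lie in
  compact subsets of \<open>\<Omega>\<close> and exhaust it.\<close>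

lemma has_weak_gradient_unique:
  assumes "open \<Omega>" "bounded \<Omega>" "has_weak_gradient \<Omega> u g" "has_weak_gradient \<Omega> u g'"
  shows "AE x in lebesgue_on \<Omega>. g x = g' x"
proof -
  have loc: "locally_integrable \<Omega> g" "locally_integrable \<Omega> g'" using assms by (auto simp: has_weak_gradient_def)
  have *: "AE x in lebesgue. x \<in> inner_set \<Omega> (1 / real (Suc j)) \<longrightarrow> (g x - g' x) \<bullet> b = 0" if b: "b \<in> Basis" for j b
  proof -
    let ?U = "inner_set \<Omega> (1 / real (Suc j))"
    have U: "open ?U" "?U \<subseteq> \<Omega>" by (auto simp: open_inner_set intro!: inner_set_subset)
    obtain K where K: "compact K" "?U \<subseteq> K" "K \<subseteq> \<Omega>"
      using inner_set_subset_compact[OF assms(2), of "1 / real (Suc j)"] by (metis of_nat_0_less_iff zero_less_Suc zero_less_divide_1_iff)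
    have int: "integrable (lebesgue_on ?U) h" if "locally_integrable \<Omega> h" for h :: "'a \<Rightarrow> 'a"
    proof -
      have "set_integrable lebesgue K h" using that K by (auto simp: locally_integrable_def)
      moreover have "?U \<in> sets lebesgue" using U(1) by auto
      ultimately have "set_integrable lebesgue ?U h" using K(2) by (rule set_integrable_subset)
      then show ?thesis unfolding lebesgue_on_integrable_iff[OF U(1)] set_integrable_def .
    qed
    let ?F = "\<lambda>x. (g x - g' x) \<bullet> b"
    have F: "integrable (lebesgue_on ?U) ?F"
      using int[OF loc(1)] int[OF loc(2)] by auto
    have "(LINT x|lebesgue_on ?U. \<bar>?F x\<bar>) \<le> 0"
    proof (rule L1_norm_le_test_functions[OF U(1) F])
      fix \<psi> assume \<psi>: "\<psi> \<in> test_functions ?U"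
      then have \<psi>': "\<psi> \<in> test_functions \<Omega>" using test_functions_mono[OF U(2)] by auto
      obtain L where L: "compact L" "L \<subseteq> ?U" "\<And>x. x \<notin> L \<Longrightarrow> \<psi> x = 0" using test_functionsE[OF \<psi>] by metis
      have cont: "continuous_on UNIV \<psi>" using test_function_C_k[OF \<psi>, of 0] by simp
      have int: "integrable (lebesgue_on \<Omega>) (\<lambda>x. (h x \<bullet> b) * \<psi> x)" if "locally_integrable \<Omega> h" for h
      proof -
        have "integrable (lebesgue_on \<Omega>) (\<lambda>x. \<psi> x *\<^sub>R h x)"
          using L U by (intro locally_integrable_test[OF assms(1) that cont L(1)]) auto
        then have "integrable (lebesgue_on \<Omega>) (\<lambda>x. (\<psi> x *\<^sub>R h x) \<bullet> b)"
          by (rule integrable_inner_left)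
        then show ?thesis by (simp add: mult.commute)
      qed
      have "(LINT x|lebesgue_on ?U. ?F x * \<psi> x) = (LINT x|lebesgue_on \<Omega>. ?F x * \<psi> x)"
        using L by (intro lebesgue_on_integral_subset[symmetric] U assms) auto
      also have "\<dots> = (LINT x|lebesgue_on \<Omega>. (g x \<bullet> b) * \<psi> x) - (LINT x|lebesgue_on \<Omega>. (g' x \<bullet> b) * \<psi> x)"
        using int[OF loc(1)] int[OF loc(2)] by (simp add: inner_simps left_diff_distrib)
      also have "\<dots> = 0" using assms(3,4) \<psi>' b unfolding has_weak_gradient_def by force
      finally show "(LINT x|lebesgue_on ?U. ?F x * \<psi> x) \<le> 0" by simp
    qed
    moreover have "0 \<le> (LINT x|lebesgue_on ?U. \<bar>?F x\<bar>)" by simp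
    ultimately have "(LINT x|lebesgue_on ?U. \<bar>?F x\<bar>) = 0" by linarith
    then have "AE x in lebesgue_on ?U. \<bar>?F x\<bar> = 0"
      using F by (subst (asm) integral_nonneg_eq_0_iff_AE) auto
    then show ?thesis using U(1) by (subst (asm) AE_restrict_space_iff) auto
  qed
  have "AE x in lebesgue. \<forall>j. \<forall>b\<in>Basis. x \<in> inner_set \<Omega> (1 / real (Suc j)) \<longrightarrow> (g x - g' x) \<bullet> b = 0"
    unfolding AE_all_countable using * by (intro allI AE_finite_allI finite_Basis)
  then have "AE x in lebesgue. x \<in> \<Omega> \<longrightarrow> g x = g' x"
  proof eventually_elim
    case (elim x)
    show ?case
    proof
      assume "x \<in> \<Omega>"
      then obtain j where "x \<in> inner_set \<Omega> (1 / real (Suc j))"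
        using eventually_mem_inner_set[OF assms(1,2)] by (auto simp: eventually_sequentially)
      then have "(g x - g' x) \<bullet> b = 0" if "b \<in> Basis" for b using elim that by blast
      then show "g x = g' x" using euclidean_eqI[of "g x" "g' x"] unfolding inner_diff_left right_minus_eq by blast
    qed
  qed
  then show ?thesis using assms(1) by (subst AE_restrict_space_iff) auto
qed

section \<open>Translations and ball averages\<close>

lemma linear_eq_sum_Basis:
  fixes f :: "'a::euclidean_space \<Rightarrow> real"
  assumes "linear f"
  shows "f h = (\<Sum>b\<in>Basis. (h \<bullet> b) * f b)"
proof -
  have "f h = f (\<Sum>b\<in>Basis. (h \<bullet> b) *\<^sub>R b)" by (simp add: euclidean_representation)
  also have "\<dots> = (\<Sum>b\<in>Basis. (h \<bullet> b) * f b)" by (simp add: linear_sum[OF assms] linear_scale[OF assms])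
  finally show ?thesis .
qed

text \<open>The partial derivatives are continuous with compact support, hence bounded. The constant
  bounds difference quotients along a line and so provides the majorant for differentiating under
  the integral.\<close>

lemma test_function_Lipschitz:
  fixes \<psi> :: "'a::euclidean_space \<Rightarrow> real"
  assumes "\<psi> \<in> test_functions \<Omega>"
  obtains L where "\<And>x y. \<bar>\<psi> x - \<psi> y\<bar> \<le> L * norm (x - y)"
proof -
  let ?D = "\<lambda>x. frechet_derivative \<psi> (at x)"
  obtain K where K: "compact K" "\<And>x. x \<notin> K \<Longrightarrow> ?D x = (\<lambda>h. 0)" using test_functionsE[OF assms] by metis
  have C1: "C_k (Suc 0) \<psi>" using assms by (rule test_function_C_k)
  have "\<exists>B\<ge>0. \<forall>x. \<bar>?D x b\<bar> \<le> B" if "b \<in> Basis" for b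
    using C_k_SucD(2)[OF C1 that] K by (intro compact_support_bounded[OF _ K(1)]) auto
  then obtain B where B: "\<And>b x. b \<in> Basis \<Longrightarrow> \<bar>?D x b\<bar> \<le> B b" by metis
  have "\<bar>?D x h\<bar> \<le> (\<Sum>b\<in>Basis. B b) * norm h" for x h
  proof -
    have lin: "linear (?D x)" using C_k_SucD(1)[OF C1] by (rule has_derivative_linear)
    have "?D x h = (\<Sum>b\<in>Basis. (h \<bullet> b) * ?D x b)" by (rule linear_eq_sum_Basis[OF lin])
    also have "\<bar>\<dots>\<bar> \<le> (\<Sum>b\<in>Basis. \<bar>(h \<bullet> b) * ?D x b\<bar>)" by (rule sum_abs)
    also have "\<dots> \<le> (\<Sum>b\<in>Basis. norm h * B b)"
      using B by (intro sum_mono) (auto simp: abs_mult intro!: mult_mono Basis_le_norm)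
    finally show ?thesis by (simp add: sum_distrib_left mult.commute)
  qed
  then have "onorm (?D x) \<le> (\<Sum>b\<in>Basis. B b)" for x by (intro onorm_le) simp
  then have "\<bar>\<psi> x - \<psi> y\<bar> \<le> (\<Sum>b\<in>Basis. B b) * norm (x - y)" for x y
    using differentiable_bound[of UNIV \<psi> ?D "\<Sum>b\<in>Basis. B b" x y] C_k_SucD(1)[OF C1] by simp
  then show thesis by (rule that)
qed

text \<open>
  With \<open>G s = \<integral> u x * \<psi> (x - s *\<^sub>R h) dx\<close> the left-hand side is \<open>\<bar>G 1 - G 0\<bar>\<close>, and the
  definition of the weak gradient bounds \<open>G'\<close>.
\<close>

lemma weak_gradient_translation:
  fixes u :: "'a::euclidean_space \<Rightarrow> real"
  assumes \<Omega>: "open \<Omega>" and wg: "has_weak_gradient \<Omega> u g"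
    and u: "integrable (lebesgue_on \<Omega>) u" and g: "integrable (lebesgue_on \<Omega>) g"
    and \<psi>: "\<psi> \<in> test_functions U" and \<psi>1: "\<And>x. \<bar>\<psi> x\<bar> \<le> 1"
    and U: "\<And>x s. x \<in> U \<Longrightarrow> 0 \<le> s \<Longrightarrow> s \<le> 1 \<Longrightarrow> x + s *\<^sub>R h \<in> \<Omega>"
  shows "\<bar>(LINT x|lebesgue_on \<Omega>. u x * \<psi> (x - h)) - (LINT x|lebesgue_on \<Omega>. u x * \<psi> x)\<bar>
           \<le> norm h * (LINT x|lebesgue_on \<Omega>. norm (g x))"
proof -
  let ?D = "\<lambda>x. frechet_derivative \<psi> (at x)"
  define G where "G s = (LINT x|lebesgue_on \<Omega>. u x * \<psi> (x - s *\<^sub>R h))" for s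
  define G' where "G' s = - (LINT x|lebesgue_on \<Omega>. u x * ?D (x - s *\<^sub>R h) h)" for s
  obtain L where L: "\<And>x y. \<bar>\<psi> x - \<psi> y\<bar> \<le> L * norm (x - y)" using test_function_Lipschitz[OF \<psi>] by blast
  obtain K where K: "compact K" "K \<subseteq> U" "\<And>x. x \<notin> K \<Longrightarrow> \<psi> x = 0" using test_functionsE[OF \<psi>] by metis
  have Ck: "C_k k (\<lambda>x. \<psi> (x - s *\<^sub>R h))" for k s by (intro C_k_translate test_function_C_k[OF \<psi>])
  have der: "(\<psi> has_derivative ?D x) (at x)" for x
    by (rule C_k_SucD(1)[OF test_function_C_k[OF \<psi>, of "Suc 0"]])
  have lin: "linear (?D x)" for x by (rule has_derivative_linear[OF der])
  have expand: "?D x h = (\<Sum>b\<in>Basis. (h \<bullet> b) * ?D x b)" for x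
    by (rule linear_eq_sum_Basis[OF lin])
  have cont: "continuous_on UNIV (\<lambda>x. \<psi> (x - s *\<^sub>R h))" for s using Ck[of 0 s] by simp
  have [measurable]: "(\<lambda>x. \<psi> (x - s *\<^sub>R h)) \<in> borel_measurable (lebesgue_on \<Omega>)" for s
    by (rule continuous_lebesgue_measurable(2)[OF cont])
  have [measurable]: "u \<in> borel_measurable (lebesgue_on \<Omega>)" "g \<in> borel_measurable (lebesgue_on \<Omega>)" using u g by auto
  have int: "integrable (lebesgue_on \<Omega>) (\<lambda>x. u x * \<psi> (x - s *\<^sub>R h))" for s
    using integrable_scaleR_bounded[OF u continuous_lebesgue_measurable(2)[OF cont[of s]], of 1] \<psi>1
    by (simp add: mult.commute)
  have line: "((\<lambda>s. \<psi> (x - s *\<^sub>R h)) has_real_derivative - ?D (x - s *\<^sub>R h) h) (at s)" for x s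
  proof -
    have "((\<lambda>s. x - s *\<^sub>R h) has_derivative (\<lambda>t. - (t *\<^sub>R h))) (at s)" by (auto intro!: derivative_eq_intros)
    from has_derivative_compose[OF this der]
    have "((\<lambda>s. \<psi> (x - s *\<^sub>R h)) has_derivative (\<lambda>t. ?D (x - s *\<^sub>R h) (- (t *\<^sub>R h)))) (at s)" .
    moreover have "(\<lambda>t. ?D (x - s *\<^sub>R h) (- (t *\<^sub>R h))) = (*) (- ?D (x - s *\<^sub>R h) h)"
    proof
      show "?D (x - s *\<^sub>R h) (- (t *\<^sub>R h)) = - ?D (x - s *\<^sub>R h) h * t" for t
        using linear_cmul[OF lin, of _ "-t" h] by simp
    qed
    ultimately show ?thesis by (simp only: has_field_derivative_def)
  qed
  \<comment> \<open>Differentiation under the integral, tested along arbitrary sequences so that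
    dominated convergence applies with majorant
    \<open>(L * norm h) * \<bar>u x\<bar>\<close>.\<close>
  have DERIV_G: "(G has_real_derivative G' s) (at s)" for s
    unfolding has_field_derivative_iff tendsto_at_iff_sequentially
  proof (intro allI impI)
    fix X :: "nat \<Rightarrow> real" assume X: "\<forall>i. X i \<in> UNIV - {s}" "X \<longlonglongrightarrow> s"
    let ?q = "\<lambda>i x. (\<psi> (x - X i *\<^sub>R h) - \<psi> (x - s *\<^sub>R h)) / (X i - s)"
    have q: "(\<lambda>i. ?q i x) \<longlonglongrightarrow> - ?D (x - s *\<^sub>R h) h" for x
      using line[of x s] X unfolding has_field_derivative_iff tendsto_at_iff_sequentially by (auto simp: o_def)
    have q_le: "\<bar>?q i x\<bar> \<le> L * norm h" for i x
    proof -
      have "\<bar>\<psi> (x - X i *\<^sub>R h) - \<psi> (x - s *\<^sub>R h)\<bar> \<le> L * norm ((x - X i *\<^sub>R h) - (x - s *\<^sub>R h))" by (rule L)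
      also have "(x - X i *\<^sub>R h) - (x - s *\<^sub>R h) = (s - X i) *\<^sub>R h" by (simp add: algebra_simps)
      finally have "\<bar>\<psi> (x - X i *\<^sub>R h) - \<psi> (x - s *\<^sub>R h)\<bar> \<le> (L * norm h) * \<bar>X i - s\<bar>"
        by (simp only: norm_scaleR abs_minus_commute[of s] mult_ac)
      moreover have "0 < \<bar>X i - s\<bar>" using X(1) by auto
      ultimately show ?thesis by (simp only: abs_divide pos_divide_le_eq)
    qed
    have meas: "(\<lambda>x. - ?D (x - s *\<^sub>R h) h) \<in> borel_measurable (lebesgue_on \<Omega>)"
      by (rule borel_measurable_LIMSEQ_real[OF q]) measurable
    have "(\<lambda>i. LINT x|lebesgue_on \<Omega>. u x * ?q i x) \<longlonglongrightarrow> (LINT x|lebesgue_on \<Omega>. u x * (- ?D (x - s *\<^sub>R h) h))"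
    proof (rule integral_dominated_convergence[where w = "\<lambda>x. (L * norm h) * \<bar>u x\<bar>"])
      show "integrable (lebesgue_on \<Omega>) (\<lambda>x. (L * norm h) * \<bar>u x\<bar>)" using u by auto
      show "AE x in lebesgue_on \<Omega>. (\<lambda>i. u x * ?q i x) \<longlonglongrightarrow> u x * (- ?D (x - s *\<^sub>R h) h)"
        by (intro AE_I2 tendsto_mult tendsto_const q)
      show "AE x in lebesgue_on \<Omega>. norm (u x * ?q i x) \<le> (L * norm h) * \<bar>u x\<bar>" for i
        unfolding real_norm_def abs_mult mult.commute[of "L * norm h"] by (intro AE_I2 mult_left_mono q_le) auto
    qed (use meas in measurable)
    moreover have "(LINT x|lebesgue_on \<Omega>. u x * ?q i x) = (G (X i) - G s) / (X i - s)" for i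
      unfolding G_def Bochner_Integration.integral_diff[OF int int, symmetric]
      by (simp add: right_diff_distrib flip: integral_divide_zero)
    moreover have "(LINT x|lebesgue_on \<Omega>. u x * (- ?D (x - s *\<^sub>R h) h)) = G' s" by (simp add: G'_def)
    ultimately show "((\<lambda>y. (G y - G s) / (y - s)) \<circ> X) \<longlonglongrightarrow> G' s"
      unfolding o_def by (simp only:)
  qed
  have G'_le: "\<bar>G' s\<bar> \<le> norm h * (LINT x|lebesgue_on \<Omega>. norm (g x))" if s: "0 \<le> s" "s \<le> 1" for s
  proof -
    \<comment> \<open>For \<open>s\<close> between \<open>0\<close> and \<open>1\<close> the shifted
      support stays in \<open>\<Omega>\<close>, so this function is admissible in the definition of
      the weak gradient.\<close>
    define \<psi>s where "\<psi>s = (\<lambda>x. \<psi> (x - s *\<^sub>R h))"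
    have \<psi>s: "\<psi>s \<in> test_functions \<Omega>"
    proof (rule test_functionsI)
      show "C_k k \<psi>s" for k unfolding \<psi>s_def by (rule Ck)
      show "compact ((\<lambda>x. x + s *\<^sub>R h) ` K)" using K by (intro compact_continuous_image continuous_intros)
      show "(\<lambda>x. x + s *\<^sub>R h) ` K \<subseteq> \<Omega>" using K(2) U s by auto
      show "\<psi>s x = 0" if "x \<notin> (\<lambda>x. x + s *\<^sub>R h) ` K" for x
      proof -
        have "x - s *\<^sub>R h \<notin> K" using that by (metis diff_add_cancel imageI)
        then show ?thesis unfolding \<psi>s_def by (rule K(3))
      qed
    qed
    have D: "frechet_derivative \<psi>s (at x) = ?D (x - s *\<^sub>R h)" for x
    proof -
      have "((\<lambda>x. x - s *\<^sub>R h) has_derivative (\<lambda>t. t)) (at x)" by (auto intro!: derivative_eq_intros)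
      from has_derivative_compose[OF this der] show ?thesis
        unfolding \<psi>s_def by (intro frechet_derivative_at[symmetric])
    qed
    have \<psi>s_meas [measurable]: "\<psi>s \<in> borel_measurable (lebesgue_on \<Omega>)" unfolding \<psi>s_def by measurable
    have Dcont: "continuous_on UNIV (\<lambda>x. ?D (x - s *\<^sub>R h) b)" if "b \<in> Basis" for b
      using C_k_SucD(2)[OF test_function_C_k[OF \<psi>s, of "Suc 0"] that] by (simp add: D)
    have intD: "integrable (lebesgue_on \<Omega>) (\<lambda>x. u x * ?D (x - s *\<^sub>R h) b)" if b: "b \<in> Basis" for b
    proof -
      obtain K' where K': "compact K'" "\<And>x. x \<notin> K' \<Longrightarrow> frechet_derivative \<psi>s (at x) = (\<lambda>h. 0)"
        using test_functionsE[OF \<psi>s] by metis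
      have "?D (x - s *\<^sub>R h) b = 0" if "x \<notin> K'" for x using K'(2)[OF that] by (simp add: D)
      then obtain B where B: "\<And>x. \<bar>?D (x - s *\<^sub>R h) b\<bar> \<le> B"
        using compact_support_bounded[OF Dcont[OF b] K'(1)] by blast
      show ?thesis
        using integrable_scaleR_bounded[OF u continuous_lebesgue_measurable(2)[OF Dcont[OF b]] B]
        by (simp add: mult.commute)
    qed
    have intg: "integrable (lebesgue_on \<Omega>) (\<lambda>x. (g x \<bullet> b) * \<psi>s x)" for b
      using integrable_scaleR_bounded[OF integrable_inner_left[OF g, of b] \<psi>s_meas, of 1] \<psi>1
      by (simp add: \<psi>s_def mult.commute)
    \<comment> \<open>The weak gradient identity is available for basis directions only, so the
      derivative in direction \<open>h\<close> is expanded and the sum reassembled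
      afterwards.\<close>
    have "G' s = - (LINT x|lebesgue_on \<Omega>. (\<Sum>b\<in>Basis. (h \<bullet> b) * (u x * ?D (x - s *\<^sub>R h) b)))"
      unfolding G'_def expand by (simp add: sum_distrib_left mult.left_commute)
    also have "\<dots> = - (\<Sum>b\<in>Basis. (h \<bullet> b) * (LINT x|lebesgue_on \<Omega>. u x * ?D (x - s *\<^sub>R h) b))"
      using intD by (subst Bochner_Integration.integral_sum) auto
    also have "\<dots> = (\<Sum>b\<in>Basis. (h \<bullet> b) * (LINT x|lebesgue_on \<Omega>. (g x \<bullet> b) * \<psi>s x))"
    proof -
      have "(LINT x|lebesgue_on \<Omega>. u x * ?D (x - s *\<^sub>R h) b) = - (LINT x|lebesgue_on \<Omega>. (g x \<bullet> b) * \<psi>s x)"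
        if "b \<in> Basis" for b
        using wg \<psi>s that unfolding has_weak_gradient_def D[symmetric] by blast
      then show ?thesis by (simp add: sum_negf)
    qed
    also have "\<dots> = (LINT x|lebesgue_on \<Omega>. (\<Sum>b\<in>Basis. (h \<bullet> b) * ((g x \<bullet> b) * \<psi>s x)))"
      using intg by (subst Bochner_Integration.integral_sum) auto
    also have "\<dots> = (LINT x|lebesgue_on \<Omega>. (h \<bullet> g x) * \<psi>s x)"
      by (intro Bochner_Integration.integral_cong refl, subst euclidean_inner) (simp add: sum_distrib_right mult.assoc)
    finally have "\<bar>G' s\<bar> = \<bar>LINT x|lebesgue_on \<Omega>. (h \<bullet> g x) * \<psi>s x\<bar>" by simp
    also have "\<dots> \<le> (LINT x|lebesgue_on \<Omega>. \<bar>(h \<bullet> g x) * \<psi>s x\<bar>)" by (rule integral_abs_bound)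
    also have "\<dots> \<le> (LINT x|lebesgue_on \<Omega>. norm h * norm (g x))"
    proof (rule integral_mono')
      show "\<bar>(h \<bullet> g x) * \<psi>s x\<bar> \<le> norm h * norm (g x)" for x
      proof -
        have "\<bar>h \<bullet> g x\<bar> * \<bar>\<psi>s x\<bar> \<le> (norm h * norm (g x)) * 1"
          using \<psi>1 by (intro mult_mono Cauchy_Schwarz_ineq2) (auto simp: \<psi>s_def)
        then show ?thesis by (simp add: abs_mult)
      qed
    qed (use g in auto)
    finally show ?thesis by simp
  qed
  obtain z where "0 < z" "z < 1" "G 1 - G 0 = (1 - 0) * G' z"
    using MVT2[of 0 1 G G'] DERIV_G by auto
  then show ?thesis using G'_le[of z] by (simp add: G_def)
qed

text \<open>Shifts and Fubini need joint measurability of \<open>v (x + h)\<close> in both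
  variables, which holds for Borel \<open>v\<close>. Extension by zero lets the shift leave
  \<open>\<Omega>\<close>.\<close>

lemma borel_representative:
  fixes u :: "'a::euclidean_space \<Rightarrow> real"
  assumes "open \<Omega>" "integrable (lebesgue_on \<Omega>) u"
  obtains v where "v \<in> borel_measurable borel" "integrable lborel v"
    "AE x in lebesgue. v x = indicator \<Omega> x * u x"
proof -
  have f: "integrable lebesgue (\<lambda>x. indicator \<Omega> x * u x)"
    using assms by (simp add: lebesgue_on_integrable_iff)
  then obtain v where v: "v \<in> borel_measurable lborel" "AE x in lborel. indicator \<Omega> x * u x = v x"
    using completion_ex_borel_measurable_real[of "\<lambda>x. indicator \<Omega> x * u x" lborel] by auto
  have ae: "AE x in lebesgue. v x = indicator \<Omega> x * u x"
    using AE_completion[OF v(2)] by eventually_elim simp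
  have "integrable lebesgue v"
    using f ae v(1) by (subst integrable_cong_AE[of _ _ "\<lambda>x. indicator \<Omega> x * u x"]) (auto intro: measurable_completion)
  then have "integrable lborel v" using v(1) by (simp add: integrable_completion)
  then show thesis using v(1) ae by (intro that) auto
qed

lemma lborel_integral_translate:
  fixes F :: "'a::euclidean_space \<Rightarrow> real"
  assumes "F \<in> borel_measurable borel"
  shows "(LINT x|lborel. F (x + h)) = (LINT x|lborel. F x)"
    "integrable lborel (\<lambda>x. F (x + h)) \<longleftrightarrow> integrable lborel F"
proof -
  have "(LINT x|distr lborel borel ((+) h). F x) = (LINT x|lborel. F (h + x))"
    using assms by (intro integral_distr) auto
  then show "(LINT x|lborel. F (x + h)) = (LINT x|lborel. F x)"
    by (simp add: lborel_distr_plus add.commute)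
  have "integrable (distr lborel borel ((+) h)) F \<longleftrightarrow> integrable lborel (\<lambda>x. F (h + x))"
    using assms by (intro integrable_distr_eq) auto
  then show "integrable lborel (\<lambda>x. F (x + h)) \<longleftrightarrow> integrable lborel F"
    by (simp add: lborel_distr_plus add.commute)
qed

lemma representative_integral:
  fixes u v \<psi> :: "'a::euclidean_space \<Rightarrow> real"
  assumes "open \<Omega>" "integrable (lebesgue_on \<Omega>) u" "v \<in> borel_measurable borel"
    "AE x in lebesgue. v x = indicator \<Omega> x * u x" "\<psi> \<in> borel_measurable borel"
  shows "(LINT x|lborel. v x * \<psi> x) = (LINT x|lebesgue_on \<Omega>. u x * \<psi> x)"
proof -
  have m: "(\<lambda>x. v x * \<psi> x) \<in> borel_measurable lborel" using assms by simp
  have u: "(\<lambda>x. indicator \<Omega> x * u x) \<in> borel_measurable lebesgue"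
    using assms(2) unfolding lebesgue_on_integrable_iff[OF assms(1)] by auto
  have \<psi>: "\<psi> \<in> borel_measurable lebesgue" using assms(5) by (intro measurable_completion) simp
  have "(LINT x|lborel. v x * \<psi> x) = (LINT x|lebesgue. v x * \<psi> x)"
    using m by (rule integral_completion[symmetric])
  also have "\<dots> = (LINT x|lebesgue. (indicator \<Omega> x * u x) * \<psi> x)"
  proof (rule integral_cong_AE)
    show "AE x in lebesgue. v x * \<psi> x = indicator \<Omega> x * u x * \<psi> x"
      using assms(4) by eventually_elim simp
  qed (use m u \<psi> in \<open>auto intro: measurable_completion\<close>)
  also have "\<dots> = (LINT x|lebesgue_on \<Omega>. u x * \<psi> x)"
    by (simp add: lebesgue_on_integral_eq[OF assms(1)] mult.assoc)
  finally show ?thesis .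
qed

text \<open>By duality it is enough to pair with test functions: a change of variables moves the
  shift from \<open>v\<close> to the test function, and the resulting bound is independent of the
  latter. The nonnegative integral is the form in which Fubini over \<open>h\<close> is applied
  later.\<close>

lemma translation_L1_bound:
  fixes u v :: "'a::euclidean_space \<Rightarrow> real"
  assumes \<Omega>: "open \<Omega>" and wg: "has_weak_gradient \<Omega> u g"
    and u: "integrable (lebesgue_on \<Omega>) u" and g: "integrable (lebesgue_on \<Omega>) g"
    and v: "v \<in> borel_measurable borel" "integrable lborel v" "AE x in lebesgue. v x = indicator \<Omega> x * u x"
    and U: "open U" "\<And>x s. x \<in> U \<Longrightarrow> 0 \<le> s \<Longrightarrow> s \<le> 1 \<Longrightarrow> x + s *\<^sub>R h \<in> \<Omega>"
  shows "(\<integral>\<^sup>+x. indicator U x * ennreal \<bar>v (x + h) - v x\<bar> \<partial>lborel)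
           \<le> ennreal (norm h * (LINT x|lebesgue_on \<Omega>. norm (g x)))"
proof -
  define F where "F = (\<lambda>x. v (x + h) - v x)"
  note [measurable] = v(1)
  have vh: "integrable lborel (\<lambda>x. v (x + h))" using lborel_integral_translate(2)[OF v(1)] v(2) by simp
  have Fm[measurable]: "F \<in> borel_measurable borel" unfolding F_def by measurable
  have F: "integrable lborel F" unfolding F_def using vh v(2) by simp
  have FU: "integrable lborel (\<lambda>x. indicator U x * F x)"
    using F U(1) integrable_mult_indicator[of U lborel F] by simp
  then have "integrable lebesgue (\<lambda>x. indicator U x * F x)"
    using U(1) by (subst integrable_completion) auto
  then have F_on: "integrable (lebesgue_on U) F" by (simp add: lebesgue_on_integrable_iff[OF U(1)])
  have "(LINT x|lebesgue_on U. \<bar>F x\<bar>) \<le> norm h * (LINT x|lebesgue_on \<Omega>. norm (g x))"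
  proof (rule L1_norm_le_test_functions[OF U(1) F_on])
    fix \<psi> assume \<psi>: "\<psi> \<in> test_functions U" and \<psi>1: "\<And>x. \<bar>\<psi> x\<bar> \<le> 1"
    obtain K where K: "K \<subseteq> U" "\<And>x. x \<notin> K \<Longrightarrow> \<psi> x = 0" using test_functionsE[OF \<psi>] by metis
    have "continuous_on UNIV \<psi>" using test_function_C_k[OF \<psi>, of 0] by simp
    then have \<psi>m[measurable]: "\<psi> \<in> borel_measurable borel" by (rule borel_measurable_continuous_onI)
    have "(LINT x|lebesgue_on U. F x * \<psi> x) = (LINT x|lebesgue. F x * \<psi> x)"
      unfolding lebesgue_on_integral_eq[OF U(1)] using K
      by (intro Bochner_Integration.integral_cong) (auto simp: indicator_def)
    also have "\<dots> = (LINT x|lborel. F x * \<psi> x)" by (rule integral_completion) simp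
    also have "\<dots> = (LINT x|lborel. v (x + h) * \<psi> x - v x * \<psi> x)" by (simp add: F_def left_diff_distrib)
    also have "\<dots> = (LINT x|lborel. v (x + h) * \<psi> x) - (LINT x|lborel. v x * \<psi> x)"
    proof (rule Bochner_Integration.integral_diff)
      have \<psi>m': "\<psi> \<in> borel_measurable lborel" by simp
      show "integrable lborel (\<lambda>x. v (x + h) * \<psi> x)"
        using integrable_scaleR_bounded[OF vh \<psi>m' \<psi>1] by (simp add: mult.commute)
      show "integrable lborel (\<lambda>x. v x * \<psi> x)"
        using integrable_scaleR_bounded[OF v(2) \<psi>m' \<psi>1] by (simp add: mult.commute)
    qed
    also have "(LINT x|lborel. v (x + h) * \<psi> x) = (LINT x|lborel. v x * \<psi> (x - h))"
      using lborel_integral_translate(1)[of "\<lambda>x. v x * \<psi> (x - h)" h] by simp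
    also have "\<dots> - (LINT x|lborel. v x * \<psi> x)
        = (LINT x|lebesgue_on \<Omega>. u x * \<psi> (x - h)) - (LINT x|lebesgue_on \<Omega>. u x * \<psi> x)"
      using representative_integral[OF \<Omega> u v(1,3), of "\<lambda>x. \<psi> (x - h)"]
        representative_integral[OF \<Omega> u v(1,3), of \<psi>] by simp
    also have "\<dots> \<le> norm h * (LINT x|lebesgue_on \<Omega>. norm (g x))"
      using weak_gradient_translation[OF \<Omega> wg u g \<psi> \<psi>1 U(2)] by linarith
    finally show "(LINT x|lebesgue_on U. F x * \<psi> x) \<le> norm h * (LINT x|lebesgue_on \<Omega>. norm (g x))" .
  qed
  moreover have "(\<integral>\<^sup>+x. indicator U x * ennreal \<bar>F x\<bar> \<partial>lborel) = ennreal (LINT x|lebesgue_on U. \<bar>F x\<bar>)"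
  proof -
    have "(\<integral>\<^sup>+x. indicator U x * ennreal \<bar>F x\<bar> \<partial>lborel) = (\<integral>\<^sup>+x. ennreal \<bar>indicator U x * F x\<bar> \<partial>lborel)"
      by (intro nn_integral_cong) (auto simp: indicator_def)
    also have "\<dots> = ennreal (LINT x|lborel. \<bar>indicator U x * F x\<bar>)"
      using FU by (intro nn_integral_eq_integral) auto
    also have "(LINT x|lborel. \<bar>indicator U x * F x\<bar>) = (LINT x|lebesgue. \<bar>indicator U x * F x\<bar>)"
      using U(1) by (intro integral_completion[symmetric]) auto
    also have "\<dots> = (LINT x|lebesgue_on U. \<bar>F x\<bar>)"
      by (simp add: lebesgue_on_integral_eq[OF U(1)] abs_mult)
    finally show ?thesis .
  qed
  ultimately show ?thesis unfolding F_def by (simp add: ennreal_leI)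
qed

text \<open>Written as an average over shifts \<open>h\<close>, so that Fubini reduces estimates to
  the translation bound.\<close>

definition ball_average :: "real \<Rightarrow> ('a::euclidean_space \<Rightarrow> real) \<Rightarrow> 'a \<Rightarrow> real" where
  "ball_average \<delta> v x = (LINT h|lborel. indicator (ball 0 \<delta>) h * v (x + h)) / measure lborel (ball (0::'a) \<delta>)"

lemma ball_average_measurable [measurable]:
  assumes [measurable]: "v \<in> borel_measurable borel"
  shows "ball_average \<delta> v \<in> borel_measurable borel"
proof -
  have [measurable]: "ball 0 \<delta> \<in> sets borel" by simp
  have "(\<lambda>(x, h). indicator (ball 0 \<delta>) h * v (x + h)) \<in> borel_measurable (borel \<Otimes>\<^sub>M borel)" by measurable
  moreover have "sets (borel \<Otimes>\<^sub>M lborel) = sets (borel \<Otimes>\<^sub>M (borel :: 'a measure))"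
    by (intro sets_pair_measure_cong) simp_all
  ultimately have "(\<lambda>(x, h). indicator (ball 0 \<delta>) h * v (x + h)) \<in> borel_measurable (borel \<Otimes>\<^sub>M lborel)"
    by (simp cong: measurable_cong_sets)
  then have "(\<lambda>x. LINT h|lborel. indicator (ball 0 \<delta>) h * v (x + h)) \<in> borel_measurable borel"
    by (rule lborel.borel_measurable_lebesgue_integral)
  then show ?thesis unfolding ball_average_def by (intro borel_measurable_divide) simp_all
qed

text \<open>The deviation from the average is at most the average of
  \<open>\<bar>v (x + h) - v x\<bar>\<close>. After exchanging the integrals each shift contributes
  at most \<open>norm h \<le> \<delta>\<close> times the gradient norm, since segments from the
  inner set to the shifted points stay in \<open>\<Omega>\<close>.\<close>

lemma ball_average_L1_bound:
  fixes u v :: "'a::euclidean_space \<Rightarrow> real"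
  assumes \<Omega>: "open \<Omega>" and wg: "has_weak_gradient \<Omega> u g"
    and u: "integrable (lebesgue_on \<Omega>) u" and g: "integrable (lebesgue_on \<Omega>) g"
    and v: "v \<in> borel_measurable borel" "integrable lborel v" "AE x in lebesgue. v x = indicator \<Omega> x * u x"
    and "0 < \<delta>"
  shows "(\<integral>\<^sup>+x. indicator (inner_set \<Omega> \<delta>) x * ennreal \<bar>v x - ball_average \<delta> v x\<bar> \<partial>lborel)
           \<le> ennreal (\<delta> * (LINT x|lebesgue_on \<Omega>. norm (g x)))"
proof -
  define U where "U = inner_set \<Omega> \<delta>"
  define B where "B = ball (0::'a) \<delta>"
  define V where "V = measure lborel B"
  define A where "A = (LINT x|lebesgue_on \<Omega>. norm (g x))"
  have "0 \<le> A" by (simp add: A_def)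
  have V: "0 < V" unfolding V_def B_def using content_ball_pos[OF \<open>0 < \<delta>\<close>] .
  have U: "open U" by (simp add: U_def open_inner_set)
  have [measurable]: "B \<in> sets borel" "U \<in> sets borel" using U by (auto simp: B_def)
  note [measurable] = v(1)
  have finB: "emeasure lborel B < \<infinity>" unfolding B_def by (intro emeasure_bounded_finite) auto
  have emB: "emeasure lborel B = ennreal V" unfolding V_def using finB by (intro emeasure_eq_ennreal_measure) auto
  have pt: "ennreal \<bar>v x - ball_average \<delta> v x\<bar>
      \<le> ennreal (1 / V) * (\<integral>\<^sup>+h. indicator B h * ennreal \<bar>v (x + h) - v x\<bar> \<partial>lborel)" for x
  proof -
    have i1: "integrable lborel (\<lambda>h. indicator B h * v x)" using finB by simp
    have "integrable lborel (\<lambda>h. v (x + h))"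
      using lborel_integral_translate(2)[OF v(1), of x] v(2) by (simp add: add.commute)
    then have i2: "integrable lborel (\<lambda>h. indicator B h * v (x + h))"
      using integrable_mult_indicator[of B lborel "\<lambda>h. v (x + h)"] by simp
    have "(LINT h|lborel. indicator B h * v x) = V * v x" by (simp add: V_def)
    then have "v x - ball_average \<delta> v x = (1 / V) * ((LINT h|lborel. indicator B h * v x) - (LINT h|lborel. indicator B h * v (x + h)))"
      using V by (simp add: ball_average_def B_def[symmetric] V_def[symmetric] field_simps)
    also have "\<dots> = (1 / V) * (LINT h|lborel. indicator B h * (v x - v (x + h)))"
      using i1 i2 by (simp add: right_diff_distrib)
    finally have "ennreal \<bar>v x - ball_average \<delta> v x\<bar> = ennreal (1 / V) * ennreal \<bar>LINT h|lborel. indicator B h * (v x - v (x + h))\<bar>"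
      using V by (simp add: abs_mult flip: ennreal_mult)
    also have "\<dots> \<le> ennreal (1 / V) * (\<integral>\<^sup>+h. ennreal \<bar>indicator B h * (v x - v (x + h))\<bar> \<partial>lborel)"
      using i1 i2 integral_norm_bound_ennreal[of lborel "\<lambda>h. indicator B h * (v x - v (x + h))"]
      by (intro mult_left_mono) (auto simp: right_diff_distrib)
    also have "(\<integral>\<^sup>+h. ennreal \<bar>indicator B h * (v x - v (x + h))\<bar> \<partial>lborel) = (\<integral>\<^sup>+h. indicator B h * ennreal \<bar>v (x + h) - v x\<bar> \<partial>lborel)"
      by (intro nn_integral_cong) (auto simp: indicator_def abs_minus_commute)
    finally show ?thesis .
  qed
  have "(\<integral>\<^sup>+x. indicator U x * ennreal \<bar>v x - ball_average \<delta> v x\<bar> \<partial>lborel)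
      \<le> (\<integral>\<^sup>+x. indicator U x * (ennreal (1 / V) * (\<integral>\<^sup>+h. indicator B h * ennreal \<bar>v (x + h) - v x\<bar> \<partial>lborel)) \<partial>lborel)"
    by (intro nn_integral_mono mult_left_mono pt) auto
  also have "\<dots> = ennreal (1 / V) * (\<integral>\<^sup>+x. (\<integral>\<^sup>+h. indicator U x * (indicator B h * ennreal \<bar>v (x + h) - v x\<bar>) \<partial>lborel) \<partial>lborel)"
    by (simp add: nn_integral_cmult[symmetric] mult.left_commute)
  also have "(\<integral>\<^sup>+x. (\<integral>\<^sup>+h. indicator U x * (indicator B h * ennreal \<bar>v (x + h) - v x\<bar>) \<partial>lborel) \<partial>lborel)
      = (\<integral>\<^sup>+h. (\<integral>\<^sup>+x. indicator U x * (indicator B h * ennreal \<bar>v (x + h) - v x\<bar>) \<partial>lborel) \<partial>lborel)"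
    by (rule lborel_pair.Fubini') measurable
  also have "\<dots> = (\<integral>\<^sup>+h. indicator B h * (\<integral>\<^sup>+x. indicator U x * ennreal \<bar>v (x + h) - v x\<bar> \<partial>lborel) \<partial>lborel)"
    by (simp add: nn_integral_cmult[symmetric] mult.left_commute)
  also have "\<dots> \<le> (\<integral>\<^sup>+h. ennreal (\<delta> * A) * indicator B h \<partial>lborel)"
  proof (rule nn_integral_mono)
    fix h :: 'a
    show "indicator B h * (\<integral>\<^sup>+x. indicator U x * ennreal \<bar>v (x + h) - v x\<bar> \<partial>lborel) \<le> ennreal (\<delta> * A) * indicator B h"
    proof (cases "h \<in> B")
      case True
      then have h: "norm h \<le> \<delta>" by (simp add: B_def)
      have "x + s *\<^sub>R h \<in> \<Omega>" if "x \<in> U" "0 \<le> s" "s \<le> 1" for x s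
      proof (rule inner_set_translate)
        show "x \<in> inner_set \<Omega> \<delta>" using that by (simp add: U_def)
        have "s * norm h \<le> 1 * norm h" using that by (intro mult_right_mono) auto
        then show "norm (s *\<^sub>R h) \<le> \<delta>" using h that by simp
      qed
      then have "(\<integral>\<^sup>+x. indicator U x * ennreal \<bar>v (x + h) - v x\<bar> \<partial>lborel) \<le> ennreal (norm h * A)"
        unfolding A_def by (rule translation_L1_bound[OF \<Omega> wg u g v U])
      also have "\<dots> \<le> ennreal (\<delta> * A)" using h \<open>0 \<le> A\<close> by (intro ennreal_leI mult_right_mono)
      finally show ?thesis using True by simp
    qed simp
  qed
  also have "\<dots> = ennreal (\<delta> * A) * ennreal V" by (simp add: nn_integral_cmult_indicator emB)
  also have "ennreal (1 / V) * \<dots> = ennreal (\<delta> * A)"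
    using V \<open>0 \<le> A\<close> \<open>0 < \<delta>\<close> by (simp add: ennreal_mult[symmetric] field_simps)
  finally show ?thesis by (simp add: U_def A_def mult_left_mono)
qed

section \<open>Strong convergence in \<open>L\<^sup>1\<close>\<close>

lemma finite_measure_lebesgue_on_bounded:
  "open \<Omega> \<Longrightarrow> bounded \<Omega> \<Longrightarrow> finite_measure (lebesgue_on \<Omega>)"
  by (intro finite_measure_lebesgue_on lmeasurable_open)

text \<open>At a fixed centre the average is a multiple of the inner product with the indicator of a
  ball, an admissible test element. The ball may leave \<open>\<Omega>\<close>, where
  \<open>v n\<close> vanishes almost everywhere.\<close>

lemma ball_average_tendsto_0:
  fixes z v :: "nat \<Rightarrow> 'a::euclidean_space \<Rightarrow> real"
  assumes \<Omega>: "open \<Omega>" "bounded \<Omega>" and z: "\<And>n. z n \<in> Lp_space 2 (lebesgue_on \<Omega>)"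
    and weak: "\<And>h. h \<in> Lp_space 2 (lebesgue_on \<Omega>) \<Longrightarrow> (\<lambda>n. L2_inner (lebesgue_on \<Omega>) (z n) h) \<longlonglongrightarrow> 0"
    and v: "\<And>n. v n \<in> borel_measurable borel" "\<And>n. AE x in lebesgue. v n x = indicator \<Omega> x * z n x"
  shows "(\<lambda>n. ball_average \<delta> (v n) x) \<longlonglongrightarrow> 0"
proof -
  have fin: "finite_measure (lebesgue_on \<Omega>)" by (rule finite_measure_lebesgue_on_bounded[OF \<Omega>])
  note [measurable] = v(1)
  have bm[measurable]: "(indicator (ball x \<delta>) :: 'a \<Rightarrow> real) \<in> borel_measurable borel"
    by (rule borel_measurable_indicator) simp
  have "(indicator (ball x \<delta>) :: 'a \<Rightarrow> real) \<in> borel_measurable lebesgue" by (rule borel_measurable_indicator) simp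
  then have ind: "(indicator (ball x \<delta>) :: 'a \<Rightarrow> real) \<in> Lp_space 2 (lebesgue_on \<Omega>)"
    by (intro Lp_space_2_bounded[OF fin, where B = 1] measurable_restrict_space1) (auto simp: indicator_def)
  have "(LINT h|lborel. indicator (ball 0 \<delta>) h * v n (x + h)) = L2_inner (lebesgue_on \<Omega>) (z n) (indicator (ball x \<delta>))" for n
  proof -
    have "(LINT h|lborel. indicator (ball 0 \<delta>) h * v n (x + h)) = (LINT h|lborel. v n (h + x) * indicator (ball x \<delta>) (h + x))"
      by (intro Bochner_Integration.integral_cong) (auto simp: indicator_def dist_norm add.commute)
    also have "\<dots> = (LINT y|lborel. v n y * indicator (ball x \<delta>) y)"
      by (rule lborel_integral_translate(1)[of "\<lambda>y. v n y * indicator (ball x \<delta>) y"]) measurable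
    also have "\<dots> = (LINT y|lebesgue_on \<Omega>. z n y * indicator (ball x \<delta>) y)"
      by (rule representative_integral[OF \<Omega>(1) Lp_space_2_imp_integrable[OF fin z] v bm])
    finally show ?thesis by (simp add: L2_inner_def)
  qed
  then have "(\<lambda>n. (LINT h|lborel. indicator (ball 0 \<delta>) h * v n (x + h)) / measure lborel (ball (0::'a) \<delta>))
      \<longlonglongrightarrow> 0 / measure lborel (ball (0::'a) \<delta>)"
    unfolding divide_inverse by (intro tendsto_mult_right) (simp add: weak[OF ind])
  then show ?thesis by (simp add: ball_average_def)
qed

text \<open>The bound does not depend on \<open>x\<close>; for fixed \<open>\<delta>\<close> it
  supplies the majorant for dominated convergence of the averages.\<close>

lemma ball_average_bound:
  fixes v :: "'a::euclidean_space \<Rightarrow> real"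
  assumes "v \<in> borel_measurable borel" "integrable lborel v"
  shows "\<bar>ball_average \<delta> v x\<bar> \<le> (LINT y|lborel. \<bar>v y\<bar>) / measure lborel (ball (0::'a) \<delta>)"
proof -
  have i: "integrable lborel (\<lambda>h. v (x + h))"
    using lborel_integral_translate(2)[OF assms(1), of x] assms(2) by (simp add: add.commute)
  then have i2: "integrable lborel (\<lambda>h. indicator (ball 0 \<delta>) h * v (x + h))"
    using integrable_mult_indicator[of "ball 0 \<delta>" lborel "\<lambda>h. v (x + h)"] by simp
  have "\<bar>LINT h|lborel. indicator (ball 0 \<delta>) h * v (x + h)\<bar> \<le> (LINT h|lborel. \<bar>indicator (ball 0 \<delta>) h * v (x + h)\<bar>)"
    by (rule integral_abs_bound)
  also have "\<dots> \<le> (LINT h|lborel. \<bar>v (x + h)\<bar>)"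
    using i i2 by (intro integral_mono) (auto simp: indicator_def)
  also have "\<dots> = (LINT y|lborel. \<bar>v y\<bar>)"
    using lborel_integral_translate(1)[of "\<lambda>y. \<bar>v y\<bar>" x] assms(1) by (simp add: add.commute)
  finally show ?thesis by (simp add: ball_average_def abs_divide divide_right_mono)
qed

text \<open>On the inner set \<open>z n\<close> splits into its deviation from the ball average, at
  most \<open>\<delta> * A\<close> in \<open>L\<^sup>1\<close> for every \<open>n\<close>, and the
  average, which tends to \<open>0\<close> pointwise and boundedly once \<open>\<delta>\<close> is
  fixed.\<close>

lemma inner_L1_eventually_le:
  fixes z :: "nat \<Rightarrow> 'a::euclidean_space \<Rightarrow> real"
  assumes \<Omega>: "open \<Omega>" "bounded \<Omega>" and z: "\<And>n. z n \<in> Lp_space 2 (lebesgue_on \<Omega>)"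
    and wg: "\<And>n. has_weak_gradient \<Omega> (z n) (\<gamma> n)" "\<And>n. integrable (lebesgue_on \<Omega>) (\<gamma> n)"
      "\<And>n. (LINT x|lebesgue_on \<Omega>. norm (\<gamma> n x)) \<le> A"
    and B: "\<And>n. L2_inner (lebesgue_on \<Omega>) (z n) (z n) \<le> B"
    and weak: "\<And>h. h \<in> Lp_space 2 (lebesgue_on \<Omega>) \<Longrightarrow> (\<lambda>n. L2_inner (lebesgue_on \<Omega>) (z n) h) \<longlonglongrightarrow> 0"
    and "0 < \<delta>" "0 < \<epsilon>"
  shows "\<forall>\<^sub>F n in sequentially. (LINT x|lebesgue_on \<Omega>. indicator (inner_set \<Omega> \<delta>) x * \<bar>z n x\<bar>) \<le> \<delta> * A + \<epsilon>"
proof -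
  have fin: "finite_measure (lebesgue_on \<Omega>)" by (rule finite_measure_lebesgue_on_bounded[OF \<Omega>])
  have z1: "integrable (lebesgue_on \<Omega>) (z n)" for n by (rule Lp_space_2_imp_integrable[OF fin z])
  define U where "U = inner_set \<Omega> \<delta>"
  define V where "V = measure lborel (ball (0::'a) \<delta>)"
  have V: "0 < V" unfolding V_def using content_ball_pos[OF \<open>0 < \<delta>\<close>] .
  have U: "open U" "U \<subseteq> \<Omega>" unfolding U_def using \<open>0 < \<delta>\<close> by (auto simp: open_inner_set intro!: inner_set_subset)
  have [measurable]: "U \<in> sets borel" using U by simp
  have "\<forall>n. \<exists>v. v \<in> borel_measurable borel \<and> integrable lborel v \<and> (AE x in lebesgue. v x = indicator \<Omega> x * z n x)"
    using borel_representative[OF \<Omega>(1) z1] by metis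
  then obtain v where v[measurable]: "\<And>n. v n \<in> borel_measurable borel" and v1: "\<And>n. integrable lborel (v n)"
    and vz: "\<And>n. AE x in lebesgue. v n x = indicator \<Omega> x * z n x" by metis
  define M where "M = sqrt (measure (lebesgue_on \<Omega>) (space (lebesgue_on \<Omega>))) * sqrt B"
  have abs_rep: "(LINT x|lborel. \<bar>v n x\<bar> * \<psi> x) = (LINT x|lebesgue_on \<Omega>. \<bar>z n x\<bar> * \<psi> x)"
    if "\<psi> \<in> borel_measurable borel" for n \<psi>
  proof (rule representative_integral[OF \<Omega>(1) _ _ _ that])
    show "AE x in lebesgue. \<bar>v n x\<bar> = indicator \<Omega> x * \<bar>z n x\<bar>"
      using vz[of n] by eventually_elim (simp add: abs_mult)
  qed (use z1 in auto)
  have vM: "(LINT x|lborel. \<bar>v n x\<bar>) \<le> M" for n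
  proof -
    have "(LINT x|lborel. \<bar>v n x\<bar>) = (LINT x|lebesgue_on \<Omega>. norm (z n x))"
      using abs_rep[of "\<lambda>x. 1" n] by simp
    also have "\<dots> \<le> sqrt (measure (lebesgue_on \<Omega>) (space (lebesgue_on \<Omega>))) * sqrt (L2_inner (lebesgue_on \<Omega>) (z n) (z n))"
      by (rule L1_norm_le_L2_norm[OF fin z])
    also have "\<dots> \<le> M" unfolding M_def using B by (intro mult_left_mono real_sqrt_le_mono) auto
    finally show ?thesis .
  qed
  have a_le: "\<bar>ball_average \<delta> (v n) x\<bar> \<le> M / V" for n x
    using ball_average_bound[OF v[of n] v1[of n], of \<delta> x] vM[of n] V unfolding V_def
    by (meson divide_right_mono less_imp_le order_trans)
  have "0 \<le> M / V" using a_le[of undefined undefined] by linarith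
  have Ufin: "emeasure lborel U < \<infinity>"
    using bounded_subset[OF \<Omega>(2) U(2)] by (rule emeasure_bounded_finite)
  have "(\<lambda>n. \<integral>\<^sup>+x. indicator U x * ennreal \<bar>ball_average \<delta> (v n) x\<bar> \<partial>lborel) \<longlonglongrightarrow> (\<integral>\<^sup>+x. 0 \<partial>(lborel :: 'a measure))"
  proof (rule nn_integral_dominated_convergence[where w = "\<lambda>x. ennreal (M / V) * indicator U x"])
    show "(\<integral>\<^sup>+x. ennreal (M / V) * indicator U x \<partial>lborel) < \<infinity>"
      using Ufin by (simp add: nn_integral_cmult_indicator ennreal_mult_less_top)
    show "AE x in lborel. indicator U x * ennreal \<bar>ball_average \<delta> (v n) x\<bar> \<le> ennreal (M / V) * indicator U x" for n
      using a_le by (intro AE_I2) (auto simp: indicator_def ennreal_leI)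
    show "AE x in lborel. (\<lambda>n. indicator U x * ennreal \<bar>ball_average \<delta> (v n) x\<bar>) \<longlonglongrightarrow> 0"
    proof (intro AE_I2)
      fix x
      have "(\<lambda>n. ennreal \<bar>ball_average \<delta> (v n) x\<bar>) \<longlonglongrightarrow> ennreal \<bar>0\<bar>"
        by (intro tendsto_ennrealI tendsto_rabs ball_average_tendsto_0[OF \<Omega> z weak v vz])
      then show "(\<lambda>n. indicator U x * ennreal \<bar>ball_average \<delta> (v n) x\<bar>) \<longlonglongrightarrow> 0"
        by (cases "x \<in> U") auto
    qed
  qed measurable
  then have "(\<lambda>n. \<integral>\<^sup>+x. indicator U x * ennreal \<bar>ball_average \<delta> (v n) x\<bar> \<partial>lborel) \<longlonglongrightarrow> 0" by simp
  then have "\<forall>\<^sub>F n in sequentially. (\<integral>\<^sup>+x. indicator U x * ennreal \<bar>ball_average \<delta> (v n) x\<bar> \<partial>lborel) < ennreal \<epsilon>"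
    using \<open>0 < \<epsilon>\<close> by (intro order_tendstoD) auto
  then show ?thesis
  proof eventually_elim
    case (elim n)
    have "0 \<le> A" using wg(3)[of n] by (rule order_trans[rotated]) simp
    have iU: "integrable lborel (\<lambda>x. \<bar>v n x\<bar> * indicator U x)"
      using integrable_mult_indicator[of U lborel "\<lambda>x. \<bar>v n x\<bar>"] v1[of n] by (simp add: mult.commute)
    have "ennreal (LINT x|lborel. \<bar>v n x\<bar> * indicator U x) = (\<integral>\<^sup>+x. ennreal (\<bar>v n x\<bar> * indicator U x) \<partial>lborel)"
      using iU by (intro nn_integral_eq_integral[symmetric]) auto
    also have "\<dots> \<le> (\<integral>\<^sup>+x. indicator U x * ennreal \<bar>v n x - ball_average \<delta> (v n) x\<bar>
        + indicator U x * ennreal \<bar>ball_average \<delta> (v n) x\<bar> \<partial>lborel)"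
      by (intro nn_integral_mono) (auto simp: indicator_def ennreal_plus[symmetric] simp del: ennreal_plus intro!: ennreal_leI)
    also have "\<dots> = (\<integral>\<^sup>+x. indicator U x * ennreal \<bar>v n x - ball_average \<delta> (v n) x\<bar> \<partial>lborel)
        + (\<integral>\<^sup>+x. indicator U x * ennreal \<bar>ball_average \<delta> (v n) x\<bar> \<partial>lborel)"
      by (rule nn_integral_add) measurable
    also have "\<dots> \<le> ennreal (\<delta> * A) + ennreal \<epsilon>"
    proof (intro add_mono)
      have "(\<integral>\<^sup>+x. indicator U x * ennreal \<bar>v n x - ball_average \<delta> (v n) x\<bar> \<partial>lborel)
          \<le> ennreal (\<delta> * (LINT x|lebesgue_on \<Omega>. norm (\<gamma> n x)))"
        unfolding U_def by (rule ball_average_L1_bound[OF \<Omega>(1) wg(1) z1 wg(2) v v1 vz \<open>0 < \<delta>\<close>])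
      also have "\<dots> \<le> ennreal (\<delta> * A)" using wg(3) \<open>0 < \<delta>\<close> by (intro ennreal_leI mult_left_mono) auto
      finally show "(\<integral>\<^sup>+x. indicator U x * ennreal \<bar>v n x - ball_average \<delta> (v n) x\<bar> \<partial>lborel) \<le> ennreal (\<delta> * A)" .
    qed (use elim in auto)
    also have "\<dots> = ennreal (\<delta> * A + \<epsilon>)" using \<open>0 \<le> A\<close> \<open>0 < \<delta>\<close> \<open>0 < \<epsilon>\<close> by simp
    finally have "(LINT x|lborel. \<bar>v n x\<bar> * indicator U x) \<le> \<delta> * A + \<epsilon>"
      using \<open>0 \<le> A\<close> \<open>0 < \<delta>\<close> \<open>0 < \<epsilon>\<close> by (subst (asm) ennreal_le_iff) auto
    also have "(LINT x|lborel. \<bar>v n x\<bar> * indicator U x) = (LINT x|lebesgue_on \<Omega>. \<bar>z n x\<bar> * indicator U x)"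
      by (intro abs_rep borel_measurable_indicator) measurable
    finally show ?case by (simp add: U_def mult.commute)
  qed
qed

text \<open>
  Near the boundary the \<open>L\<^sup>2\<close> bound makes the \<open>L\<^sup>1\<close> norms uniformly small.
\<close>

lemma strong_L1_convergence:
  fixes z :: "nat \<Rightarrow> 'a::euclidean_space \<Rightarrow> real"
  assumes \<Omega>: "open \<Omega>" "bounded \<Omega>" and z: "\<And>n. z n \<in> Lp_space 2 (lebesgue_on \<Omega>)"
    and wg: "\<And>n. has_weak_gradient \<Omega> (z n) (\<gamma> n)" "\<And>n. integrable (lebesgue_on \<Omega>) (\<gamma> n)"
      "\<And>n. (LINT x|lebesgue_on \<Omega>. norm (\<gamma> n x)) \<le> A"
    and B: "\<And>n. L2_inner (lebesgue_on \<Omega>) (z n) (z n) \<le> B"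
    and weak: "\<And>h. h \<in> Lp_space 2 (lebesgue_on \<Omega>) \<Longrightarrow> (\<lambda>n. L2_inner (lebesgue_on \<Omega>) (z n) h) \<longlonglongrightarrow> 0"
  shows "(\<lambda>n. LINT x|lebesgue_on \<Omega>. \<bar>z n x\<bar>) \<longlonglongrightarrow> 0"
proof -
  let ?M = "lebesgue_on \<Omega>"
  have fin: "finite_measure ?M" by (rule finite_measure_lebesgue_on_bounded[OF \<Omega>])
  have z1: "integrable ?M (z n)" for n by (rule Lp_space_2_imp_integrable[OF fin z])
  define U where "U j = inner_set \<Omega> (1 / real (Suc j))" for j
  define c where "c j x = 1 - (indicator (U j) x :: real)" for j x
  have cm[measurable]: "c j \<in> borel_measurable ?M" for j
  proof -
    have "U j \<in> sets lebesgue" by (simp add: U_def open_inner_set)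
    then have "(indicator (U j) :: 'a \<Rightarrow> real) \<in> borel_measurable lebesgue" by (rule borel_measurable_indicator)
    then have [measurable]: "(indicator (U j) :: 'a \<Rightarrow> real) \<in> borel_measurable ?M" by (rule measurable_restrict_space1)
    show ?thesis unfolding c_def by measurable
  qed
  have c01: "0 \<le> c j x" "c j x \<le> 1" "c j x * c j x = c j x" for j x by (auto simp: c_def indicator_def)
  have c2: "c j \<in> Lp_space 2 ?M" for j by (rule Lp_space_2_bounded[OF fin cm, of _ 1]) (use c01 in auto)
  \<comment> \<open>Since \<open>c j\<close> is an indicator function, \<open>q j\<close> is the
    measure of the part of \<open>\<Omega>\<close> outside \<open>U j\<close>; it tends to
    \<open>0\<close> because the inner sets exhaust \<open>\<Omega>\<close>.\<close>
  define q where "q j = L2_inner ?M (c j) (c j)" for j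
  have "q \<longlonglongrightarrow> (LINT x|?M. 0)"
    unfolding q_def L2_inner_def
  proof (rule integral_dominated_convergence[where w = "\<lambda>x. 1"])
    show "integrable ?M (\<lambda>x. 1 :: real)" using fin by (simp add: finite_measure.integrable_const)
    show "AE x in ?M. (\<lambda>j. c j x \<bullet> c j x) \<longlonglongrightarrow> 0"
    proof (intro AE_I2)
      fix x assume "x \<in> space ?M"
      then have "x \<in> \<Omega>" by simp
      then have "\<forall>\<^sub>F j in sequentially. x \<in> U j" unfolding U_def by (rule eventually_mem_inner_set[OF \<Omega>])
      then show "(\<lambda>j. c j x \<bullet> c j x) \<longlonglongrightarrow> 0"
        by (intro tendsto_eventually) (auto elim!: eventually_mono simp: c_def)
    qed
  qed (auto simp: c01)
  then have q: "q \<longlonglongrightarrow> 0" by simp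
  have A: "0 \<le> A" using wg(3)[of 0] by (rule order_trans[rotated]) simp
  show ?thesis
  proof (rule LIMSEQ_I)
    fix \<epsilon> :: real assume "0 < \<epsilon>"
    \<comment> \<open>The index \<open>j\<close> is fixed first and makes the translation error and
      the boundary part small for all \<open>n\<close>. The other half of \<open>\<epsilon>\<close>
      is left for the averages, which need large \<open>n\<close>.\<close>
    have "(\<lambda>j. 1 / real (Suc j) * A + sqrt (q j) * sqrt B) \<longlonglongrightarrow> 0 * A + sqrt 0 * sqrt B"
      by (intro tendsto_add tendsto_mult_right tendsto_real_sqrt q LIMSEQ_inverse_real_of_nat[unfolded inverse_eq_divide])
    then have "\<forall>\<^sub>F j in sequentially. 1 / real (Suc j) * A + sqrt (q j) * sqrt B < \<epsilon> / 2"
      using \<open>0 < \<epsilon>\<close> by (intro order_tendstoD) auto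
    then obtain j where j: "1 / real (Suc j) * A + sqrt (q j) * sqrt B < \<epsilon> / 2"
      by (auto simp: eventually_sequentially)
    have "\<forall>\<^sub>F n in sequentially. (LINT x|?M. indicator (U j) x * \<bar>z n x\<bar>) \<le> 1 / real (Suc j) * A + \<epsilon> / 2"
      unfolding U_def using \<open>0 < \<epsilon>\<close> by (intro inner_L1_eventually_le[OF \<Omega> z wg B weak]) auto
    then have "\<forall>\<^sub>F n in sequentially. (LINT x|?M. \<bar>z n x\<bar>) < \<epsilon>"
    proof eventually_elim
      case (elim n)
      have i1: "integrable ?M (\<lambda>x. c j x * \<bar>z n x\<bar>)"
        using integrable_scaleR_bounded[OF integrable_abs[OF z1[of n]] cm, of j 1] c01 by simp
      have "(LINT x|?M. \<bar>z n x\<bar>) = (LINT x|?M. \<bar>z n x\<bar> - c j x * \<bar>z n x\<bar>) + (LINT x|?M. c j x * \<bar>z n x\<bar>)"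
        using i1 z1[of n] by simp
      also have "(LINT x|?M. \<bar>z n x\<bar> - c j x * \<bar>z n x\<bar>) = (LINT x|?M. indicator (U j) x * \<bar>z n x\<bar>)"
        by (simp add: c_def left_diff_distrib)
      also have "(LINT x|?M. c j x * \<bar>z n x\<bar>) = L2_inner ?M (c j) (\<lambda>x. norm (z n x))"
        by (simp add: L2_inner_def)
      also have "\<dots> \<le> sqrt (q j) * sqrt (L2_inner ?M (\<lambda>x. norm (z n x)) (\<lambda>x. norm (z n x)))"
        using L2_Cauchy_Schwarz[OF c2[of j] Lp_space_2_norm[OF z[of n]]] by (simp add: q_def)
      also have "L2_inner ?M (\<lambda>x. norm (z n x)) (\<lambda>x. norm (z n x)) = L2_inner ?M (z n) (z n)"
        by (simp add: L2_inner_def)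
      also have "sqrt (q j) * sqrt (L2_inner ?M (z n) (z n)) \<le> sqrt (q j) * sqrt B"
        using B by (intro mult_left_mono real_sqrt_le_mono) (auto simp: q_def L2_inner_nonneg)
      finally show ?case using elim j by linarith
    qed
    then show "\<exists>N. \<forall>n\<ge>N. norm ((LINT x|?M. \<bar>z n x\<bar>) - 0) < \<epsilon>"
      by (simp add: eventually_sequentially)
  qed
qed

section \<open>Compactness of sublevel sets of the energy\<close>

lemma integrable_imp_locally_integrable:
  fixes g :: "'a::euclidean_space \<Rightarrow> 'b::euclidean_space"
  assumes "open \<Omega>" "integrable (lebesgue_on \<Omega>) g"
  shows "locally_integrable \<Omega> g"
  unfolding locally_integrable_def
proof (intro allI impI)
  fix K assume K: "compact K \<and> K \<subseteq> \<Omega>"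
  have "set_integrable lebesgue \<Omega> g" using assms by (simp add: lebesgue_on_integrable_iff set_integrable_def)
  moreover have "K \<in> sets lebesgue" using K by (auto dest: borel_compact)
  moreover have "K \<subseteq> \<Omega>" using K by simp
  ultimately show "set_integrable lebesgue K g" by (rule set_integrable_subset)
qed

text \<open>The choice in \<open>weak_gradient\<close> guarantees nothing beyond being some weak
  gradient; uniqueness ties it to the integrable \<open>g\<close>.\<close>

lemma integrable_weak_gradient:
  assumes "open \<Omega>" "bounded \<Omega>" "has_weak_gradient \<Omega> u g" "integrable (lebesgue_on \<Omega>) g"
  shows "has_weak_gradient \<Omega> u (weak_gradient \<Omega> u)" "integrable (lebesgue_on \<Omega>) (weak_gradient \<Omega> u)"
    "AE x in lebesgue_on \<Omega>. g x = weak_gradient \<Omega> u x"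
proof -
  show w: "has_weak_gradient \<Omega> u (weak_gradient \<Omega> u)"
    unfolding weak_gradient_def using assms(3) by (rule someI[where P = "has_weak_gradient \<Omega> u"])
  show ae: "AE x in lebesgue_on \<Omega>. g x = weak_gradient \<Omega> u x"
    by (rule has_weak_gradient_unique[OF assms(1,2,3) w])
  then have ae': "AE x in lebesgue. indicator \<Omega> x *\<^sub>R g x = indicator \<Omega> x *\<^sub>R weak_gradient \<Omega> u x"
    using assms(1) by (subst (asm) AE_restrict_space_iff) (auto elim!: eventually_mono simp: indicator_def)
  have i: "integrable lebesgue (\<lambda>x. indicator \<Omega> x *\<^sub>R g x)"
    using assms by (simp add: lebesgue_on_integrable_iff)
  \<comment> \<open>Measurability passes through almost everywhere equality because
    \<open>lebesgue\<close> is complete.\<close>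
  then have m: "(\<lambda>x. indicator \<Omega> x *\<^sub>R weak_gradient \<Omega> u x) \<in> borel_measurable lebesgue"
    using borel_measurable_AE[OF _ ae'] by auto
  show "integrable (lebesgue_on \<Omega>) (weak_gradient \<Omega> u)"
    unfolding lebesgue_on_integrable_iff[OF assms(1)] by (rule integrable_cong_AE_imp[OF i m]) (use ae' in \<open>auto elim: eventually_mono\<close>)
qed

text \<open>The gradient side of the weak gradient identity has this form, so weak
  \<open>L\<^sup>1\<close> convergence passes it to the limit.\<close>

lemma integral_test_mem_Lp_dual_1:
  fixes \<psi> :: "'a \<Rightarrow> real" and b :: "'b::euclidean_space"
  assumes "\<psi> \<in> borel_measurable M" "\<And>x. \<bar>\<psi> x\<bar> \<le> K"
  shows "(\<lambda>v. LINT x|M. (v x \<bullet> b) * \<psi> x) \<in> Lp_dual 1 M"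
proof -
  have i: "integrable M (\<lambda>x. (v x \<bullet> b) * \<psi> x)" if "integrable M v" for v :: "'a \<Rightarrow> 'b"
    using integrable_scaleR_bounded[OF integrable_inner_left[OF that, of b] assms] by (simp add: mult.commute)
  have "\<bar>LINT x|M. (v x \<bullet> b) * \<psi> x\<bar> \<le> (norm b * K) * (LINT x|M. norm (v x))" if v: "integrable M v" for v :: "'a \<Rightarrow> 'b"
  proof -
    have "\<bar>LINT x|M. (v x \<bullet> b) * \<psi> x\<bar> \<le> (LINT x|M. \<bar>(v x \<bullet> b) * \<psi> x\<bar>)" by (rule integral_abs_bound)
    also have "\<dots> \<le> (LINT x|M. (norm b * K) * norm (v x))"
    proof (rule integral_mono)
      fix x
      have "\<bar>v x \<bullet> b\<bar> * \<bar>\<psi> x\<bar> \<le> (norm (v x) * norm b) * K"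
        using assms(2) by (intro mult_mono Cauchy_Schwarz_ineq2) auto
      then show "\<bar>(v x \<bullet> b) * \<psi> x\<bar> \<le> (norm b * K) * norm (v x)" by (simp add: abs_mult mult_ac)
    qed (use v i[OF v] in auto)
    finally show ?thesis by simp
  qed
  then have "\<forall>v\<in>Lp_space 1 M. \<bar>LINT x|M. (v x \<bullet> b) * \<psi> x\<bar> \<le> (norm b * K) * Lp_norm 1 M v"
    by (simp add: Lp_space_1_iff Lp_norm_1)
  moreover have "(LINT x|M. ((v x + w x) \<bullet> b) * \<psi> x) = (LINT x|M. (v x \<bullet> b) * \<psi> x) + (LINT x|M. (w x \<bullet> b) * \<psi> x)"
    if "v \<in> Lp_space 1 M" "w \<in> Lp_space 1 M" for v w :: "'a \<Rightarrow> 'b"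
    using that i by (simp add: Lp_space_1_iff inner_simps distrib_right)
  moreover have "(LINT x|M. ((c *\<^sub>R v x) \<bullet> b) * \<psi> x) = c * (LINT x|M. (v x \<bullet> b) * \<psi> x)" for c and v :: "'a \<Rightarrow> 'b"
    by (simp add: mult.assoc)
  ultimately show ?thesis unfolding Lp_dual_def by blast
qed

text \<open>For a fixed test function both sides of the defining identity are bounded functionals:
  pairing with a derivative of \<open>\<psi>\<close> on \<open>L\<^sup>2\<close> for the functions,
  pairing with \<open>\<psi>\<close> on \<open>L\<^sup>1\<close> for the gradients.\<close>

lemma has_weak_gradient_weak_limit:
  fixes u :: "nat \<Rightarrow> 'a::euclidean_space \<Rightarrow> real"
  assumes \<Omega>: "open \<Omega>" "bounded \<Omega>"
    and wg: "\<And>n. has_weak_gradient \<Omega> (u n) (G n)"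
    and w: "w \<in> Lp_space 2 (lebesgue_on \<Omega>)" and g: "integrable (lebesgue_on \<Omega>) g"
    and ulim: "\<And>\<Lambda>. \<Lambda> \<in> Lp_dual 2 (lebesgue_on \<Omega>) \<Longrightarrow> (\<lambda>n. \<Lambda> (u n)) \<longlonglongrightarrow> \<Lambda> w"
    and Glim: "\<And>\<Lambda>. \<Lambda> \<in> Lp_dual 1 (lebesgue_on \<Omega>) \<Longrightarrow> (\<lambda>n. \<Lambda> (G n)) \<longlonglongrightarrow> \<Lambda> g"
  shows "has_weak_gradient \<Omega> w g"
  unfolding has_weak_gradient_def
proof (intro conjI ballI)
  have fin: "finite_measure (lebesgue_on \<Omega>)" by (rule finite_measure_lebesgue_on_bounded[OF \<Omega>])
  show "locally_integrable \<Omega> w" "locally_integrable \<Omega> g"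
    using Lp_space_2_imp_integrable[OF fin w] g by (auto intro: integrable_imp_locally_integrable[OF \<Omega>(1)])
  fix \<psi> and b :: 'a assume \<psi>: "\<psi> \<in> test_functions \<Omega>" and b: "b \<in> Basis"
  let ?D = "\<lambda>x. frechet_derivative \<psi> (at x) b"
  obtain K where K: "compact K" "\<And>x. x \<notin> K \<Longrightarrow> \<psi> x = 0" "\<And>x. x \<notin> K \<Longrightarrow> frechet_derivative \<psi> (at x) = (\<lambda>h. 0)"
    using test_functionsE[OF \<psi>] by metis
  have cont: "continuous_on UNIV \<psi>" using test_function_C_k[OF \<psi>, of 0] by simp
  have contD: "continuous_on UNIV ?D" using C_k_SucD(2)[OF test_function_C_k[OF \<psi>, of "Suc 0"] b] by simp
  obtain B where B: "\<And>x. \<bar>\<psi> x\<bar> \<le> B" using compact_support_bounded[OF cont K(1,2)] by blast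
  have "?D x = 0" if "x \<notin> K" for x using K(3)[OF that] by simp
  then obtain B' where B': "\<And>x. \<bar>?D x\<bar> \<le> B'" using compact_support_bounded[OF contD K(1)] by blast
  have "?D \<in> Lp_space 2 (lebesgue_on \<Omega>)"
    by (rule Lp_space_2_bounded[OF fin continuous_lebesgue_measurable(2)[OF contD], where B = B']) (simp add: B')
  from ulim[OF L2_inner_mem_Lp_dual[OF this]]
  have "(\<lambda>n. LINT x|lebesgue_on \<Omega>. u n x * ?D x) \<longlonglongrightarrow> (LINT x|lebesgue_on \<Omega>. w x * ?D x)"
    by (simp add: L2_inner_def)
  moreover have "(\<lambda>n. - (LINT x|lebesgue_on \<Omega>. (G n x \<bullet> b) * \<psi> x)) \<longlonglongrightarrow> - (LINT x|lebesgue_on \<Omega>. (g x \<bullet> b) * \<psi> x)"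
    by (intro tendsto_minus Glim[OF integral_test_mem_Lp_dual_1[OF continuous_lebesgue_measurable(2)[OF cont] B]])
  moreover have "(LINT x|lebesgue_on \<Omega>. u n x * ?D x) = - (LINT x|lebesgue_on \<Omega>. (G n x \<bullet> b) * \<psi> x)" for n
    using wg[of n] \<psi> b unfolding has_weak_gradient_def by blast
  ultimately show "(LINT x|lebesgue_on \<Omega>. w x * ?D x) = - (LINT x|lebesgue_on \<Omega>. (g x \<bullet> b) * \<psi> x)"
    using LIMSEQ_unique by (simp only:)
qed

lemma has_weak_gradient_diff:
  assumes \<Omega>: "open \<Omega>" and "has_weak_gradient \<Omega> u g" "has_weak_gradient \<Omega> w h"
    and i: "integrable (lebesgue_on \<Omega>) u" "integrable (lebesgue_on \<Omega>) g"
      "integrable (lebesgue_on \<Omega>) w" "integrable (lebesgue_on \<Omega>) h"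
  shows "has_weak_gradient \<Omega> (\<lambda>x. u x - w x) (\<lambda>x. g x - h x)"
  unfolding has_weak_gradient_def
proof (intro conjI ballI)
  show "locally_integrable \<Omega> (\<lambda>x. u x - w x)" "locally_integrable \<Omega> (\<lambda>x. g x - h x)"
    using i by (auto intro!: integrable_imp_locally_integrable[OF \<Omega>])
  fix \<psi> and b :: 'a assume \<psi>: "\<psi> \<in> test_functions \<Omega>" and b: "b \<in> Basis"
  let ?D = "\<lambda>x. frechet_derivative \<psi> (at x) b"
  obtain K where K: "compact K" "\<And>x. x \<notin> K \<Longrightarrow> \<psi> x = 0" "\<And>x. x \<notin> K \<Longrightarrow> frechet_derivative \<psi> (at x) = (\<lambda>h. 0)"
    using test_functionsE[OF \<psi>] by metis
  have cont: "continuous_on UNIV \<psi>" using test_function_C_k[OF \<psi>, of 0] by simp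
  have contD: "continuous_on UNIV ?D" using C_k_SucD(2)[OF test_function_C_k[OF \<psi>, of "Suc 0"] b] by simp
  obtain B where B: "\<And>x. \<bar>\<psi> x\<bar> \<le> B" using compact_support_bounded[OF cont K(1,2)] by blast
  have "?D x = 0" if "x \<notin> K" for x using K(3)[OF that] by simp
  then obtain B' where B': "\<And>x. \<bar>?D x\<bar> \<le> B'" using compact_support_bounded[OF contD K(1)] by blast
  have "integrable (lebesgue_on \<Omega>) (\<lambda>x. v x * ?D x)" if "integrable (lebesgue_on \<Omega>) v" for v
    using integrable_scaleR_bounded[OF that continuous_lebesgue_measurable(2)[OF contD] B'] by (simp add: mult.commute)
  moreover have "integrable (lebesgue_on \<Omega>) (\<lambda>x. (v x \<bullet> b) * \<psi> x)" if "integrable (lebesgue_on \<Omega>) v" for v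
    using integrable_scaleR_bounded[OF integrable_inner_left[OF that, of b] continuous_lebesgue_measurable(2)[OF cont] B]
    by (simp add: mult.commute)
  moreover have "(LINT x|lebesgue_on \<Omega>. u x * ?D x) = - (LINT x|lebesgue_on \<Omega>. (g x \<bullet> b) * \<psi> x)"
    "(LINT x|lebesgue_on \<Omega>. w x * ?D x) = - (LINT x|lebesgue_on \<Omega>. (h x \<bullet> b) * \<psi> x)"
    using assms(2,3) \<psi> b unfolding has_weak_gradient_def by blast+
  ultimately show "(LINT x|lebesgue_on \<Omega>. (u x - w x) * ?D x) = - (LINT x|lebesgue_on \<Omega>. ((g x - h x) \<bullet> b) * \<psi> x)"
    using i by (simp add: inner_simps left_diff_distrib)
qed

text \<open>By convexity and \<open>\<phi> x 0 = 0\<close>, a bound \<open>m * t \<le> \<phi> x t\<close> at one \<open>t > 0\<close> persists for larger \<open>t\<close>.\<close>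

lemma admissible_integrand_superlinear:
  assumes "admissible_integrand \<Omega> \<phi>"
  shows "\<exists>k>0. AE x in lebesgue_on \<Omega>. \<forall>t\<ge>k. m * t \<le> \<phi> x t"
proof -
  have "((\<lambda>t. ess_inf (lebesgue_on \<Omega>) (\<lambda>x. \<phi> x t / t)) \<longlongrightarrow> \<infinity>) at_top"
    and conv: "AE x in lebesgue_on \<Omega>. convex_on {0..} (\<phi> x) \<and> \<phi> x 0 = 0"
    using assms unfolding admissible_integrand_def by (auto elim: eventually_mono)
  then have "\<forall>\<^sub>F t in at_top. ereal m < ess_inf (lebesgue_on \<Omega>) (\<lambda>x. \<phi> x t / t)"
    by (intro order_tendstoD(1)) auto
  then have "\<forall>\<^sub>F t in at_top. ereal m < ess_inf (lebesgue_on \<Omega>) (\<lambda>x. \<phi> x t / t) \<and> 0 < t"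
    using eventually_gt_at_top[of 0] by eventually_elim simp
  then obtain k where k: "ereal m < ess_inf (lebesgue_on \<Omega>) (\<lambda>x. \<phi> x k / k)" "0 < (k::real)"
    using eventually_happens'[OF trivial_limit_at_top_linorder] by blast
  \<comment> \<open>Being strictly below a supremum of essential lower bounds yields an actual lower
    bound \<open>c\<close>, valid almost everywhere.\<close>
  then obtain c where c: "AE x in lebesgue_on \<Omega>. c \<le> ereal (\<phi> x k / k)" "ereal m < c"
    unfolding ess_inf_def less_Sup_iff by auto
  \<comment> \<open>The essential infimum has its own exceptional null set for each
    \<open>t\<close>. Evaluating it at the single point \<open>k\<close> and using convexity gives
    one null set for all \<open>t \<ge> k\<close>.\<close>
  have "AE x in lebesgue_on \<Omega>. \<forall>t\<ge>k. m * t \<le> \<phi> x t"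
    using c(1) conv
  proof eventually_elim
    case (elim x)
    show ?case
    proof (intro allI impI)
      fix t assume t: "k \<le> t"
      have "ereal m \<le> ereal (\<phi> x k / k)" using c(2) elim by (meson less_imp_le order_trans)
      then have mk: "m * k \<le> \<phi> x k" using k(2) by (simp add: field_simps)
      \<comment> \<open>The point \<open>k\<close> is the convex combination of \<open>0\<close> and
        \<open>t\<close> with weight \<open>k / t\<close> on \<open>t\<close>.\<close>
      have "\<phi> x ((1 - k / t) *\<^sub>R 0 + (k / t) *\<^sub>R t) \<le> (1 - k / t) * \<phi> x 0 + (k / t) * \<phi> x t"
        using elim k t by (intro convex_onD[of "{0..}"]) auto
      then have "\<phi> x k \<le> k / t * \<phi> x t" using elim k t by simp
      with mk have "m * k \<le> k / t * \<phi> x t" by linarith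
      then have "k * (m * t) \<le> k * \<phi> x t" using k t by (simp add: field_simps)
      then show "m * t \<le> \<phi> x t" using k by simp
    qed
  qed
  then show ?thesis using k(2) by blast
qed

text \<open>The argument of de la Vallee Poussin: beyond a threshold depending only on
  \<open>m\<close>, the norm is at most \<open>\<phi>\<close> divided by \<open>m\<close>, so every
  tail integral is at most \<open>C / m\<close>.\<close>

lemma rho_bounded_uniformly_integrable:
  fixes G :: "'i \<Rightarrow> 'a::euclidean_space \<Rightarrow> 'a"
  assumes adm: "admissible_integrand \<Omega> \<phi>" and G: "\<And>n. integrable (lebesgue_on \<Omega>) (G n)"
    and C: "\<And>n. rho \<Omega> \<phi> (G n) \<le> ennreal C" "0 \<le> C" and "0 < \<epsilon>"
  shows "\<exists>k::real. \<forall>n. (LINT x|lebesgue_on \<Omega>. (if norm (G n x) \<le> k then 0 else norm (G n x))) \<le> \<epsilon>"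
proof -
  \<comment> \<open>Chosen so that \<open>C \<le> m * \<epsilon>\<close>; the summand
    \<open>1\<close> keeps \<open>m\<close> positive when \<open>C = 0\<close>.\<close>
  define m where "m = C / \<epsilon> + 1"
  have "0 < m" using C(2) \<open>0 < \<epsilon>\<close> by (simp add: m_def add_nonneg_pos)
  obtain k where k: "0 < k" "AE x in lebesgue_on \<Omega>. \<forall>t\<ge>k. m * t \<le> \<phi> x t"
    using admissible_integrand_superlinear[OF adm] by blast
  have "(LINT x|lebesgue_on \<Omega>. (if norm (G n x) \<le> k then 0 else norm (G n x))) \<le> \<epsilon>" for n
  proof -
    let ?t = "\<lambda>x. if norm (G n x) \<le> k then 0 else norm (G n x)"
    have [measurable]: "G n \<in> borel_measurable (lebesgue_on \<Omega>)" using G[of n] by auto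
    have tm: "?t \<in> borel_measurable (lebesgue_on \<Omega>)" by measurable
    have ti: "integrable (lebesgue_on \<Omega>) ?t"
      by (rule Bochner_Integration.integrable_bound[OF G[of n] tm]) auto
    have "ennreal (LINT x|lebesgue_on \<Omega>. m * ?t x) = (\<integral>\<^sup>+x. ennreal (m * ?t x) \<partial>lebesgue_on \<Omega>)"
      using ti \<open>0 < m\<close> by (intro nn_integral_eq_integral[symmetric]) auto
    also have "\<dots> \<le> rho \<Omega> \<phi> (G n)"
      unfolding rho_def
    proof (rule nn_integral_mono_AE)
      show "AE x in lebesgue_on \<Omega>. ennreal (m * ?t x) \<le> ennreal (\<phi> x (norm (G n x)))"
        using k(2) by eventually_elim (auto intro: ennreal_leI)
    qed
    also have "\<dots> \<le> ennreal C" by (rule C)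
    finally have "m * (LINT x|lebesgue_on \<Omega>. ?t x) \<le> C" using C(2) by simp
    moreover have "C \<le> m * \<epsilon>" using \<open>0 < \<epsilon>\<close> by (simp add: m_def field_simps)
    ultimately have "m * (LINT x|lebesgue_on \<Omega>. ?t x) \<le> m * \<epsilon>" by linarith
    then show ?thesis using \<open>0 < m\<close> by simp
  qed
  then show ?thesis by blast
qed

text \<open>The norm is at most \<open>\<bar>k\<bar>\<close> plus its own tail; the absolute value
  covers a negative level \<open>k\<close>.\<close>

lemma uniformly_integrable_imp_L1_bounded:
  fixes G :: "'i \<Rightarrow> 'a \<Rightarrow> 'b::euclidean_space"
  assumes M: "finite_measure M" and G: "\<And>n. integrable M (G n)"
    and k: "\<And>n. (LINT x|M. (if norm (G n x) \<le> k then 0 else norm (G n x))) \<le> c"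
  shows "(LINT x|M. norm (G n x)) \<le> \<bar>k\<bar> * measure M (space M) + c"
proof -
  let ?t = "\<lambda>x. if norm (G n x) \<le> k then 0 else norm (G n x)"
  have [measurable]: "G n \<in> borel_measurable M" using G[of n] by auto
  have tm: "?t \<in> borel_measurable M" by measurable
  have ti: "integrable M ?t"
    by (rule Bochner_Integration.integrable_bound[OF G[of n] tm]) auto
  have c: "integrable M (\<lambda>x. \<bar>k\<bar>)" using M by (simp add: finite_measure.integrable_const)
  have "(LINT x|M. norm (G n x)) \<le> (LINT x|M. \<bar>k\<bar> + ?t x)"
    using G[of n] ti c by (intro integral_mono) auto
  also have "\<dots> = \<bar>k\<bar> * measure M (space M) + (LINT x|M. ?t x)"
    using ti c by (subst Bochner_Integration.integral_add) (auto simp: mult.commute)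
  finally show ?thesis using k[of n] by linarith
qed

lemma energy_bounds:
  assumes f: "f \<in> Lp_space 2 (lebesgue_on \<Omega>)" and u: "u \<in> X_space \<Omega> \<phi>" and E: "energy \<Omega> \<phi> f u \<le> C"
  shows "L2_inner (lebesgue_on \<Omega>) u u \<le> 4 * C + 2 * L2_inner (lebesgue_on \<Omega>) f f"
    "rho \<Omega> \<phi> (weak_gradient \<Omega> u) \<le> ennreal C" "0 \<le> C"
proof -
  let ?M = "lebesgue_on \<Omega>" and ?\<rho> = "rho \<Omega> \<phi> (weak_gradient \<Omega> u)"
  have u2: "u \<in> Lp_space 2 ?M" and fin: "?\<rho> < \<infinity>" using u by (auto simp: X_space_def)
  have N: "(Lp_norm 2 ?M (\<lambda>x. u x - f x))\<^sup>2 = L2_inner ?M (\<lambda>x. u x - f x) (\<lambda>x. u x - f x)"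
    by (simp add: Lp_norm_2 L2_inner_nonneg)
  have nn: "0 \<le> enn2real ?\<rho>" "0 \<le> L2_inner ?M (\<lambda>x. u x - f x) (\<lambda>x. u x - f x)"
    by (auto simp: L2_inner_nonneg)
  have le: "L2_inner ?M (\<lambda>x. u x - f x) (\<lambda>x. u x - f x) \<le> 2 * C" "enn2real ?\<rho> \<le> C"
    using E nn unfolding energy_def N by linarith+
  show "0 \<le> C" using le nn by linarith
  \<comment> \<open>\<open>enn2real\<close> sends infinity to \<open>0\<close>, so the finiteness
    contained in \<open>X_space\<close> is what makes the real bound informative.\<close>
  show "?\<rho> \<le> ennreal C" using le(2) fin by (metis ennreal_enn2real ennreal_leI infinity_ennreal_def)
  have "L2_inner ?M (\<lambda>x. u x - f x) (\<lambda>x. u x - f x) = L2_inner ?M u u - 2 * L2_inner ?M u f + L2_inner ?M f f"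
    using u2 f by (simp add: L2_inner_simps L2_inner_commute[of _ f u])
  \<comment> \<open>The square of \<open>u - 2 f\<close> equals twice that of \<open>u - f\<close>
    plus twice that of \<open>f\<close> minus that of \<open>u\<close>. Its nonnegativity gives the
    constants \<open>4 * C\<close> and \<open>2\<close>.\<close>
  moreover have "0 \<le> L2_inner ?M u u - 4 * L2_inner ?M u f + 4 * L2_inner ?M f f"
    using L2_inner_nonneg[of ?M "\<lambda>x. u x - 2 *\<^sub>R f x"] u2 f
    by (simp add: L2_inner_simps L2_inner_commute[of _ f u] algebra_simps del: real_scaleR_def)
  ultimately show "L2_inner ?M u u \<le> 4 * C + 2 * L2_inner ?M f f" using le(1) by linarith
qed

theorem lemma3p1:
  fixes \<Omega> :: "'a::euclidean_space set"
    and \<phi> :: "'a \<Rightarrow> real \<Rightarrow> real"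
    and f :: "'a \<Rightarrow> real"
    and u :: "nat \<Rightarrow> 'a \<Rightarrow> real"
    and C :: real
  assumes "bounded_lipschitz_domain \<Omega>"
    and "admissible_integrand \<Omega> \<phi>"
    and "f \<in> Lp_space 2 (lebesgue_on \<Omega>)"
    and "\<And>n. u n \<in> X_space \<Omega> \<phi>"
    and "(SUP n. ereal (energy \<Omega> \<phi> f (u n))) \<le> ereal C"
  shows "\<exists>(r :: nat \<Rightarrow> nat) w. strict_mono r \<and>
           w \<in> Lp_space 2 (lebesgue_on \<Omega>) \<inter> W11 \<Omega> \<and>
           Lp_strongly_tendsto 1 (lebesgue_on \<Omega>) (\<lambda>n. u (r n)) w \<and>
           Lp_weakly_tendsto 2 (lebesgue_on \<Omega>) (\<lambda>n. u (r n)) w \<and>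
           Lp_weakly_tendsto 1 (lebesgue_on \<Omega>)
             (\<lambda>n. weak_gradient \<Omega> (u (r n))) (weak_gradient \<Omega> w)"
proof -
  let ?M = "lebesgue_on \<Omega>"
  have \<Omega>: "open \<Omega>" "bounded \<Omega>" using assms(1) by (auto simp: bounded_lipschitz_domain_def)
  have fin: "finite_measure ?M" by (rule finite_measure_lebesgue_on_bounded[OF \<Omega>])
  define G where "G n = weak_gradient \<Omega> (u n)" for n
  have u2: "u n \<in> Lp_space 2 ?M" for n using assms(4)[of n] by (simp add: X_space_def)
  have u1: "integrable ?M (u n)" for n by (rule Lp_space_2_imp_integrable[OF fin u2])
  have "\<exists>g. has_weak_gradient \<Omega> (u n) g \<and> integrable ?M g" for n
    using assms(4)[of n] by (auto simp: X_space_def W11_def Lp_space_1_iff)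
  then have wg: "has_weak_gradient \<Omega> (u n) (G n)" and G1: "integrable ?M (G n)" for n
    unfolding G_def using integrable_weak_gradient[OF \<Omega>] by blast+
  have E: "energy \<Omega> \<phi> f (u n) \<le> C" for n
    using order_trans[OF SUP_upper assms(5), of n] by simp
  define B where "B = 4 * C + 2 * L2_inner ?M f f"
  have B: "L2_inner ?M (u n) (u n) \<le> B" and rho: "rho \<Omega> \<phi> (G n) \<le> ennreal C" and "0 \<le> C" for n
    using energy_bounds[OF assms(3,4) E] unfolding B_def G_def by auto
  have ui: "\<exists>k::real. \<forall>n. (LINT x|?M. (if norm (G n x) \<le> k then 0 else norm (G n x))) \<le> \<epsilon>" if "0 < \<epsilon>" for \<epsilon>
    by (rule rho_bounded_uniformly_integrable[OF assms(2) G1 rho \<open>0 \<le> C\<close> that])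
  obtain k where k: "(LINT x|?M. (if norm (G n x) \<le> k then 0 else norm (G n x))) \<le> 1" for n
    using ui[OF zero_less_one] by auto
  define A where "A = \<bar>k\<bar> * measure ?M (space ?M) + 1"
  have A: "(LINT x|?M. norm (G n x)) \<le> A" for n
    unfolding A_def by (rule uniformly_integrable_imp_L1_bounded[where G = G, OF fin G1 k])
  \<comment> \<open>A one-element index type specializes the compactness result to a single
    sequence.\<close>
  obtain r1 w where r1: "strict_mono (r1 :: nat \<Rightarrow> nat)" and w: "w \<in> Lp_space 2 ?M"
    and ulim1: "\<And>\<Lambda>. \<Lambda> \<in> Lp_dual 2 ?M \<Longrightarrow> (\<lambda>n. \<Lambda> (u (r1 n))) \<longlonglongrightarrow> \<Lambda> w"
    using weak_L2_compactness[OF fin, of "\<lambda>n (_::unit). u n" "\<lambda>_. B"] u2 B by auto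
  have "\<exists>k::real. \<forall>n. (LINT x|?M. (if norm (G (r1 n) x) \<le> k then 0 else norm (G (r1 n) x))) \<le> \<epsilon>" if "0 < \<epsilon>" for \<epsilon>
    using ui[OF that] by blast
  then obtain r2 g where r2: "strict_mono (r2 :: nat \<Rightarrow> nat)" and g: "integrable ?M g"
    and Glim1: "\<And>\<Lambda>. \<Lambda> \<in> Lp_dual 1 ?M \<Longrightarrow> (\<lambda>n. \<Lambda> (G (r1 (r2 n)))) \<longlonglongrightarrow> \<Lambda> g"
    using weak_L1_compactness[OF fin, of "\<lambda>n. G (r1 n)"] G1 by blast
  define r where "r = r1 \<circ> r2"
  have r: "strict_mono r" unfolding r_def using r1 r2 by (rule strict_mono_o)
  have ulim: "(\<lambda>n. \<Lambda> (u (r n))) \<longlonglongrightarrow> \<Lambda> w" if "\<Lambda> \<in> Lp_dual 2 ?M" for \<Lambda>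
    using LIMSEQ_subseq_LIMSEQ[OF ulim1[OF that] r2] by (simp add: r_def o_def)
  have Glim: "(\<lambda>n. \<Lambda> (G (r n))) \<longlonglongrightarrow> \<Lambda> g" if "\<Lambda> \<in> Lp_dual 1 ?M" for \<Lambda>
    using Glim1[OF that] by (simp add: r_def)
  have w1: "integrable ?M w" by (rule Lp_space_2_imp_integrable[OF fin w])
  \<comment> \<open>Up to here \<open>g\<close> is only a weak limit of gradients, with no relation
    to \<open>w\<close>.\<close>
  have wgw: "has_weak_gradient \<Omega> w g"
    by (rule has_weak_gradient_weak_limit[OF \<Omega> wg w g ulim Glim])
  have wW: "w \<in> W11 \<Omega>" using w1 g wgw by (auto simp: W11_def Lp_space_1_iff)
  define z where "z n = (\<lambda>x. u (r n) x - w x)" for n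
  define \<gamma> where "\<gamma> n = (\<lambda>x. G (r n) x - g x)" for n
  have "(\<lambda>n. LINT x|?M. \<bar>z n x\<bar>) \<longlonglongrightarrow> 0"
  proof (rule strong_L1_convergence[OF \<Omega>])
    show "z n \<in> Lp_space 2 ?M" for n unfolding z_def by (intro Lp_space_2_diff u2 w)
    show "has_weak_gradient \<Omega> (z n) (\<gamma> n)" for n
      unfolding z_def \<gamma>_def by (rule has_weak_gradient_diff[OF \<Omega>(1) wg wgw u1 G1 w1 g])
    show "integrable ?M (\<gamma> n)" for n unfolding \<gamma>_def using G1 g by simp
    show "(LINT x|?M. norm (\<gamma> n x)) \<le> A + (LINT x|?M. norm (g x))" for n
    proof -
      have "(LINT x|?M. norm (\<gamma> n x)) \<le> (LINT x|?M. norm (G (r n) x) + norm (g x))"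
        unfolding \<gamma>_def using G1 g by (intro integral_mono norm_triangle_ineq4) auto
      also have "\<dots> = (LINT x|?M. norm (G (r n) x)) + (LINT x|?M. norm (g x))"
        using G1 g by (intro Bochner_Integration.integral_add) auto
      finally show ?thesis using A[of "r n"] by linarith
    qed
    show "L2_inner ?M (z n) (z n) \<le> 2 * B + 2 * L2_inner ?M w w" for n
      using L2_inner_nonneg[of ?M "\<lambda>x. u (r n) x + w x"] B[of "r n"] u2 w
      by (simp add: z_def L2_inner_simps L2_inner_commute[of _ w "u (r n)"])
    show "(\<lambda>n. L2_inner ?M (z n) h) \<longlonglongrightarrow> 0" if h: "h \<in> Lp_space 2 ?M" for h
      using ulim[OF L2_inner_mem_Lp_dual[OF h]] u2 w h by (simp add: z_def L2_inner_simps LIM_zero_iff)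
  qed
  then have strong: "Lp_strongly_tendsto 1 ?M (\<lambda>n. u (r n)) w"
    using u1 w1 by (simp add: Lp_strongly_tendsto_def Lp_space_1_iff Lp_norm_1 z_def)
  have weak: "Lp_weakly_tendsto 2 ?M (\<lambda>n. u (r n)) w"
    using u2 w ulim by (simp add: Lp_weakly_tendsto_def)
  have wgrad: "integrable ?M (weak_gradient \<Omega> w)" and ae: "AE x in ?M. g x = weak_gradient \<Omega> w x"
    using integrable_weak_gradient[OF \<Omega> wgw g] by auto
  \<comment> \<open>The conclusion is about the chosen representative. It has
    \<open>L\<^sup>1\<close> distance zero from \<open>g\<close>, and boundedness of
    \<open>\<Lambda>\<close> makes the two values agree.\<close>
  have eq: "\<Lambda> g = \<Lambda> (weak_gradient \<Omega> w)" if \<Lambda>: "\<Lambda> \<in> Lp_dual 1 ?M" for \<Lambda>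
  proof -
    have sp: "g \<in> Lp_space 1 ?M" "weak_gradient \<Omega> w \<in> Lp_space 1 ?M"
      "(\<lambda>x. g x - weak_gradient \<Omega> w x) \<in> Lp_space 1 ?M"
      using g wgrad by (auto simp: Lp_space_1_iff)
    obtain K where K: "\<And>f. f \<in> Lp_space 1 ?M \<Longrightarrow> \<bar>\<Lambda> f\<bar> \<le> K * Lp_norm 1 ?M f"
      using \<Lambda> unfolding Lp_dual_def mem_Collect_eq by blast
    have "Lp_norm 1 ?M (\<lambda>x. g x - weak_gradient \<Omega> w x) = (LINT x|?M. 0)"
      unfolding Lp_norm_1 using ae sp(3)[unfolded Lp_space_1_iff]
      by (intro integral_cong_AE) (auto elim: eventually_mono)
    then have "\<bar>\<Lambda> (\<lambda>x. g x - weak_gradient \<Omega> w x)\<bar> \<le> 0" using K[OF sp(3)] by simp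
    then show ?thesis using L1_dual_diff[OF \<Lambda> sp(1,2)] by simp
  qed
  have "(\<lambda>n. \<Lambda> (G (r n))) \<longlonglongrightarrow> \<Lambda> (weak_gradient \<Omega> w)" if "\<Lambda> \<in> Lp_dual 1 ?M" for \<Lambda>
    using Glim[OF that] unfolding eq[OF that] .
  then have "Lp_weakly_tendsto 1 ?M (\<lambda>n. weak_gradient \<Omega> (u (r n))) (weak_gradient \<Omega> w)"
    using G1 wgrad by (simp add: Lp_weakly_tendsto_def Lp_space_1_iff G_def)
  with r w wW strong weak show ?thesis by blast
qed

end
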